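(* Let $(\Lambda_f,\eta)$ and $(\Lambda_{\widetilde f},\widetilde\eta)$ be two admissible irrational polygonal gratings, and let $\mathbf{G}$ be the unbounded connected component of $\Omega_f\cap\Omega_{\widetilde f}$. Fix $k>0$ and two distinct directions $\mathbf{d}_\ell=(\sin\theta_\ell,-\cos\theta_\ell)^\top$, $\theta_\ell\in(-\pi/2,\pi/2)$, $\ell=1,2$. Let $u(\cdot;k,\mathbf{d}_\ell)$, $\widetilde u(\cdot;k,\mathbf{d}_\ell)$ be the total fields for the two gratings. If $u(\mathbf{x};k,\mathbf{d}_\ell)=\widetilde u(\mathbf{x};k,\mathbf{d}_\ell)$ for all $\mathbf{x}\in\Gamma_b$ and $\ell=1,2$, then there is no corner point of $\Lambda_f$ lying on $\partial\mathbf{G}\setminus\Lambda_{\widetilde f}$, and no corner point of $\Lambda_{\widetilde f}$ lying on $\partial\mathbf{G}\setminus\Lambda_f$.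
   Context: For a $2\pi$-periodic Lipschitz $f:\mathbb{R}\to\mathbb{R}$, $\Lambda_f=\{(x_1,x_2):x_2=f(x_1)\}$ and $\Omega_f=\{x_2>f(x_1)\}$. For incident $u^i=e^{\mathrm{i}k\mathbf{d}\cdot\mathbf{x}}$, $\mathbf{d}=(\sin\theta,-\cos\theta)^\top$, $\theta\in(-\pi/2,\pi/2)$, the total field $u$ solves $\Delta u+k^2u=0$ in $\Omega_f$, $\partial_\nu u+\eta u=0$ on $\Lambda_f$ (with $u=0$ where $\eta=\infty$), is $\alpha$-quasiperiodic with $\alpha=k\sin\theta$, i.e. $u(x_1+2\pi,x_2)=e^{2\mathrm{i}\alpha\pi}u(x_1,x_2)$, and $u^s=u-u^i$ has the Rayleigh expansion $u^s=\sum_{n\in\mathbb{Z}}u_ne^{\mathrm{i}(\alpha_nx_1+\beta_nx_2)}$ for $x_2>\max f$, where $\alpha_n=n+k\sin\theta$, $\beta_n=\sqrt{k^2-\alpha_n^2}$ if $|\alpha_n|\le k$ and $\beta_n=\mathrm{i}\sqrt{\alpha_n^2-k^2}$ otherwise; this forward problem is assumed uniquely solvable. An admissible polygonal grating $(\Lambda_f,\eta)$: $f$ is piecewise linear in each period, and on each linear piece $\eta$ is a constant (possibly zero) or $\infty$. The intersection point of two adjacent pieces $\Gamma^\pm$ is a corner point and $\angle(\Gamma^+,\Gamma^-)$ the corner angle; the grating is irrational if every corner angle $\theta$ has $\theta/\pi$ irrational. $\Gamma_b=\{(x_1,b):0\le x_1\le2\pi\}$ with $b>\max|f|$ and $b>\max|\widetilde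 f|$. *)

theory Defs
  imports "HOL-Analysis.Analysis"
begin

definition Omega :: "(real \<Rightarrow> real) \<Rightarrow> (real \<times> real) set" where
  "Omega f = {p. snd p > f (fst p)}"

definition Lambda :: "(real \<Rightarrow> real) \<Rightarrow> (real \<times> real) set" where
  "Lambda f = {p. snd p = f (fst p)}"

text \<open>A polygonal grating is given by the profile f, the (2 pi-periodic) set C of
  x1-coordinates of the breakpoints between adjacent linear pieces, and the impedance
  eta on the pieces: Some e means the constant impedance e, None means eta = infinity
  (Dirichlet condition).  The corner points are the points (c, f c) with c in C.\<close>

definition admissible_polygonal_grating ::
  "(real \<Rightarrow> real) \<Rightarrow> real set \<Rightarrow> (real \<Rightarrow> complex option) \<Rightarrow> bool" where
  "admissible_polygonal_grating f C eta \<longleftrightarrow>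
     (\<forall>x. f (x + 2 * pi) = f x) \<and> continuous_on UNIV f \<and>
     (\<forall>x. x \<in> C \<longleftrightarrow> x + 2 * pi \<in> C) \<and> finite (C \<inter> {0..<2 * pi}) \<and>
     (\<forall>x. eta (x + 2 * pi) = eta x) \<and>
     (\<forall>a b. a < b \<and> {a<..<b} \<inter> C = {} \<longrightarrow>
        (\<exists>m q. \<forall>x\<in>{a<..<b}. f x = m * x + q) \<and> (\<exists>e. \<forall>x\<in>{a<..<b}. eta x = e))"

definition left_slope :: "(real \<Rightarrow> real) \<Rightarrow> real \<Rightarrow> real" where
  "left_slope f c = (THE m. \<exists>\<delta>>0. \<forall>x\<in>{c - \<delta><..<c}. f x = f c + m * (x - c))"

definition right_slope :: "(real \<Rightarrow> real) \<Rightarrow> real \<Rightarrow> real" where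
  "right_slope f c = (THE m. \<exists>\<delta>>0. \<forall>x\<in>{c<..<c + \<delta>}. f x = f c + m * (x - c))"

text \<open>Angle at the corner (c, f c) between the two adjacent pieces, measured through
  the domain Omega f (the angle from the right piece counterclockwise to the left piece).\<close>
definition corner_angle :: "(real \<Rightarrow> real) \<Rightarrow> real \<Rightarrow> real" where
  "corner_angle f c = pi + arctan (left_slope f c) - arctan (right_slope f c)"

definition irrational_grating :: "(real \<Rightarrow> real) \<Rightarrow> real set \<Rightarrow> bool" where
  "irrational_grating f C \<longleftrightarrow> (\<forall>c\<in>C. corner_angle f c / pi \<notin> \<rat>)"

definition incident :: "real \<Rightarrow> real \<Rightarrow> real \<times> real \<Rightarrow> complex" where
  "incident k \<theta> p = exp (\<i> * of_real k * of_real (sin \<theta> * fst p - cos \<theta> * snd p))"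

definition alpha_n :: "real \<Rightarrow> real \<Rightarrow> int \<Rightarrow> real" where
  "alpha_n k \<theta> n = of_int n + k * sin \<theta>"

definition beta_n :: "real \<Rightarrow> real \<Rightarrow> int \<Rightarrow> complex" where
  "beta_n k \<theta> n = (if \<bar>alpha_n k \<theta> n\<bar> \<le> k
      then complex_of_real (sqrt (k\<^sup>2 - (alpha_n k \<theta> n)\<^sup>2))
      else \<i> * complex_of_real (sqrt ((alpha_n k \<theta> n)\<^sup>2 - k\<^sup>2)))"

text \<open>u is a total field for the grating (f, C, eta), wave number k, incident angle theta:
  a classical C^2 solution of the Helmholtz equation in Omega f (u1, u2 are the partial
  derivatives, u11, u22 the pure second partials), continuous up to the boundary, locally H^1,
  satisfying the boundary condition on every linear piece (normal derivative with the unit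
  normal pointing into Omega f), alpha-quasiperiodic, with a Rayleigh expansion of the
  scattered field above the grating.\<close>

definition total_field ::
  "(real \<Rightarrow> real) \<Rightarrow> real set \<Rightarrow> (real \<Rightarrow> complex option) \<Rightarrow> real \<Rightarrow> real
    \<Rightarrow> (real \<times> real \<Rightarrow> complex) \<Rightarrow> bool" where
  "total_field f C eta k \<theta> u \<longleftrightarrow>
     continuous_on (closure (Omega f)) u \<and>
     (\<exists>u1 u2 u11 u22.
        continuous_on (Omega f) u1 \<and> continuous_on (Omega f) u2 \<and>
        continuous_on (Omega f) u11 \<and> continuous_on (Omega f) u22 \<and>
        (\<forall>p\<in>Omega f.
           ((\<lambda>t. u (t, snd p)) has_vector_derivative u1 p) (at (fst p)) \<and>
           ((\<lambda>t. u (fst p, t)) has_vector_derivative u2 p) (at (snd p)) \<and>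
           ((\<lambda>t. u1 (t, snd p)) has_vector_derivative u11 p) (at (fst p)) \<and>
           ((\<lambda>t. u2 (fst p, t)) has_vector_derivative u22 p) (at (snd p)) \<and>
           u11 p + u22 p + (of_real k)\<^sup>2 * u p = 0) \<and>
        (\<forall>R. nn_integral lborel
               (\<lambda>p. ennreal ((norm (u1 p))\<^sup>2 + (norm (u2 p))\<^sup>2)
                      * indicator (Omega f \<inter> ball 0 R) p) < \<infinity>) \<and>
        (\<forall>x. x \<notin> C \<longrightarrow>
           (case eta x of
              None \<Rightarrow> u (x, f x) = 0
            | Some e \<Rightarrow> (\<exists>g1 g2. (u1 \<longlongrightarrow> g1) (at (x, f x) within Omega f) \<and>
                                  (u2 \<longlongrightarrow> g2) (at (x, f x) within Omega f) \<and>
                                  (- of_real (deriv f x) * g1 + g2) / of_real (sqrt (1 + (deriv f x)\<^sup>2))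
                                    + e * u (x, f x) = 0)))) \<and>
     (\<forall>p\<in>Omega f. u (fst p + 2 * pi, snd p)
                    = exp (2 * \<i> * of_real (k * sin \<theta>) * of_real pi) * u p) \<and>
     (\<exists>c :: int \<Rightarrow> complex. \<forall>x1 x2. (\<forall>t. f t < x2) \<longrightarrow>
        ((\<lambda>n. c n * exp (\<i> * (of_real (alpha_n k \<theta> n * x1) + beta_n k \<theta> n * of_real x2)))
           has_sum (u (x1, x2) - incident k \<theta> (x1, x2))) UNIV)"

definition uniquely_solvable ::
  "(real \<Rightarrow> real) \<Rightarrow> real set \<Rightarrow> (real \<Rightarrow> complex option) \<Rightarrow> real \<Rightarrow> real \<Rightarrow> bool" where
  "uniquely_solvable f C eta k \<theta> \<longleftrightarrow>
     (\<exists>u. total_field f C eta k \<theta> u \<and>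
          (\<forall>v. total_field f C eta k \<theta> v \<longrightarrow> (\<forall>p\<in>Omega f. v p = u p)))"

end

theory Submission
  imports Defs
begin

text \<open>By uniqueness of Fourier coefficients the Rayleigh expansions of the two fields coincide, and
  unique continuation gives equality of the fields on \<open>G\<close>. At a corner of one grating lying strictly above
  the other one, the other total field solves the Helmholtz equation in a full neighbourhood and inherits
  the boundary conditions on both adjacent edges. For two incident directions, a nontrivial combination of
  the two fields vanishes at the corner; comparing its lowest angular modes on the two edges, the irrational
  corner angle forces it to vanish near the corner and hence everywhere, whereas fields with different
  incident directions are linearly independent: the incoming plane wave cannot be cancelled by
  outgoing modes.

  The local theory rests on Green's formula on circles against the functions
  \<open>J\<^sub>n (k r) cis (\<plusminus> n t)\<close>: it shows that the angular Fourier coefficients of a Helmholtz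
  solution are constant multiples of \<open>J\<^sub>n (k r)\<close>. This replaces real analyticity.\<close>

section \<open>Fourier coefficients on the circle\<close>

text \<open>The combination has to vanish at the corner because the constant mode carries no angular
  information, and through an impedance term it would disturb the first-order balance on the edges.
  That mode is governed by one complex number, the value at the corner, so two incident fields are
  just enough to remove it. The combination keeps the edge conditions: they are linear, and their
  coefficients do not depend on the incident direction.

  The smallness condition \<open>k\<^sup>2 * R\<^sup>2 \<le> 1\<close> appears throughout the local
  theory. On such discs the Bessel functions have no zero away from the centre and are comparable
  with \<open>r ^ n / fact n\<close> uniformly in \<open>n\<close>. This permits division by them
  and yields geometric decay of the angular modes, hence termwise limits.

  The global geometry is simple because two epigraphs intersect in an epigraph: \<open>G\<close> is
  the whole intersection, and a frontier point of \<open>G\<close> on one graph and off the other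
  lies strictly above the other.\<close>

definition fourier_coeff :: "(real \<Rightarrow> complex) \<Rightarrow> int \<Rightarrow> complex" where
  "fourier_coeff g m = integral {0..2 * pi} (\<lambda>t. g t * cis (- (of_int m * t)))"

lemma fourier_coeff_cong:
  assumes "\<And>t. t \<in> {0..2 * pi} \<Longrightarrow> g t = h t"
  shows "fourier_coeff g m = fourier_coeff h m"
  unfolding fourier_coeff_def using assms by (intro integral_cong) auto

lemma has_integral_cis_int:
  "((\<lambda>t. cis (of_int n * t)) has_integral (if n = 0 then 2 * pi else 0)) {0..2 * pi}"
proof (cases "n = 0")
  case True
  then show ?thesis
    using has_integral_const_real[of "1::complex" 0 "2 * pi"] by (simp add: scaleR_conv_of_real)
next
  case False
  have "((\<lambda>t. cis (of_int n * t)) has_integral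
      (cis (of_int n * (2 * pi)) / (\<i> * of_int n) - cis (of_int n * 0) / (\<i> * of_int n))) {0..2 * pi}"
  proof (rule fundamental_theorem_of_calculus)
    fix x :: real
    assume "x \<in> {0..2 * pi}"
    have "((\<lambda>z. exp (\<i> * of_int n * z) / (\<i> * of_int n)) has_field_derivative
        exp (\<i> * of_int n * of_real x)) (at (of_real x))"
      using False by (auto intro!: derivative_eq_intros)
    then have "((\<lambda>t. exp (\<i> * of_int n * of_real t) / (\<i> * of_int n)) has_vector_derivative
        exp (\<i> * of_int n * of_real x)) (at x within {0..2 * pi})"
      by (rule has_vector_derivative_real_field)
    then show "((\<lambda>t. cis (of_int n * t) / (\<i> * of_int n)) has_vector_derivative
        cis (of_int n * x)) (at x within {0..2 * pi})"
      by (simp add: cis_conv_exp mult.assoc)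
  qed auto
  moreover have "cis (of_int n * (2 * pi)) = 1"
    using cis_multiple_2pi[of "of_int n"] by (simp add: mult_ac)
  ultimately show ?thesis
    using False by simp
qed

text \<open>At \<open>t = 0\<close> the expansion shows that \<open>b\<close> is summable, and
  unconditional summability of complex numbers is absolute. The M-test then gives uniform
  convergence and allows termwise integration. The factor \<open>2 * pi\<close> appears because
  \<open>fourier_coeff\<close> is not normalised.\<close>

lemma fourier_coeff_has_sum:
  fixes b :: "int \<Rightarrow> complex"
  assumes "\<And>t. t \<in> {0..2 * pi} \<Longrightarrow> ((\<lambda>n::int. b n * cis (of_int n * t)) has_sum g t) UNIV"
  shows "fourier_coeff g m = 2 * pi * b m"
proof -
  have "(\<lambda>n. b n) summable_on UNIV"
    using assms[of 0] by (auto simp: summable_on_def)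
  then have sm: "(\<lambda>n. norm (b n)) summable_on UNIV"
    using summable_on_iff_abs_summable_on_complex by blast
  have hs: "((\<lambda>n::int. b n * cis (of_int n * t) * cis (- (of_int m * t))) has_sum
      (g t * cis (- (of_int m * t)))) UNIV" if "t \<in> {0..2 * pi}" for t
    using assms[OF that] by (rule has_sum_cmult_left)
  have ul: "uniform_limit {0..2 * pi}
      (\<lambda>F t. \<Sum>n\<in>F. b n * cis (of_int n * t) * cis (- (of_int m * t)))
      (\<lambda>t. g t * cis (- (of_int m * t))) (finite_subsets_at_top UNIV)"
    by (rule Weierstrass_m_test_general'[OF _ hs sm]) (auto simp: norm_mult)
  obtain I J where I: "\<And>F. ((\<lambda>t. \<Sum>n\<in>F. b n * cis (of_int n * t) * cis (- (of_int m * t))) has_integral I F) {0..2 * pi}"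
    and J: "((\<lambda>t. g t * cis (- (of_int m * t))) has_integral J) {0..2 * pi}"
    and lim: "(I \<longlongrightarrow> J) (finite_subsets_at_top UNIV)"
    by (rule uniform_limit_integral[OF ul]) (auto intro!: continuous_intros simp: cis_conv_exp)
  have I_eq: "I F = 2 * pi * b m" if "finite F" "m \<in> F" for F
  proof -
    have "((\<lambda>t. \<Sum>n\<in>F. b n * cis (of_int (n - m) * t)) has_integral
        (\<Sum>n\<in>F. b n * (if n - m = 0 then 2 * pi else 0))) {0..2 * pi}"
      by (intro has_integral_sum has_integral_mult_right has_integral_cis_int that)
    moreover have "(\<Sum>n\<in>F. b n * (if n - m = 0 then 2 * pi else 0)) = (\<Sum>n\<in>F. if n = m then 2 * pi * b n else 0)"
      by (rule sum.cong) auto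
    moreover have "\<dots> = 2 * pi * b m"
      using that by simp
    moreover have "(\<lambda>t. \<Sum>n\<in>F. b n * cis (of_int (n - m) * t)) =
        (\<lambda>t. \<Sum>n\<in>F. b n * cis (of_int n * t) * cis (- (of_int m * t)))"
      by (intro ext sum.cong refl) (simp add: cis_mult left_diff_distrib mult.assoc)
    ultimately show ?thesis
      using has_integral_unique[OF I[of F]] by simp
  qed
  have "\<forall>\<^sub>F F in finite_subsets_at_top UNIV. I F = 2 * pi * b m"
    unfolding eventually_finite_subsets_at_top
    by (intro exI[of _ "{m}"]) (simp add: I_eq)
  then have "(I \<longlongrightarrow> 2 * pi * b m) (finite_subsets_at_top UNIV)"
    by (rule tendsto_eventually)
  then have "J = 2 * pi * b m"
    using lim by (rule tendsto_unique[OF finite_subsets_at_top_neq_bot, rotated])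
  then show ?thesis
    using J unfolding fourier_coeff_def by blast
qed

text \<open>Periodic functions are written as \<open>G (cis t)\<close> with \<open>G\<close>
  continuous on the unit circle: periodicity is built in, and the compact circle is a domain for
  Stone-Weierstrass.\<close>

lemma continuous_on_circle_cis:
  fixes G :: "complex \<Rightarrow> complex"
  assumes "continuous_on (sphere 0 1) G"
  shows "continuous_on {0..2 * pi} (\<lambda>t. G (cis t))"
  by (rule continuous_on_compose2[OF assms]) (auto intro!: continuous_intros simp: cis_conv_exp)

lemma fourier_coeff_integrable:
  fixes G :: "complex \<Rightarrow> complex"
  assumes "continuous_on (sphere 0 1) G"
  shows "(\<lambda>t. G (cis t) * cis (- (of_int m * t))) integrable_on {0..2 * pi}"
  using continuous_on_circle_cis[OF assms]
  by (intro integrable_continuous_real continuous_intros) (auto simp: cis_conv_exp intro!: continuous_intros)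

lemma fourier_coeff_add:
  assumes "continuous_on (sphere 0 1) G" "continuous_on (sphere 0 1) H"
  shows "fourier_coeff (\<lambda>t. G (cis t) + H (cis t)) m =
    fourier_coeff (\<lambda>t. G (cis t)) m + fourier_coeff (\<lambda>t. H (cis t)) m"
  unfolding fourier_coeff_def
  by (simp add: distrib_right integral_add fourier_coeff_integrable assms)

lemma fourier_coeff_mult:
  "fourier_coeff (\<lambda>t. c * g t) m = c * fourier_coeff g m"
  unfolding fourier_coeff_def by (simp add: mult.assoc)

lemma fourier_coeff_cis:
  "fourier_coeff (\<lambda>t. cis (of_int n * t) * g t) m = fourier_coeff g (m - n)"
  unfolding fourier_coeff_def
  by (rule integral_cong) (simp add: cis_mult algebra_simps flip: mult.assoc)

text \<open>On the unit circle a real-linear functional has the form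
  \<open>A * z + B * inverse z\<close>, so multiplying by it shifts Fourier indices by one in either
  direction. \<open>G\<close> is generalised in the induction because a product applies the
  hypothesis for one factor to the other factor times \<open>G\<close>.\<close>

lemma real_polynomial_mult_fourier_coeff_zero:
  fixes p :: "complex \<Rightarrow> real"
  assumes "real_polynomial_function p"
    and "continuous_on (sphere 0 1) G" "\<And>m. fourier_coeff (\<lambda>t. G (cis t)) m = 0"
  shows "fourier_coeff (\<lambda>t. of_real (p (cis t)) * G (cis t)) m = 0"
  using assms
proof (induction p arbitrary: G m rule: real_polynomial_function.induct)
  case (linear p)
  interpret p: bounded_linear p by fact
  define A where "A = (complex_of_real (p 1) - \<i> * of_real (p \<i>)) / 2"
  define B where "B = (complex_of_real (p 1) + \<i> * of_real (p \<i>)) / 2"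
  have eq: "of_real (p (cis t)) = A * cis (of_int 1 * t) + B * cis (of_int (-1) * t)" for t
  proof -
    have c: "cis t = cos t *\<^sub>R 1 + sin t *\<^sub>R \<i>"
      by (simp add: complex_eq_iff)
    have "p (cis t) = cos t * p 1 + sin t * p \<i>"
      by (subst c) (simp add: p.add p.scaleR)
    then show ?thesis
      by (simp add: A_def B_def complex_eq_iff) (simp add: field_simps)
  qed
  have cont: "continuous_on (sphere 0 1) (\<lambda>z. z * G z)" "continuous_on (sphere 0 1) (\<lambda>z. inverse z * G z)"
    using linear by (auto intro!: continuous_intros)
  have "fourier_coeff (\<lambda>t. of_real (p (cis t)) * G (cis t)) m =
      fourier_coeff (\<lambda>t. A * (cis t * G (cis t)) + B * (inverse (cis t) * G (cis t))) m"
    by (rule fourier_coeff_cong) (simp only: eq, simp add: cis_inverse algebra_simps)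
  also have "\<dots> = A * fourier_coeff (\<lambda>t. cis t * G (cis t)) m
      + B * fourier_coeff (\<lambda>t. inverse (cis t) * G (cis t)) m"
    using fourier_coeff_add[of "\<lambda>z. A * (z * G z)" "\<lambda>z. B * (inverse z * G z)" m]
    using linear(2) cont by (simp add: continuous_on_mult_left fourier_coeff_mult)
  also have "\<dots> = 0"
    using fourier_coeff_cis[of 1 "\<lambda>t. G (cis t)" m] fourier_coeff_cis[of "-1" "\<lambda>t. G (cis t)" m] linear(3)
    by (simp add: cis_inverse)
  finally show ?case .
next
  case (const c)
  then show ?case by (simp add: fourier_coeff_mult)
next
  case (add f g)
  have "continuous_on (sphere 0 1) (\<lambda>z. of_real (f z) * G z)"
    "continuous_on (sphere 0 1) (\<lambda>z. of_real (g z) * G z)"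
    using add.hyps add.prems
    by (auto intro!: continuous_intros simp: real_polynomial_function_eq continuous_on_polymonial_function)
  from fourier_coeff_add[OF this, of m] add show ?case
    by (simp add: distrib_right)
next
  case (mult f g)
  have "continuous_on (sphere 0 1) (\<lambda>z. of_real (g z) * G z)"
    using mult.hyps mult.prems
    by (auto intro!: continuous_intros simp: real_polynomial_function_eq continuous_on_polymonial_function)
  from mult.IH(1)[OF this] mult.IH(2)[OF mult.prems] show ?case
    by (simp add: mult.assoc)
qed

text \<open>For a polynomial \<open>p\<close> uniformly within \<open>e\<close> of the conjugate of
  \<open>G\<close>, the integral of \<open>p G\<close> vanishes, so the squared L2 norm of
  \<open>G\<close> is the integral of \<open>(cnj G - p) G\<close> and at most \<open>e\<close>
  times its L1 norm. Continuity turns L2 norm zero into pointwise zero.\<close>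

lemma fourier_coeff_zero_imp_zero:
  fixes G :: "complex \<Rightarrow> complex"
  assumes G: "continuous_on (sphere 0 1) G" and zero: "\<And>m. fourier_coeff (\<lambda>t. G (cis t)) m = 0"
    and z: "z \<in> sphere 0 1"
  shows "G z = 0"
proof -
  have "(Re z)\<^sup>2 + (Im z)\<^sup>2 = 1"
    using z by (simp add: norm_complex_def)
  then obtain t where t': "0 \<le> t" "t < 2 * pi" "Re z = cos t" "Im z = sin t"
    by (rule sincos_total_2pi)
  then have t: "t \<in> {0..2 * pi}" and zt: "z = cis t"
    by (auto simp: complex_eq_iff)
  note contG = continuous_on_circle_cis[OF G]
  define I1 where "I1 = integral {0..2 * pi} (\<lambda>t. norm (G (cis t)))"
  define I2 where "I2 = integral {0..2 * pi} (\<lambda>t. (norm (G (cis t)))\<^sup>2)"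
  have int1: "(\<lambda>t. norm (G (cis t))) integrable_on {0..2 * pi}"
    and int2: "(\<lambda>t. (norm (G (cis t)))\<^sup>2) integrable_on {0..2 * pi}"
    using contG by (auto intro!: integrable_continuous_real continuous_intros)
  have I2_le: "I2 \<le> e * I1" if "e > 0" for e
  proof -
    have "continuous_on (sphere 0 1) (\<lambda>z. cnj (G z))"
      using G by (intro continuous_intros)
    then obtain p :: "complex \<Rightarrow> complex" where p: "polynomial_function p"
      and close: "\<And>z. z \<in> sphere 0 1 \<Longrightarrow> norm (cnj (G z) - p z) < e"
      using Stone_Weierstrass_polynomial_function[OF _ _ \<open>e > 0\<close>, of "sphere 0 1" "\<lambda>z. cnj (G z)"]
        compact_sphere by blast
    have reim: "real_polynomial_function (\<lambda>z. Re (p z))" "real_polynomial_function (\<lambda>z. Im (p z))"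
      using p bounded_linear_Re bounded_linear_Im unfolding polynomial_function_def o_def by blast+
    have cp: "continuous_on (sphere 0 1) p"
      using p by (rule continuous_on_polymonial_function)
    have "continuous_on (sphere 0 1) (\<lambda>z. of_real (Re (p z)) * G z)"
      "continuous_on (sphere 0 1) (\<lambda>z. \<i> * (of_real (Im (p z)) * G z))"
      using cp G by (auto intro!: continuous_intros)
    from fourier_coeff_add[OF this, of 0]
    have "fourier_coeff (\<lambda>t. of_real (Re (p (cis t))) * G (cis t) + \<i> * (of_real (Im (p (cis t))) * G (cis t))) 0 = 0"
      using real_polynomial_mult_fourier_coeff_zero[OF reim(1) G zero]
        real_polynomial_mult_fourier_coeff_zero[OF reim(2) G zero]
      by (simp add: fourier_coeff_mult)
    also have "(\<lambda>t. of_real (Re (p (cis t))) * G (cis t) + \<i> * (of_real (Im (p (cis t))) * G (cis t)))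
        = (\<lambda>t. p (cis t) * G (cis t))"
      by (rule ext) (metis complex_eq mult.assoc distrib_right)
    finally have int0: "integral {0..2 * pi} (\<lambda>t. p (cis t) * G (cis t)) = 0"
      by (simp add: fourier_coeff_def)
    have "(\<lambda>t. p (cis t) * G (cis t)) integrable_on {0..2 * pi}"
      using contG continuous_on_circle_cis[OF cp]
      by (intro integrable_continuous_real continuous_intros)
    then have pG: "((\<lambda>t. p (cis t) * G (cis t)) has_integral 0) {0..2 * pi}"
      using int0 by (metis integrable_integral)
    have "((\<lambda>t. of_real ((norm (G (cis t)))\<^sup>2)) has_integral complex_of_real I2) {0..2 * pi}"
      using int2 unfolding I2_def by (intro has_integral_of_real integrable_integral)
    from has_integral_diff[OF this pG]
    have d: "((\<lambda>t. (cnj (G (cis t)) - p (cis t)) * G (cis t)) has_integral of_real I2) {0..2 * pi}"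
      by (simp only: complex_norm_square) (simp add: algebra_simps)
    have "norm (complex_of_real I2) \<le> e * I1"
    proof -
      have "norm (integral {0..2 * pi} (\<lambda>t. (cnj (G (cis t)) - p (cis t)) * G (cis t)))
          \<le> integral {0..2 * pi} (\<lambda>t. e * norm (G (cis t)))"
      proof (rule integral_norm_bound_integral)
        show "(\<lambda>t. (cnj (G (cis t)) - p (cis t)) * G (cis t)) integrable_on {0..2 * pi}"
          using d by blast
        show "(\<lambda>t. e * norm (G (cis t))) integrable_on {0..2 * pi}"
          using int1 by (rule integrable_on_mult_right)
        show "norm ((cnj (G (cis t)) - p (cis t)) * G (cis t)) \<le> e * norm (G (cis t))" for t
          using close[of "cis t"] by (simp add: norm_mult mult_right_mono)
      qed
      then show ?thesis
        using d by (simp add: I1_def integral_unique)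
    qed
    then show ?thesis by simp
  qed
  have "I1 \<ge> 0"
    unfolding I1_def by (rule integral_nonneg[OF int1]) auto
  have "I2 \<le> 0"
  proof (rule field_le_epsilon)
    fix e :: real
    assume "e > 0"
    \<comment> \<open>Adding 1 to \<open>I1\<close> keeps the denominator positive even if the L1
      norm is zero.\<close>
    then have "e / (I1 + 1) > 0" using \<open>I1 \<ge> 0\<close> by simp
    from I2_le[OF this] have "I2 \<le> e * (I1 / (I1 + 1))" by simp
    also have "\<dots> \<le> e * 1" using \<open>I1 \<ge> 0\<close> \<open>e > 0\<close> by (intro mult_left_mono) (auto simp: field_simps)
    finally show "I2 \<le> 0 + e" by simp
  qed
  moreover have "I2 \<ge> 0"
    unfolding I2_def by (rule integral_nonneg[OF int2]) auto
  ultimately have "((\<lambda>t. (norm (G (cis t)))\<^sup>2) has_integral 0) (cbox 0 (2 * pi))"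
    using int2 unfolding I2_def by (simp add: has_integral_iff)
  then have "(norm (G (cis t)))\<^sup>2 = 0"
    using t contG
    by (intro has_integral_0_cbox_imp_0[of 0 "2 * pi" "\<lambda>t. (norm (G (cis t)))\<^sup>2"])
      (use pi_gt_zero in \<open>auto intro!: continuous_intros simp del: pi_gt_zero simp: not_le\<close>)
  then show ?thesis by (simp add: zt)
qed

text \<open>The Fourier series converges uniformly to a continuous function \<open>S\<close> with
  the same coefficients as \<open>G\<close>, so the uniqueness result forces
  \<open>G = S\<close>.\<close>

lemma fourier_inversion_abs_summable:
  fixes G :: "complex \<Rightarrow> complex"
  assumes G: "continuous_on (sphere 0 1) G"
    and M: "M summable_on UNIV" "\<And>m. norm (fourier_coeff (\<lambda>t. G (cis t)) m) \<le> M m"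
  shows "((\<lambda>m. fourier_coeff (\<lambda>t. G (cis t)) m / (2 * pi) * cis (of_int m * t)) has_sum G (cis t)) UNIV"
proof -
  define b where "b m = fourier_coeff (\<lambda>t. G (cis t)) m / (2 * pi)" for m
  have bM: "norm (b m) \<le> M m / (2 * pi)" for m
    using M(2)[of m] by (simp add: b_def norm_divide divide_right_mono)
  have sM: "(\<lambda>m. M m / (2 * pi)) summable_on UNIV"
    unfolding divide_inverse by (rule summable_on_cmult_left[OF M(1)])
  define S where "S z = (\<Sum>\<^sub>\<infinity>m. b m * z powi m)" for z
  have le: "norm (b m * z powi m) \<le> M m / (2 * pi)" if "z \<in> sphere 0 1" for m z
    using bM[of m] that by (simp add: norm_mult norm_power_int)
  have ul: "uniform_limit (sphere 0 1) (\<lambda>F z. \<Sum>m\<in>F. b m * z powi m) S (finite_subsets_at_top UNIV)"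
    unfolding S_def by (rule Weierstrass_m_test_general[OF le sM])
  have contS: "continuous_on (sphere 0 1) S"
    by (rule uniform_limit_theorem[OF _ ul])
      (auto intro!: always_eventually continuous_intros)
  have hs: "((\<lambda>m. b m * cis (of_int m * t)) has_sum S (cis t)) UNIV" for t
  proof -
    have "(\<lambda>m. b m * cis t powi m) summable_on UNIV"
      by (rule abs_summable_summable, rule Infinite_Sum.abs_summable_on_comparison_test'[OF sM]) (use le[of "cis t"] in auto)
    then show ?thesis
      unfolding S_def by (simp add: cis_power_int)
  qed
  have "fourier_coeff (\<lambda>t. S (cis t)) m = fourier_coeff (\<lambda>t. G (cis t)) m" for m
    using fourier_coeff_has_sum[OF hs, of m] by (simp add: b_def)
  moreover have "continuous_on (sphere 0 1) (\<lambda>z. (-1) * S z)" 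
    using contS by (intro continuous_intros)
  ultimately have "fourier_coeff (\<lambda>t. G (cis t) + (-1) * S (cis t)) m = 0" for m
    using fourier_coeff_add[OF G, of "\<lambda>z. (-1) * S z" m] by (simp only: fourier_coeff_mult) simp
  from fourier_coeff_zero_imp_zero[of "\<lambda>z. G z + (-1) * S z", OF _ this, of "cis t"] G contS
  have "G (cis t) = S (cis t)"
    by (auto intro!: continuous_intros)
  then show ?thesis using hs[of t] by (simp add: b_def)
qed

section \<open>Green's formula on circles\<close>

definition helmholtz_witness ::
  "real \<Rightarrow> (real \<times> real) set \<Rightarrow> (real \<times> real \<Rightarrow> complex) \<Rightarrow> (real \<times> real \<Rightarrow> complex)
    \<Rightarrow> (real \<times> real \<Rightarrow> complex) \<Rightarrow> (real \<times> real \<Rightarrow> complex) \<Rightarrow> (real \<times> real \<Rightarrow> complex) \<Rightarrow> bool"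
  where
  "helmholtz_witness k S w w1 w2 w11 w22 \<longleftrightarrow>
     continuous_on S w1 \<and> continuous_on S w2 \<and> continuous_on S w11 \<and> continuous_on S w22 \<and>
     (\<forall>p\<in>S.
         ((\<lambda>t. w (t, snd p)) has_vector_derivative w1 p) (at (fst p)) \<and>
         ((\<lambda>t. w (fst p, t)) has_vector_derivative w2 p) (at (snd p)) \<and>
         ((\<lambda>t. w1 (t, snd p)) has_vector_derivative w11 p) (at (fst p)) \<and>
         ((\<lambda>t. w2 (fst p, t)) has_vector_derivative w22 p) (at (snd p)) \<and>
         w11 p + w22 p + (of_real k)\<^sup>2 * w p = 0)"

text \<open>The second partials are quantified away while the gradient stays visible, because the
  boundary conditions speak about \<open>w\<close>, \<open>w1\<close> and \<open>w2\<close>.\<close>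

definition helmholtz ::
  "real \<Rightarrow> (real \<times> real) set \<Rightarrow> (real \<times> real \<Rightarrow> complex) \<Rightarrow> (real \<times> real \<Rightarrow> complex)
    \<Rightarrow> (real \<times> real \<Rightarrow> complex) \<Rightarrow> bool" where
  "helmholtz k S w w1 w2 \<longleftrightarrow> (\<exists>w11 w22. helmholtz_witness k S w w1 w2 w11 w22)"

lemma helmholtz_witnessD:
  assumes "helmholtz_witness k S w w1 w2 w11 w22"
  shows "continuous_on S w1" "continuous_on S w2" "continuous_on S w11" "continuous_on S w22"
    and "p \<in> S \<Longrightarrow> ((\<lambda>t. w (t, snd p)) has_vector_derivative w1 p) (at (fst p))"
    and "p \<in> S \<Longrightarrow> ((\<lambda>t. w (fst p, t)) has_vector_derivative w2 p) (at (snd p))"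
    and "p \<in> S \<Longrightarrow> ((\<lambda>t. w1 (t, snd p)) has_vector_derivative w11 p) (at (fst p))"
    and "p \<in> S \<Longrightarrow> ((\<lambda>t. w2 (fst p, t)) has_vector_derivative w22 p) (at (snd p))"
    and "p \<in> S \<Longrightarrow> w11 p + w22 p + (of_real k)\<^sup>2 * w p = 0"
  using assms unfolding helmholtz_witness_def by simp_all

lemma helmholtzE:
  assumes "helmholtz k S w w1 w2"
  obtains w11 w22 where "helmholtz_witness k S w w1 w2 w11 w22"
  using assms unfolding helmholtz_def by metis

lemma helmholtz_continuous_on_gradient:
  assumes "helmholtz k S w w1 w2"
  shows "continuous_on S w1" "continuous_on S w2"
  using assms by (meson helmholtzE helmholtz_witnessD)+

definition polar :: "real \<Rightarrow> real \<Rightarrow> real \<times> real" where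
  "polar r t = (r * cos t, r * sin t)"

text \<open>Passes from separate partial derivatives to a total derivative, as required by the chain
  rule along circles and rays. Working within a rectangle covers closed squares as well, where
  derivatives at the edges are one-sided.\<close>

lemma has_derivative_partials_rectangle:
  fixes w :: "real \<times> real \<Rightarrow> 'b::real_normed_vector"
  assumes w1: "((\<lambda>t. w (t, y)) has_vector_derivative w1) (at x within X)"
    and w2: "\<And>p. p \<in> X \<times> Y \<Longrightarrow> ((\<lambda>t. w (fst p, t)) has_vector_derivative w2 p) (at (snd p) within Y)"
    and cont: "continuous_on (X \<times> Y) w2" and "convex Y" "x \<in> X" "y \<in> Y"
  shows "(w has_derivative (\<lambda>h. fst h *\<^sub>R w1 + snd h *\<^sub>R w2 (x, y))) (at (x, y) within X \<times> Y)"
proof -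
  have "((\<lambda>(x, y). w (x, y)) has_derivative
      (\<lambda>(tx, ty). tx *\<^sub>R w1 + blinfun_apply (blinfun_scaleR_left (w2 (x, y))) ty)) (at (x, y) within X \<times> Y)"
  proof (rule has_derivative_partialsI[where fy = "\<lambda>x y. blinfun_scaleR_left (w2 (x, y))"])
    show "((\<lambda>x. w (x, y)) has_derivative (\<lambda>tx. tx *\<^sub>R w1)) (at x within X)"
      using w1 by (simp add: has_vector_derivative_def)
    show "((\<lambda>y. w (x, y)) has_derivative blinfun_apply (blinfun_scaleR_left (w2 (x, y)))) (at y within Y)"
      if "x \<in> X" "y \<in> Y" for x y
      using w2[of "(x, y)"] that by (simp add: has_vector_derivative_def)
    have "continuous (at (x, y) within X \<times> Y) w2"
      using cont assms(5,6) by (simp add: continuous_on_eq_continuous_within)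
    then show "continuous (at (x, y) within X \<times> Y) (\<lambda>(x, y). blinfun_scaleR_left (w2 (x, y)))"
      using bounded_linear.continuous[OF bounded_linear_blinfun_scaleR_left] by (simp add: split_beta')
  qed (use assms in auto)
  then show ?thesis by (simp add: split_beta')
qed

lemma polar_has_vector_derivative:
  "((\<lambda>t. polar r t) has_vector_derivative (- (r * sin t), r * cos t)) (at t within T)"
  "((\<lambda>r. polar r t) has_vector_derivative (cos t, sin t)) (at r within T)"
  unfolding polar_def
  by (auto intro!: has_vector_derivative_Pair derivative_eq_intros
      simp: has_real_derivative_iff_has_vector_derivative[symmetric])

lemma polar_in_square:
  assumes "0 \<le> r" "r < R"
  shows "polar r t \<in> {-R<..<R} \<times> {-R<..<R}"
proof -
  have "\<bar>r * cos t\<bar> \<le> r * 1" "\<bar>r * sin t\<bar> \<le> r * 1"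
    unfolding abs_mult using assms(1) by (intro mult_mono; simp)+
  then show ?thesis using assms by (auto simp: polar_def)
qed

text \<open>The form \<open>F1 dy - F2 dx\<close> is closed, and integration along L-shaped paths from the
  lower left corner gives a primitive \<open>P\<close>. Neither mixed derivatives nor integration over the
  disc are needed.\<close>

lemma integral_flux_circle_eq_0:
  fixes F1 F2 A B :: "real \<times> real \<Rightarrow> complex"
  defines "Q R \<equiv> {-R..R} \<times> {-R..R}"
  assumes F: "continuous_on (Q R) F1" "continuous_on (Q R) F2"
    and AB: "continuous_on (Q R) A" "continuous_on (Q R) B"
    and dF: "\<And>p. p \<in> Q R \<Longrightarrow> ((\<lambda>t. F1 (t, snd p)) has_vector_derivative A p) (at (fst p))"
      "\<And>p. p \<in> Q R \<Longrightarrow> ((\<lambda>t. F2 (fst p, t)) has_vector_derivative B p) (at (snd p))"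
    and zero: "\<And>p. p \<in> Q R \<Longrightarrow> A p + B p = 0"
    and r: "0 \<le> r" "r < R"
  shows "integral {0..2 * pi} (\<lambda>t. r * (F1 (polar r t) * of_real (cos t) + F2 (polar r t) * of_real (sin t))) = 0"
proof -
  define P where "P p = integral {-R..snd p} (\<lambda>t. F1 (-R, t)) - integral {-R..fst p} (\<lambda>s. F2 (s, snd p))"
    for p :: "real \<times> real"
  have sec: "continuous_on {-R..x} (\<lambda>s. F (s, y))" "continuous_on {-R..y} (\<lambda>s. F (x, s))"
    if "continuous_on (Q R) F" "(x, y) \<in> Q R" for x y and F :: "real \<times> real \<Rightarrow> complex"
    by (rule continuous_on_compose2[OF that(1)]; (intro continuous_intros | use that(2) in \<open>auto simp: Q_def\<close>))+
  have sec': "continuous_on {-R..R} (\<lambda>s. F (s, y))" "continuous_on {-R..R} (\<lambda>s. F (y, s))"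
    if "continuous_on (Q R) F" "y \<in> {-R..R}" for y and F :: "real \<times> real \<Rightarrow> complex"
    by (rule continuous_on_compose2[OF that(1)]; (intro continuous_intros | use that(2) in \<open>auto simp: Q_def\<close>))+
  have P1: "((\<lambda>t. P (t, snd p)) has_vector_derivative - F2 p) (at (fst p) within {-R..R})"
    if "p \<in> Q R" for p
  proof -
    have "((\<lambda>u. integral {-R..u} (\<lambda>s. F2 (s, snd p))) has_vector_derivative F2 (fst p, snd p))
        (at (fst p) within {-R..R})"
      by (rule integral_has_vector_derivative) (use that sec' F in \<open>auto simp: Q_def\<close>)
    then show ?thesis
      unfolding P_def by (auto intro!: derivative_eq_intros)
  qed
  have P2: "((\<lambda>t. P (fst p, t)) has_vector_derivative F1 p) (at (snd p) within {-R..R})"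
    if p: "p \<in> Q R" for p
  proof -
    obtain x y where xy: "p = (x, y)" by force
    then have xy_in: "x \<in> {-R..R}" "y \<in> {-R..R}" using p by (auto simp: Q_def)
    have 1: "((\<lambda>u. integral {-R..u} (\<lambda>s. F1 (-R, s))) has_vector_derivative F1 (-R, y))
        (at y within {-R..R})"
      by (rule integral_has_vector_derivative) (use xy_in sec' F r in \<open>auto simp: Q_def\<close>)
    have "((\<lambda>u. integral (cbox (-R) x) (\<lambda>s. F2 (s, u))) has_vector_derivative
        integral (cbox (-R) x) (\<lambda>s. B (s, y))) (at y within {-R..R})"
    proof (rule leibniz_rule_vector_derivative)
      show "((\<lambda>u. F2 (s, u)) has_vector_derivative B (s, u)) (at u within {-R..R})"
        if "u \<in> {-R..R}" "s \<in> cbox (-R) x" for u s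
        using dF(2)[of "(s, u)"] that xy_in by (auto simp: Q_def intro: has_vector_derivative_at_within)
      show "(\<lambda>s. F2 (s, u)) integrable_on cbox (-R) x" if "u \<in> {-R..R}" for u
        using sec(1)[OF F(2), of x u] xy_in that
        by (auto simp: Q_def intro!: integrable_continuous_real)
      show "continuous_on ({-R..R} \<times> cbox (-R) x) (\<lambda>(u, s). B (s, u))"
        unfolding case_prod_beta
        by (rule continuous_on_compose2[OF AB(2)]) (use xy_in in \<open>auto simp: Q_def intro!: continuous_intros\<close>)
    qed (use xy_in in auto)
    moreover have "((\<lambda>s. A (s, y)) has_integral (F1 (x, y) - F1 (-R, y))) {-R..x}"
    proof (rule fundamental_theorem_of_calculus)
      show "((\<lambda>s. F1 (s, y)) has_vector_derivative A (s, y)) (at s within {-R..x})" if "s \<in> {-R..x}" for s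
        using dF(1)[of "(s, y)"] that xy_in by (auto simp: Q_def intro: has_vector_derivative_at_within)
    qed (use xy_in in auto)
    \<comment> \<open>With \<open>B = - A\<close> the differentiated inner integral becomes a
      difference of values of \<open>F1\<close>; its value on the left edge cancels the derivative
      of the first term of \<open>P\<close>.\<close>
    moreover have "integral {-R..x} (\<lambda>s. B (s, y)) = integral {-R..x} (\<lambda>s. - A (s, y))"
      by (rule integral_cong) (use zero xy_in in \<open>force simp: Q_def add_eq_0_iff\<close>)
    ultimately have 2: "((\<lambda>u. integral {-R..x} (\<lambda>s. F2 (s, u))) has_vector_derivative
        - (F1 (x, y) - F1 (-R, y))) (at y within {-R..R})"
      by (simp add: integral_unique)
    show ?thesis
      unfolding P_def xy fst_conv snd_conv using has_vector_derivative_diff[OF 1 2] by simp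
  qed
  have dP: "(P has_derivative (\<lambda>h. fst h *\<^sub>R - F2 p + snd h *\<^sub>R F1 p)) (at p within Q R)"
    if p: "p \<in> Q R" for p
    using has_derivative_partials_rectangle[OF _ P2[unfolded Q_def] F(1)[unfolded Q_def],
        of "snd p" "- F2 p" "fst p"] P1[OF p] p
    by (auto simp: Q_def)
  \<comment> \<open>The flux integrand is the derivative of \<open>P\<close> along the circle, whose
    two endpoints coincide.\<close>
  have "((\<lambda>t. r * (F1 (polar r t) * of_real (cos t) + F2 (polar r t) * of_real (sin t))) has_integral
      (P (polar r (2 * pi)) - P (polar r 0))) {0..2 * pi}"
  proof (rule fundamental_theorem_of_calculus)
    fix t :: real
    have im: "polar r t \<in> Q R" for t
      using polar_in_square[OF r, of t] unfolding Q_def by force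
    have "((P \<circ> polar r) has_vector_derivative
        (\<lambda>h. fst h *\<^sub>R - F2 (polar r t) + snd h *\<^sub>R F1 (polar r t)) (- (r * sin t), r * cos t))
        (at t within {0..2 * pi})"
      by (rule vector_derivative_diff_chain_within[OF polar_has_vector_derivative(1)])
        (rule has_derivative_subset[OF dP[OF im]], use im in auto)
    then show "((\<lambda>t. P (polar r t)) has_vector_derivative
        of_real r * (F1 (polar r t) * of_real (cos t) + F2 (polar r t) * of_real (sin t))) (at t within {0..2 * pi})"
      by (simp add: o_def scaleR_conv_of_real algebra_simps)
  qed auto
  from integral_unique[OF this] show ?thesis
    by (simp only: polar_def) simp
qed

section \<open>Restriction, differentiability, linear combination and translation of Helmholtz
  solutions\<close>

lemma helmholtz_subset:
  assumes "helmholtz k S w w1 w2" and T: "T \<subseteq> S"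
  shows "helmholtz k T w w1 w2"
proof -
  obtain w11 w22 where h: "helmholtz_witness k S w w1 w2 w11 w22"
    using assms(1) by (rule helmholtzE)
  have "helmholtz_witness k T w w1 w2 w11 w22"
    unfolding helmholtz_witness_def
    by (intro conjI ballI continuous_on_subset[OF _ T] helmholtz_witnessD[OF h]; use T in blast)
  then show ?thesis unfolding helmholtz_def by blast
qed

lemma helmholtz_has_derivative:
  assumes h: "helmholtz k S w w1 w2" and "open S" "p \<in> S"
  shows "(w has_derivative (\<lambda>h. fst h *\<^sub>R w1 p + snd h *\<^sub>R w2 p)) (at p)"
proof -
  obtain x y where p: "p = (x, y)" by force
  obtain X Y where XY: "open X" "open Y" "p \<in> X \<times> Y" "X \<times> Y \<subseteq> S"
    by (rule open_prod_elim[OF assms(2,3)])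
  have "x \<in> X" "y \<in> Y" using XY p by auto
  \<comment> \<open>The second factor of the box is shrunk to a ball to make it convex.\<close>
  obtain e where e: "e > 0" "ball y e \<subseteq> Y" using openE[OF XY(2) \<open>y \<in> Y\<close>] .
  have sub: "X \<times> ball y e \<subseteq> S" using XY(4) e(2) by blast
  obtain w11 w22 where hw: "helmholtz_witness k S w w1 w2 w11 w22"
    using h by (rule helmholtzE)
  note D = helmholtz_witnessD[OF hw]
  have "(w has_derivative (\<lambda>h. fst h *\<^sub>R w1 p + snd h *\<^sub>R w2 (x, y))) (at (x, y) within X \<times> ball y e)"
  proof (rule has_derivative_partials_rectangle)
    show "((\<lambda>t. w (t, y)) has_vector_derivative w1 p) (at x within X)"
      using has_vector_derivative_at_within[OF D(5)[OF \<open>p \<in> S\<close>]] by (simp add: p)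
    show "((\<lambda>t. w (fst q, t)) has_vector_derivative w2 q) (at (snd q) within ball y e)"
      if "q \<in> X \<times> ball y e" for q
      by (rule has_vector_derivative_at_within, rule D(6)) (use that sub in blast)
    show "continuous_on (X \<times> ball y e) w2"
      using D(2) sub by (rule continuous_on_subset)
    show "y \<in> ball y e" using e(1) by simp
  qed (use \<open>x \<in> X\<close> in auto)
  moreover have "at (x, y) within X \<times> ball y e = at (x, y)"
    by (rule at_within_open) (use \<open>x \<in> X\<close> e(1) XY(1) in \<open>auto intro: open_Times\<close>)
  ultimately show ?thesis by (simp add: p)
qed

lemma helmholtz_continuous_on:
  assumes "helmholtz k S w w1 w2" "open S"
  shows "continuous_on S w"
  by (intro continuous_at_imp_continuous_on ballI
      has_derivative_continuous[OF helmholtz_has_derivative[OF assms]])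

lemma helmholtz_cmult_add:
  assumes w: "helmholtz k S w w1 w2" and v: "helmholtz k S v v1 v2"
  shows "helmholtz k S (\<lambda>p. a * w p + b * v p) (\<lambda>p. a * w1 p + b * v1 p) (\<lambda>p. a * w2 p + b * v2 p)"
proof -
  obtain w11 w22 where hw: "helmholtz_witness k S w w1 w2 w11 w22" using w by (rule helmholtzE)
  obtain v11 v22 where hv: "helmholtz_witness k S v v1 v2 v11 v22" using v by (rule helmholtzE)
  note D = helmholtz_witnessD[OF hw] helmholtz_witnessD[OF hv]
  have lin: "a * w11 p + b * v11 p + (a * w22 p + b * v22 p) + (of_real k)\<^sup>2 * (a * w p + b * v p) = 0"
    if "p \<in> S" for p
  proof -
    have "a * (w11 p + w22 p + (of_real k)\<^sup>2 * w p) + b * (v11 p + v22 p + (of_real k)\<^sup>2 * v p) = 0"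
      using D(9)[OF that] D(18)[OF that] by simp
    then show ?thesis by (simp add: algebra_simps)
  qed
  have "helmholtz_witness k S (\<lambda>p. a * w p + b * v p) (\<lambda>p. a * w1 p + b * v1 p) (\<lambda>p. a * w2 p + b * v2 p)
      (\<lambda>p. a * w11 p + b * v11 p) (\<lambda>p. a * w22 p + b * v22 p)"
    unfolding helmholtz_witness_def
    by (intro conjI ballI continuous_on_add continuous_on_mult_left
        has_vector_derivative_add has_vector_derivative_mult_right D lin; assumption)
  then show ?thesis unfolding helmholtz_def by blast
qed

lemma helmholtz_translate:
  assumes h: "helmholtz k S w w1 w2" and T: "\<And>p. p \<in> T \<Longrightarrow> q + p \<in> S"
  shows "helmholtz k T (\<lambda>p. w (q + p)) (\<lambda>p. w1 (q + p)) (\<lambda>p. w2 (q + p))"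
proof -
  obtain w11 w22 where hw: "helmholtz_witness k S w w1 w2 w11 w22" using h by (rule helmholtzE)
  note D = helmholtz_witnessD[OF hw]
  have c: "continuous_on T (\<lambda>p. g (q + p))" if "continuous_on S g" for g :: "real \<times> real \<Rightarrow> complex"
    by (rule continuous_on_compose2[OF that]) (use T in \<open>auto intro!: continuous_intros\<close>)
  have shift: "((\<lambda>t. g (a + t)) has_vector_derivative d) (at x)"
    if "(g has_vector_derivative d) (at (a + x))" for g :: "real \<Rightarrow> complex" and a x d
  proof -
    have "((\<lambda>t. a + t) has_vector_derivative 1) (at x)"
      by (auto intro!: derivative_eq_intros)
    from vector_diff_chain_at[OF this that] show ?thesis by (simp add: o_def)
  qed
  have e: "q + (t, snd p) = (fst q + t, snd (q + p))" "q + (fst p, t) = (fst (q + p), snd q + t)" for t p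
    by (auto simp: prod_eq_iff)
  have s: "((\<lambda>t. g (q + (t, snd p))) has_vector_derivative d) (at (fst p))"
    if "((\<lambda>t. g (t, snd (q + p))) has_vector_derivative d) (at (fst (q + p)))"
    for g :: "real \<times> real \<Rightarrow> complex" and d p
    unfolding e using shift[of "\<lambda>t. g (t, snd (q + p))" d "fst q" "fst p"] that by simp
  have s': "((\<lambda>t. g (q + (fst p, t))) has_vector_derivative d) (at (snd p))"
    if "((\<lambda>t. g (fst (q + p), t)) has_vector_derivative d) (at (snd (q + p)))"
    for g :: "real \<times> real \<Rightarrow> complex" and d p
    unfolding e using shift[of "\<lambda>t. g (fst (q + p), t)" d "snd q" "snd p"] that by simp
  have "helmholtz_witness k T (\<lambda>p. w (q + p)) (\<lambda>p. w1 (q + p)) (\<lambda>p. w2 (q + p))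
      (\<lambda>p. w11 (q + p)) (\<lambda>p. w22 (q + p))"
    unfolding helmholtz_witness_def
    by (intro conjI ballI c[OF D(1)] c[OF D(2)] c[OF D(3)] c[OF D(4)]
        s[OF D(5)] s'[OF D(6)] s[OF D(7)] s'[OF D(8)] D(9) T; assumption)
  then show ?thesis unfolding helmholtz_def by blast
qed

text \<open>The field \<open>v grad w - w grad v\<close> is divergence free, since the zeroth-order
  terms of the two equations cancel; its flux through the circle is therefore zero.\<close>

lemma helmholtz_green_circle:
  assumes w: "helmholtz k S w w1 w2" and v: "helmholtz k S v v1 v2" and "open S"
    and Q: "{-R..R} \<times> {-R..R} \<subseteq> S" and r: "0 < r" "r < R"
  shows "integral {0..2 * pi} (\<lambda>t.
      (w1 (polar r t) * of_real (cos t) + w2 (polar r t) * of_real (sin t)) * v (polar r t)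
      - w (polar r t) * (v1 (polar r t) * of_real (cos t) + v2 (polar r t) * of_real (sin t))) = 0"
proof -
  let ?Q = "{-R..R} \<times> {-R..R}"
  obtain w11 w22 where hw: "helmholtz_witness k S w w1 w2 w11 w22" using w by (rule helmholtzE)
  obtain v11 v22 where hv: "helmholtz_witness k S v v1 v2 v11 v22" using v by (rule helmholtzE)
  note D = helmholtz_witnessD[OF hw] and E = helmholtz_witnessD[OF hv]
  note cont = D(1-4)[THEN continuous_on_subset[OF _ Q]] E(1-4)[THEN continuous_on_subset[OF _ Q]]
    helmholtz_continuous_on[OF w \<open>open S\<close>, THEN continuous_on_subset[OF _ Q]]
    helmholtz_continuous_on[OF v \<open>open S\<close>, THEN continuous_on_subset[OF _ Q]]
  have "integral {0..2 * pi} (\<lambda>t. r * ((w1 (polar r t) * v (polar r t) - w (polar r t) * v1 (polar r t)) * of_real (cos t)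
      + (w2 (polar r t) * v (polar r t) - w (polar r t) * v2 (polar r t)) * of_real (sin t))) = 0"
  proof (rule integral_flux_circle_eq_0[where A = "\<lambda>p. w11 p * v p - w p * v11 p"
        and B = "\<lambda>p. w22 p * v p - w p * v22 p" and R = R and ?F1.0 = "\<lambda>p. w1 p * v p - w p * v1 p"
        and ?F2.0 = "\<lambda>p. w2 p * v p - w p * v2 p"])
    fix p assume "p \<in> ?Q"
    then have p: "p \<in> S" using Q by blast
    have "((\<lambda>t. w1 (t, snd p) * v (t, snd p) - w (t, snd p) * v1 (t, snd p)) has_vector_derivative
        (w1 (fst p, snd p) * v1 p + w11 p * v (fst p, snd p))
        - (w (fst p, snd p) * v11 p + w1 p * v1 (fst p, snd p))) (at (fst p))"
      by (intro has_vector_derivative_diff has_vector_derivative_mult D E p)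
    then show "((\<lambda>t. w1 (t, snd p) * v (t, snd p) - w (t, snd p) * v1 (t, snd p)) has_vector_derivative
        w11 p * v p - w p * v11 p) (at (fst p))" by simp
    have "((\<lambda>t. w2 (fst p, t) * v (fst p, t) - w (fst p, t) * v2 (fst p, t)) has_vector_derivative
        (w2 (fst p, snd p) * v2 p + w22 p * v (fst p, snd p))
        - (w (fst p, snd p) * v22 p + w2 p * v2 (fst p, snd p))) (at (snd p))"
      by (intro has_vector_derivative_diff has_vector_derivative_mult D E p)
    then show "((\<lambda>t. w2 (fst p, t) * v (fst p, t) - w (fst p, t) * v2 (fst p, t)) has_vector_derivative
        w22 p * v p - w p * v22 p) (at (snd p))" by simp
    have "(w11 p + w22 p + (of_real k)\<^sup>2 * w p) * v p - w p * (v11 p + v22 p + (of_real k)\<^sup>2 * v p) = 0"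
      using D(9)[OF p] E(9)[OF p] by simp
    then show "w11 p * v p - w p * v11 p + (w22 p * v p - w p * v22 p) = 0"
      by (simp add: algebra_simps)
  qed (use r in \<open>auto intro!: continuous_intros cont\<close>)
  then have "integral {0..2 * pi} (\<lambda>t. ((w1 (polar r t) * v (polar r t) - w (polar r t) * v1 (polar r t)) * of_real (cos t)
      + (w2 (polar r t) * v (polar r t) - w (polar r t) * v2 (polar r t)) * of_real (sin t))) = 0"
    using r by simp
  then show ?thesis
    by (simp add: algebra_simps)
qed

section \<open>Bessel functions as radial parts of Helmholtz solutions\<close>

text \<open>\<open>r ^ n * bessel_series k n (r\<^sup>2)\<close> is a multiple of the Bessel function \<open>J\<^sub>n (k r)\<close>.\<close>

definition bessel_coeff :: "real \<Rightarrow> nat \<Rightarrow> nat \<Rightarrow> real" where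
  "bessel_coeff k n j = (- (k\<^sup>2 / 4)) ^ j / (fact j * fact (n + j))"

definition bessel_series :: "real \<Rightarrow> nat \<Rightarrow> real \<Rightarrow> real" where
  "bessel_series k n s = (\<Sum>j. bessel_coeff k n j * s ^ j)"

definition bessel_series' :: "real \<Rightarrow> nat \<Rightarrow> real \<Rightarrow> real" where
  "bessel_series' k n s = (\<Sum>j. diffs (bessel_coeff k n) j * s ^ j)"

definition bessel_series'' :: "real \<Rightarrow> nat \<Rightarrow> real \<Rightarrow> real" where
  "bessel_series'' k n s = (\<Sum>j. diffs (diffs (bessel_coeff k n)) j * s ^ j)"

text \<open>The coefficient recursion behind \<open>bessel_series_ode\<close>.\<close>

lemma bessel_coeff_Suc:
  "(real j + real n + 1) * diffs (bessel_coeff k n) j = - (k\<^sup>2 / 4) * bessel_coeff k n j"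
proof -
  define D where "D = real j + real n + 1"
  define E where "E = real (Suc j)"
  have "fact (n + Suc j) = D * fact (n + j)" "fact (Suc j) = E * fact j"
    by (simp_all add: D_def E_def algebra_simps)
  moreover have "D \<noteq> 0" "E \<noteq> 0" unfolding D_def E_def by linarith+
  ultimately have "D * (E * ((- (k\<^sup>2 / 4)) ^ Suc j / (fact (Suc j) * fact (n + Suc j))))
      = - (k\<^sup>2 / 4) * ((- (k\<^sup>2 / 4)) ^ j / (fact j * fact (n + j)))"
    by simp
  then show ?thesis
    by (simp only: diffs_def bessel_coeff_def D_def E_def of_nat_Suc)
qed

lemma abs_bessel_term:
  "\<bar>bessel_coeff k n j * s ^ j\<bar> = (k\<^sup>2 / 4 * \<bar>s\<bar>) ^ j / (fact j * fact (n + j))"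
proof -
  define q where "q = k\<^sup>2 / 4"
  have "\<bar>- q\<bar> = q" unfolding q_def by simp
  then show ?thesis
    unfolding bessel_coeff_def q_def[symmetric] power_mult_distrib
    by (simp add: abs_mult power_abs)
qed

lemma bessel_summable: "summable (\<lambda>j. bessel_coeff k n j * s ^ j)"
proof (rule summable_comparison_test'[where N = 0])
  show "summable (\<lambda>j. inverse (fact j) * (k\<^sup>2 / 4 * \<bar>s\<bar>) ^ j)"
    by (rule summable_exp)
  fix j
  have "inverse (fact (n + j)) \<le> (1::real)"
    by (simp add: inverse_eq_divide fact_ge_1)
  then have "(k\<^sup>2 / 4 * \<bar>s\<bar>) ^ j * inverse (fact j) * inverse (fact (n + j))
      \<le> (k\<^sup>2 / 4 * \<bar>s\<bar>) ^ j * inverse (fact j) * 1"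
    by (intro mult_left_mono) auto
  then show "norm (bessel_coeff k n j * s ^ j) \<le> inverse (fact j) * (k\<^sup>2 / 4 * \<bar>s\<bar>) ^ j"
    unfolding real_norm_def abs_bessel_term divide_inverse inverse_mult_distrib
    by (simp only: mult.assoc mult_1_right mult.commute[of "inverse (fact j)" "_ ^ j"])
qed

lemma bessel_summable':
  "summable (\<lambda>j. diffs (bessel_coeff k n) j * s ^ j)"
  "summable (\<lambda>j. diffs (diffs (bessel_coeff k n)) j * s ^ j)"
  by (intro termdiff_converges_all bessel_summable)+

lemma bessel_series_deriv:
  "(bessel_series k n has_real_derivative bessel_series' k n s) (at s within T)"
  "(bessel_series' k n has_real_derivative bessel_series'' k n s) (at s within T)"
proof -
  have "(bessel_series k n has_real_derivative bessel_series' k n s) (at s)"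
    unfolding bessel_series_def[abs_def] bessel_series'_def
    by (rule termdiffs_strong_converges_everywhere) (rule bessel_summable)
  moreover have "(bessel_series' k n has_real_derivative bessel_series'' k n s) (at s)"
    unfolding bessel_series'_def[abs_def] bessel_series''_def
    by (rule termdiffs_strong_converges_everywhere) (rule bessel_summable')
  ultimately show "(bessel_series k n has_real_derivative bessel_series' k n s) (at s within T)"
    "(bessel_series' k n has_real_derivative bessel_series'' k n s) (at s within T)"
    by (auto intro: DERIV_subset)
qed

lemma bessel_series_continuous:
  "continuous_on T (bessel_series k n)" "continuous_on T (bessel_series' k n)"
  by (rule DERIV_continuous_on, rule bessel_series_deriv)+

lemma bessel_series''_continuous: "continuous_on T (bessel_series'' k n)"
proof -
  have "(bessel_series'' k n has_real_derivative (\<Sum>j. diffs (diffs (diffs (bessel_coeff k n))) j * s ^ j)) (at s)" for s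
    unfolding bessel_series''_def[abs_def]
    by (rule termdiffs_strong_converges_everywhere) (rule bessel_summable')
  then show ?thesis
    by (intro DERIV_continuous_on[where D = "\<lambda>s. (\<Sum>j. diffs (diffs (diffs (bessel_coeff k n))) j * s ^ j)"])
      (auto intro: DERIV_subset)
qed

text \<open>Bessel's equation after splitting off \<open>r ^ n\<close> and passing to the variable
  \<open>s = r\<^sup>2\<close>. In this form nothing is singular at the origin, so the angular modes
  are smooth there.\<close>

lemma bessel_series_ode:
  "s * bessel_series'' k n s + (real n + 1) * bessel_series' k n s = - (k\<^sup>2 / 4) * bessel_series k n s"
proof -
  let ?d = "diffs (bessel_coeff k n)"
  have "(\<lambda>j. s * (diffs ?d j * s ^ j)) sums (s * bessel_series'' k n s)"
    unfolding bessel_series''_def by (intro sums_mult summable_sums bessel_summable')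
  then have "(\<lambda>j. real (Suc j) * ?d (Suc j) * s ^ Suc j) sums (s * bessel_series'' k n s)"
    by (simp add: diffs_def mult_ac)
  then have "(\<lambda>j. real j * ?d j * s ^ j) sums (s * bessel_series'' k n s)"
    by (subst (asm) sums_Suc_iff) simp
  moreover have "(\<lambda>j. (real n + 1) * (?d j * s ^ j)) sums ((real n + 1) * bessel_series' k n s)"
    unfolding bessel_series'_def by (intro sums_mult summable_sums bessel_summable')
  ultimately have "(\<lambda>j. real j * ?d j * s ^ j + (real n + 1) * (?d j * s ^ j)) sums
      (s * bessel_series'' k n s + (real n + 1) * bessel_series' k n s)"
    by (rule sums_add)
  moreover have "(\<lambda>j. real j * ?d j * s ^ j + (real n + 1) * (?d j * s ^ j)) =
      (\<lambda>j. - (k\<^sup>2 / 4) * (bessel_coeff k n j * s ^ j))"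
  proof
    fix j
    have "real j * ?d j * s ^ j + (real n + 1) * (?d j * s ^ j) = ((real j + real n + 1) * ?d j) * s ^ j"
      by (simp add: algebra_simps)
    then show "real j * ?d j * s ^ j + (real n + 1) * (?d j * s ^ j) = - (k\<^sup>2 / 4) * (bessel_coeff k n j * s ^ j)"
      by (simp only: bessel_coeff_Suc mult.assoc)
  qed
  moreover have "(\<lambda>j. - (k\<^sup>2 / 4) * (bessel_coeff k n j * s ^ j)) sums (- (k\<^sup>2 / 4) * bessel_series k n s)"
    unfolding bessel_series_def by (intro sums_mult summable_sums bessel_summable)
  ultimately show ?thesis
    by (metis sums_unique2)
qed

text \<open>After scaling by \<open>fact n\<close> the constant term is 1 and the later terms are
  dominated by a geometric series of ratio 1/4, whose tail sums to 1/3. The bound does not depend on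
  \<open>n\<close>.\<close>

lemma bessel_series_bound:
  assumes "0 \<le> s" "k\<^sup>2 / 4 * s \<le> 1 / 4"
  shows "\<bar>fact n * bessel_series k n s - 1\<bar> \<le> 1 / 3"
proof -
  let ?a = "\<lambda>j. fact n * (bessel_coeff k n j * s ^ j)"
  have sm: "?a sums (fact n * bessel_series k n s)"
    unfolding bessel_series_def by (intro sums_mult summable_sums bessel_summable)
  then have S1: "(\<lambda>j. ?a (Suc j)) sums (fact n * bessel_series k n s - 1)"
    by (subst sums_Suc_iff) (simp add: bessel_coeff_def)
  have S2: "(\<lambda>j. (1 / 4) * (1 / 4) ^ j) sums ((1 / 4) * (1 / (1 - 1 / 4 :: real)))"
    by (intro sums_mult geometric_sums) auto
  have S3: "norm (?a (Suc j)) \<le> (1 / 4) * (1 / 4) ^ j" for j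
  proof -
    have 1: "norm (?a i) = (fact n / (fact i * fact (n + i))) * (k\<^sup>2 / 4 * s) ^ i" for i
      unfolding real_norm_def abs_mult[of "fact n"] abs_bessel_term using assms(1) by simp
    have 2: "fact n / (fact i * fact (n + i)) \<le> (1::real)" for i
    proof -
      have "fact n \<le> (fact (n + i) :: real)" by (rule fact_mono) simp
      also have "\<dots> \<le> fact i * fact (n + i)"
        using mult_right_mono[OF fact_ge_1[of i, where 'a = real], of "fact (n + i)"] by simp
      finally show ?thesis by (simp add: divide_le_eq)
    qed
    have 3: "(k\<^sup>2 / 4 * s) ^ i \<le> (1 / 4) ^ i" for i
      using assms by (intro power_mono) auto
    have "norm (?a (Suc j)) \<le> 1 * (1 / 4) ^ Suc j"
      unfolding 1 by (rule mult_mono[OF 2 3]) (use assms(1) in simp_all)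
    then show ?thesis by simp
  qed
  show ?thesis
    using norm_suminf_le[OF S3 sums_summable[OF S2]]
    unfolding sums_unique[OF S1, symmetric] sums_unique[OF S2, symmetric] by simp
qed

definition radial :: "real \<Rightarrow> nat \<Rightarrow> real \<Rightarrow> real" where
  "radial k n r = r ^ n * bessel_series k n (r\<^sup>2)"

text \<open>For \<open>n = 0\<close> the truncated exponent \<open>n - 1\<close> is harmless because
  of the factor \<open>of_nat n\<close>.\<close>

definition radial' :: "real \<Rightarrow> nat \<Rightarrow> real \<Rightarrow> real" where
  "radial' k n r = of_nat n * r ^ (n - 1) * bessel_series k n (r\<^sup>2)
     + 2 * r ^ Suc n * bessel_series' k n (r\<^sup>2)"

lemma radial_deriv: "(radial k n has_real_derivative radial' k n r) (at r within T)"
proof -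
  have "((\<lambda>r. bessel_series k n (r\<^sup>2)) has_real_derivative bessel_series' k n (r\<^sup>2) * (2 * r)) (at r within T)"
    by (rule DERIV_chain2[OF bessel_series_deriv(1)]) (auto intro!: derivative_eq_intros)
  then show ?thesis
    unfolding radial_def[abs_def] radial'_def
    by (auto intro!: derivative_eq_intros simp: algebra_simps)
qed

text \<open>Comparability with \<open>r ^ n / fact n\<close>, with constants independent of
  \<open>n\<close>: the lower bound makes division possible, and both together compare the values at
  two radii.\<close>

lemma radial_bound:
  assumes "0 \<le> r" "k\<^sup>2 * r\<^sup>2 \<le> 1"
  shows "2 / 3 * r ^ n \<le> fact n * radial k n r" "fact n * radial k n r \<le> 4 / 3 * r ^ n"
proof -
  have b: "2 / 3 \<le> fact n * bessel_series k n (r\<^sup>2)" "fact n * bessel_series k n (r\<^sup>2) \<le> 4 / 3"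
  proof -
    have "\<bar>fact n * bessel_series k n (r\<^sup>2) - 1\<bar> \<le> 1 / 3"
      by (rule bessel_series_bound) (use assms in auto)
    then show "2 / 3 \<le> fact n * bessel_series k n (r\<^sup>2)" "fact n * bessel_series k n (r\<^sup>2) \<le> 4 / 3"
      unfolding abs_le_iff by linarith+
  qed
  show "2 / 3 * r ^ n \<le> fact n * radial k n r" "fact n * radial k n r \<le> 4 / 3 * r ^ n"
    using mult_right_mono[OF b(1), of "r ^ n"] mult_right_mono[OF b(2), of "r ^ n"] assms(1)
    by (auto simp: radial_def mult_ac)
qed

lemma radial_pos:
  assumes "0 < r" "r < R" "k\<^sup>2 * R\<^sup>2 \<le> 1"
  shows "0 < radial k n r"
proof -
  have "k\<^sup>2 * r\<^sup>2 \<le> k\<^sup>2 * R\<^sup>2" using assms by (intro mult_left_mono power_mono) auto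
  then have "0 < 2 / 3 * r ^ n" "2 / 3 * r ^ n \<le> fact n * radial k n r"
    using radial_bound(1)[of r k n] assms by auto
  then have "0 < fact n * radial k n r" by linarith
  then show ?thesis by (simp add: zero_less_mult_iff)
qed

lemma has_vector_derivative_shifted_power:
  "((\<lambda>t. (complex_of_real t + c) ^ n) has_vector_derivative of_nat n * (of_real x + c) ^ (n - 1)) (at x)"
  "((\<lambda>t. (c + d * complex_of_real t) ^ n) has_vector_derivative d * (of_nat n * (c + d * of_real x) ^ (n - 1))) (at x)"
proof -
  have "((\<lambda>z. (z + c) ^ n) has_field_derivative of_nat n * (of_real x + c) ^ (n - 1)) (at (complex_of_real x))"
    by (auto intro!: derivative_eq_intros)
  then show "((\<lambda>t. (complex_of_real t + c) ^ n) has_vector_derivative of_nat n * (of_real x + c) ^ (n - 1)) (at x)"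
    by (rule has_vector_derivative_real_field)
  have "((\<lambda>z. (c + d * z) ^ n) has_field_derivative d * (of_nat n * (c + d * of_real x) ^ (n - 1))) (at (complex_of_real x))"
    by (auto intro!: derivative_eq_intros)
  then show "((\<lambda>t. (c + d * complex_of_real t) ^ n) has_vector_derivative d * (of_nat n * (c + d * of_real x) ^ (n - 1))) (at x)"
    by (rule has_vector_derivative_real_field)
qed

text \<open>In Cartesian form the mode is \<open>(x + \<i> * \<sigma> * y) ^ n\<close> times a
  smooth function of \<open>x\<^sup>2 + y\<^sup>2\<close>, so it is regular at the origin and solves
  the equation on the whole plane. The sign \<open>\<sigma>\<close> covers both orientations, and
  the last conclusion identifies the radial derivative that enters Green's formula.\<close>

lemma helmholtz_angular_mode:
  fixes \<sigma> :: real
  assumes \<sigma>: "\<sigma>\<^sup>2 = 1"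
  obtains v v1 v2 where "helmholtz k UNIV v v1 v2"
    and "\<And>r t. v (polar r t) = radial k n r * cis (\<sigma> * of_nat n * t)"
    and "\<And>r t. v1 (polar r t) * of_real (cos t) + v2 (polar r t) * of_real (sin t) = radial' k n r * cis (\<sigma> * of_nat n * t)"
proof -
  define \<zeta> where "\<zeta> p = of_real (fst p) + \<i> * \<sigma> * of_real (snd p)" for p :: "real \<times> real"
  define sq where "sq p = (fst p)\<^sup>2 + (snd p)\<^sup>2" for p :: "real \<times> real"
  define g g' g'' where "g p = complex_of_real (bessel_series k n (sq p))"
    and "g' p = complex_of_real (bessel_series' k n (sq p))"
    and "g'' p = complex_of_real (bessel_series'' k n (sq p))" for p
  \<comment> \<open>The derivative of the power \<open>\<zeta> p ^ m\<close> with respect to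
    \<open>\<zeta> p\<close>; it is zero for \<open>m = 0\<close>, whatever the truncated
    exponent.\<close>
  define Z where "Z m p = of_nat m * \<zeta> p ^ (m - 1)" for m p
  define v where "v p = \<zeta> p ^ n * g p" for p
  define v1 where "v1 p = Z n p * g p + \<zeta> p ^ n * (g' p * (2 * of_real (fst p)))" for p
  define v2 where "v2 p = \<i> * \<sigma> * Z n p * g p + \<zeta> p ^ n * (g' p * (2 * of_real (snd p)))" for p
  define v11 where "v11 p = of_nat n * Z (n - 1) p * g p + 2 * (Z n p * (g' p * (2 * of_real (fst p))))
      + \<zeta> p ^ n * (g'' p * (2 * of_real (fst p)) * (2 * of_real (fst p)) + g' p * 2)" for p
  define v22 where "v22 p = - (of_nat n * Z (n - 1) p * g p) + 2 * (\<i> * \<sigma> * Z n p * (g' p * (2 * of_real (snd p))))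
      + \<zeta> p ^ n * (g'' p * (2 * of_real (snd p)) * (2 * of_real (snd p)) + g' p * 2)" for p
  have \<sigma>2: "complex_of_real \<sigma> * of_real \<sigma> = 1"
    using \<sigma> by (metis of_real_1 of_real_mult power2_eq_square)
  have dZ1: "((\<lambda>t. \<zeta> (t, snd p) ^ m) has_vector_derivative Z m p) (at (fst p))"
    and dZ2: "((\<lambda>t. \<zeta> (fst p, t) ^ m) has_vector_derivative \<i> * \<sigma> * Z m p) (at (snd p))" for m p
    unfolding \<zeta>_def Z_def fst_conv snd_conv using has_vector_derivative_shifted_power by blast+
  have dZ1': "((\<lambda>t. Z n (t, snd p)) has_vector_derivative of_nat n * Z (n - 1) p) (at (fst p))"
    and dZ2': "((\<lambda>t. Z n (fst p, t)) has_vector_derivative of_nat n * (\<i> * \<sigma> * Z (n - 1) p)) (at (snd p))" for p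
    unfolding Z_def[of n] by (intro has_vector_derivative_mult_right dZ1 dZ2)+
  have chain: "((\<lambda>t. complex_of_real (B (q t))) has_vector_derivative of_real (B' (q x)) * (2 * of_real x)) (at x)"
    if "\<And>s. (B has_real_derivative B' s) (at s)" "\<And>t. q t = t\<^sup>2 + c" for B B' :: "real \<Rightarrow> real" and q x c
  proof -
    have "q = (\<lambda>t. t\<^sup>2 + c)" using that(2) by (auto simp: fun_eq_iff)
    then have "(q has_real_derivative 2 * x) (at x)" by (auto intro!: derivative_eq_intros)
    from DERIV_chain2[OF that(1) this]
    show ?thesis
      using has_vector_derivative_of_real[of "\<lambda>t. B (q t)" "B' (q x) * (2 * x)"]
      by (simp add: has_real_derivative_iff_has_vector_derivative)
  qed
  have dg1: "((\<lambda>t. g (t, snd p)) has_vector_derivative g' p * (2 * of_real (fst p))) (at (fst p))"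
    and dg2: "((\<lambda>t. g (fst p, t)) has_vector_derivative g' p * (2 * of_real (snd p))) (at (snd p))" for p
    unfolding g_def g'_def
    using chain[OF bessel_series_deriv(1), where q = "\<lambda>t. sq (t, snd p)" and c = "(snd p)\<^sup>2" and x = "fst p"]
      chain[OF bessel_series_deriv(1), where q = "\<lambda>t. sq (fst p, t)" and c = "(fst p)\<^sup>2" and x = "snd p"]
    by (simp_all add: sq_def add.commute)
  have dg1': "((\<lambda>t. g' (t, snd p)) has_vector_derivative g'' p * (2 * of_real (fst p))) (at (fst p))"
    and dg2': "((\<lambda>t. g' (fst p, t)) has_vector_derivative g'' p * (2 * of_real (snd p))) (at (snd p))" for p
    unfolding g'_def g''_def
    using chain[OF bessel_series_deriv(2), where q = "\<lambda>t. sq (t, snd p)" and c = "(snd p)\<^sup>2" and x = "fst p"]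
      chain[OF bessel_series_deriv(2), where q = "\<lambda>t. sq (fst p, t)" and c = "(fst p)\<^sup>2" and x = "snd p"]
    by (simp_all add: sq_def add.commute)
  have d2: "((\<lambda>t. 2 * complex_of_real t) has_vector_derivative 2) (at x)" for x
  proof -
    have "((\<lambda>t. 2 * complex_of_real t) has_vector_derivative 2 * of_real 1) (at x)"
      by (intro has_vector_derivative_mult_right has_vector_derivative_of_real DERIV_ident)
    then show ?thesis by simp
  qed
  have csq: "continuous_on UNIV sq" unfolding sq_def by (intro continuous_intros)
  have cg: "continuous_on UNIV g" "continuous_on UNIV g'" "continuous_on UNIV g''"
    unfolding g_def g'_def g''_def
    by (intro continuous_on_of_real continuous_on_compose2[OF bessel_series_continuous(1) csq subset_UNIV]
        continuous_on_compose2[OF bessel_series_continuous(2) csq subset_UNIV]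
        continuous_on_compose2[OF bessel_series''_continuous csq subset_UNIV])+
  have c\<zeta>: "continuous_on UNIV (\<lambda>p. \<zeta> p ^ m)" "continuous_on UNIV (Z m)" for m
    unfolding \<zeta>_def Z_def by (intro continuous_intros)+
  have pde: "v11 p + v22 p + (of_real k)\<^sup>2 * v p = 0" for p
  proof -
    have Zn: "Z n p * \<zeta> p = of_nat n * \<zeta> p ^ n"
      unfolding Z_def by (cases n) auto
    have "sq p * bessel_series'' k n (sq p) + (real n + 1) * bessel_series' k n (sq p) + k\<^sup>2 / 4 * bessel_series k n (sq p) = 0"
      using bessel_series_ode[of "sq p" k n] by simp
    then have "complex_of_real (sq p * bessel_series'' k n (sq p) + (real n + 1) * bessel_series' k n (sq p) + k\<^sup>2 / 4 * bessel_series k n (sq p)) = 0"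
      by (metis of_real_0)
    then have ode: "of_real (sq p) * g'' p + (of_nat n + 1) * g' p + (of_real k)\<^sup>2 / 4 * g p = 0"
      by (simp add: g_def g'_def g''_def)
    \<comment> \<open>The pure second derivatives of the power cancel because it is harmonic. The
      mixed terms combine to a multiple of \<open>\<zeta> p\<close>, and Euler's identity
      \<open>Zn\<close> reduces everything to the radial equation.\<close>
    have "v11 p + v22 p = 4 * (Z n p * \<zeta> p * g' p) + 4 * (\<zeta> p ^ n * (g' p + of_real (sq p) * g'' p))"
      unfolding v11_def v22_def \<zeta>_def sq_def by (simp add: algebra_simps power2_eq_square)
    also have "\<dots> = 4 * \<zeta> p ^ n * (of_real (sq p) * g'' p + (of_nat n + 1) * g' p)"
      unfolding Zn by (simp add: algebra_simps)
    also have "\<dots> = 4 * \<zeta> p ^ n * (- ((of_real k)\<^sup>2 / 4 * g p))"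
      using ode by (metis add_eq_0_iff2)
    finally show ?thesis by (simp add: v_def algebra_simps)
  qed
  have "helmholtz_witness k UNIV v v1 v2 v11 v22"
    unfolding helmholtz_witness_def
  proof (intro conjI ballI)
    show "continuous_on UNIV v1" "continuous_on UNIV v2" "continuous_on UNIV v11" "continuous_on UNIV v22"
      unfolding v1_def v2_def v11_def v22_def by (intro continuous_intros cg c\<zeta>)+
    fix p
    show "((\<lambda>t. v (t, snd p)) has_vector_derivative v1 p) (at (fst p))"
      unfolding v_def v1_def using has_vector_derivative_mult[OF dZ1[of p n] dg1[of p]] by (simp add: algebra_simps)
    show "((\<lambda>t. v (fst p, t)) has_vector_derivative v2 p) (at (snd p))"
      unfolding v_def v2_def using has_vector_derivative_mult[OF dZ2[of p n] dg2[of p]] by (simp add: algebra_simps)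
    show "((\<lambda>t. v1 (t, snd p)) has_vector_derivative v11 p) (at (fst p))"
      unfolding v1_def v11_def fst_conv
      using has_vector_derivative_add[OF has_vector_derivative_mult[OF dZ1'[of p] dg1[of p]]
          has_vector_derivative_mult[OF dZ1[of p n] has_vector_derivative_mult[OF dg1'[of p] d2]]]
      by (simp add: algebra_simps)
    have eq: "- (of_nat n * Z (n - 1) p * g p) = \<i> * \<sigma> * (of_nat n * (\<i> * \<sigma> * Z (n - 1) p)) * g p"
    proof -
      have "\<i> * \<sigma> * (of_nat n * (\<i> * \<sigma> * Z (n - 1) p)) * g p = (\<i> * \<i>) * (of_real \<sigma> * of_real \<sigma>) * (of_nat n * Z (n - 1) p * g p)"
        by (simp only: mult_ac)
      then show ?thesis by (simp only: \<sigma>2) simp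
    qed
    show "((\<lambda>t. v2 (fst p, t)) has_vector_derivative v22 p) (at (snd p))"
      unfolding v2_def v22_def snd_conv eq
      using has_vector_derivative_add[OF has_vector_derivative_mult[OF has_vector_derivative_mult_right[OF dZ2'[of p], of "\<i> * \<sigma>"] dg2[of p]]
          has_vector_derivative_mult[OF dZ2[of p n] has_vector_derivative_mult[OF dg2'[of p] d2]]]
      by (simp add: algebra_simps)
    show "v11 p + v22 p + (of_real k)\<^sup>2 * v p = 0" by (rule pde)
  qed
  then have h: "helmholtz k UNIV v v1 v2" unfolding helmholtz_def by blast
  have cos_sin: "complex_of_real (cos t) + \<i> * \<sigma> * of_real (sin t) = cis (\<sigma> * t)" for t
    using \<sigma> by (auto simp: power2_eq_1_iff complex_eq_iff)
  have \<zeta>p: "\<zeta> (polar r t) = r * cis (\<sigma> * t)" for r t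
    unfolding \<zeta>_def polar_def fst_conv snd_conv cos_sin[symmetric] by (simp add: algebra_simps)
  have sqp: "sq (polar r t) = r\<^sup>2" for r t
    unfolding sq_def polar_def fst_conv snd_conv power_mult_distrib
    by (metis distrib_left mult.right_neutral sin_cos_squared_add2)
  have cisn: "cis (\<sigma> * t) ^ n = cis (\<sigma> * of_nat n * t)" for t
    by (simp only: Complex.DeMoivre mult_ac)
  have 1: "v (polar r t) = radial k n r * cis (\<sigma> * of_nat n * t)" for r t
    unfolding v_def g_def \<zeta>p sqp power_mult_distrib cisn radial_def by simp
  have 2: "v1 (polar r t) * of_real (cos t) + v2 (polar r t) * of_real (sin t) = radial' k n r * cis (\<sigma> * of_nat n * t)" for r t
  proof -
    have a: "Z n (polar r t) * cis (\<sigma> * t) = of_nat n * of_real (r ^ (n - 1)) * cis (\<sigma> * of_nat n * t)"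
      unfolding Z_def \<zeta>p power_mult_distrib cisn[symmetric] by (cases n) auto
    have b: "complex_of_real (fst (polar r t)) * of_real (cos t) + of_real (snd (polar r t)) * of_real (sin t) = r"
      unfolding polar_def fst_conv snd_conv
      by (simp add: mult.assoc flip: distrib_left of_real_mult of_real_add power2_eq_square)
    have "v1 (polar r t) * of_real (cos t) + v2 (polar r t) * of_real (sin t) =
        (Z n (polar r t) * (complex_of_real (cos t) + \<i> * \<sigma> * of_real (sin t))) * g (polar r t)
        + 2 * \<zeta> (polar r t) ^ n * g' (polar r t)
          * (complex_of_real (fst (polar r t)) * of_real (cos t) + of_real (snd (polar r t)) * of_real (sin t))"
      unfolding v1_def v2_def by (simp add: algebra_simps)
    also have "\<dots> = radial' k n r * cis (\<sigma> * of_nat n * t)"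
      unfolding cos_sin a b g_def g'_def sqp \<zeta>p power_mult_distrib cisn radial'_def
      by (simp add: algebra_simps)
    finally show ?thesis .
  qed
  from that[OF h 1 2] show ?thesis .
qed

section \<open>Unique continuation\<close>

lemma continuous_on_polar: "continuous_on T (\<lambda>x. polar (fst x) (snd x))"
  unfolding polar_def by (intro continuous_intros)

lemma polar_mem:
  assumes "{-R..R} \<times> {-R..R} \<subseteq> S" "0 \<le> r" "r < R"
  shows "polar r t \<in> S"
proof -
  have "{-R<..<R} \<times> {-R<..<R} \<subseteq> {-R..R} \<times> {-R..R}"
    by (intro Sigma_mono) auto
  from subsetD[OF this polar_in_square[OF assms(2,3)]] show ?thesis
    by (rule subsetD[OF assms(1)])
qed

lemma continuous_on_circle:
  fixes w :: "real \<times> real \<Rightarrow> complex"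
  assumes "continuous_on S w" and Q: "{-R..R} \<times> {-R..R} \<subseteq> S" and r: "0 \<le> r" "r < R"
  shows "continuous_on (sphere 0 1) (\<lambda>z. w (r * Re z, r * Im z))"
proof (rule continuous_on_compose2[OF assms(1)])
  show "(\<lambda>z. (r * Re z, r * Im z)) ` sphere 0 1 \<subseteq> S"
  proof clarify
    fix z :: complex assume "z \<in> sphere 0 1"
    then have "\<bar>Re z\<bar> \<le> 1" "\<bar>Im z\<bar> \<le> 1"
      using abs_Re_le_cmod[of z] abs_Im_le_cmod[of z] by auto
    then have "\<bar>r * Re z\<bar> \<le> r * 1" "\<bar>r * Im z\<bar> \<le> r * 1"
      unfolding abs_mult using r by (intro mult_mono; simp)+
    then have "(r * Re z, r * Im z) \<in> {-R..R} \<times> {-R..R}" using r by auto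
    then show "(r * Re z, r * Im z) \<in> S" by (rule subsetD[OF Q])
  qed
qed (intro continuous_intros)

lemma polar_cis: "polar r t = (r * Re (cis t), r * Im (cis t))"
  by (simp add: polar_def)

lemma continuous_on_polar_circle:
  fixes w :: "real \<times> real \<Rightarrow> complex"
  assumes "continuous_on S w" and Q: "{-R..R} \<times> {-R..R} \<subseteq> S" and r: "0 \<le> r" "r < R"
  shows "continuous_on T (\<lambda>t. w (polar r t))"
proof (rule continuous_on_compose2[OF assms(1)])
  show "continuous_on T (polar r)"
    unfolding polar_def by (intro continuous_intros)
  show "polar r ` T \<subseteq> S"
    by (rule image_subsetI) (rule polar_mem[OF Q r])
qed

text \<open>Green's formula with the angular modes makes the Wronskian of the angular coefficient and
  the Bessel function vanish.\<close>

lemma helmholtz_angular_coeff: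
  assumes h: "helmholtz k S w w1 w2" and "open S" and Q: "{-R..R} \<times> {-R..R} \<subseteq> S"
    and kR: "k\<^sup>2 * R\<^sup>2 \<le> 1"
  obtains c :: "int \<Rightarrow> complex" where
    "\<And>m r. 0 < r \<Longrightarrow> r < R \<Longrightarrow> fourier_coeff (\<lambda>t. w (polar r t)) m = c m * radial k (nat \<bar>m\<bar>) r"
proof -
  have "\<exists>c::complex. \<forall>r\<in>{0<..<R}. fourier_coeff (\<lambda>t. w (polar r t)) m = c * radial k (nat \<bar>m\<bar>) r" for m
  proof -
    define n where "n = nat \<bar>m\<bar>"
    \<comment> \<open>The sign that makes the test mode carry \<open>cis (- (of_int m * t))\<close>,
      the kernel of the \<open>m\<close>-th Fourier coefficient.\<close>
    define \<sigma> :: real where "\<sigma> = (if m \<ge> 0 then -1 else 1)"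
    have \<sigma>: "\<sigma>\<^sup>2 = 1" "\<sigma> * of_nat n * t = - (of_int m * t)" for t
      by (auto simp: \<sigma>_def n_def)
    obtain v v1 v2 where v: "helmholtz k UNIV v v1 v2"
      "\<And>r t. v (polar r t) = radial k n r * cis (\<sigma> * of_nat n * t)"
      "\<And>r t. v1 (polar r t) * of_real (cos t) + v2 (polar r t) * of_real (sin t) = radial' k n r * cis (\<sigma> * of_nat n * t)"
      using helmholtz_angular_mode[OF \<sigma>(1), of k n] by blast
    define dw where "dw r t = w1 (polar r t) * of_real (cos t) + w2 (polar r t) * of_real (sin t)" for r t
    define A where "A r = fourier_coeff (\<lambda>t. w (polar r t)) m" for r
    define A' where "A' r = fourier_coeff (dw r) m" for r
    have cw: "continuous_on S w" "continuous_on S w1" "continuous_on S w2"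
      using helmholtz_continuous_on[OF h \<open>open S\<close>] helmholtz_continuous_on_gradient[OF h] by auto
    have rad: "radial k n r > 0" if "r \<in> {0<..<R}" for r
      by (rule radial_pos[OF _ _ kR]) (use that in auto)
    have wron: "radial k n r * A' r = radial' k n r * A r" if r: "r \<in> {0<..<R}" for r
    proof -
      have c: "continuous_on {0..2 * pi} (\<lambda>t. cis (- (of_int m * t)))"
        by (auto intro!: continuous_intros simp: cis_conv_exp)
      have i1: "(\<lambda>t. dw r t * cis (- (of_int m * t))) integrable_on {0..2 * pi}"
        unfolding dw_def using r
        by (intro integrable_continuous_real continuous_intros c
            continuous_on_polar_circle[OF cw(2) Q] continuous_on_polar_circle[OF cw(3) Q]) auto
      have i2: "(\<lambda>t. w (polar r t) * cis (- (of_int m * t))) integrable_on {0..2 * pi}"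
        using r by (intro integrable_continuous_real continuous_intros c continuous_on_polar_circle[OF cw(1) Q]) auto
      have "integral {0..2 * pi} (\<lambda>t. dw r t * v (polar r t) - w (polar r t) *
          (v1 (polar r t) * of_real (cos t) + v2 (polar r t) * of_real (sin t))) = 0"
        unfolding dw_def using r
        by (intro helmholtz_green_circle[OF h helmholtz_subset[OF v(1)] \<open>open S\<close> Q]) auto
      then have "integral {0..2 * pi} (\<lambda>t. radial k n r * (dw r t * cis (- (of_int m * t)))
          - radial' k n r * (w (polar r t) * cis (- (of_int m * t)))) = 0"
        unfolding v \<sigma>(2) by (simp only: mult_ac)
      then have "radial k n r * A' r - radial' k n r * A r = 0"
        unfolding A_def A'_def fourier_coeff_def
        using i1 i2 by (subst (asm) integral_diff) (auto intro: integrable_on_mult_right)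
      then show ?thesis by simp
    qed
    have dA: "(A has_vector_derivative A' r) (at r within {0<..<R})" if r: "r \<in> {0<..<R}" for r
    proof -
      have "((\<lambda>r. integral (cbox 0 (2 * pi)) (\<lambda>t. w (polar r t) * cis (- (of_int m * t)))) has_vector_derivative
          integral (cbox 0 (2 * pi)) (\<lambda>t. dw r t * cis (- (of_int m * t)))) (at r within {0<..<R})"
      proof (rule leibniz_rule_vector_derivative)
        fix r t :: real assume r: "r \<in> {0<..<R}"
        have p: "polar r t \<in> S" 
          using r by (intro polar_mem[OF Q]) auto
        have "((w \<circ> (\<lambda>r. polar r t)) has_vector_derivative
            (\<lambda>h. fst h *\<^sub>R w1 (polar r t) + snd h *\<^sub>R w2 (polar r t)) (cos t, sin t)) (at r within {0<..<R})"
          by (rule vector_derivative_diff_chain_within[OF polar_has_vector_derivative(2)])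
            (rule has_derivative_at_withinI, rule helmholtz_has_derivative[OF h \<open>open S\<close> p])
        then have "((\<lambda>r. w (polar r t)) has_vector_derivative dw r t) (at r within {0<..<R})"
          by (simp add: o_def dw_def scaleR_conv_of_real mult.commute)
        then show "((\<lambda>r. w (polar r t) * cis (- (of_int m * t))) has_vector_derivative
            dw r t * cis (- (of_int m * t))) (at r within {0<..<R})"
          by (rule has_vector_derivative_mult_left)
      next
        fix r assume r: "r \<in> {0<..<R}"
        show "(\<lambda>t. w (polar r t) * cis (- (of_int m * t))) integrable_on cbox 0 (2 * pi)"
          unfolding cbox_interval using r
          by (intro integrable_continuous_real continuous_on_mult continuous_on_polar_circle[OF cw(1) Q])
            (auto simp: cis_conv_exp intro!: continuous_intros)
      next
        have sub: "(\<lambda>x. polar (fst x) (snd x)) ` ({0<..<R} \<times> cbox 0 (2 * pi)) \<subseteq> S"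
          by (rule image_subsetI, rule polar_mem[OF Q]) auto
        show "continuous_on ({0<..<R} \<times> cbox 0 (2 * pi)) (\<lambda>(r, t). dw r t * cis (- (of_int m * t)))"
          unfolding dw_def split_beta'
          by (intro continuous_on_mult continuous_on_add continuous_on_compose2[OF cw(2) continuous_on_polar sub]
              continuous_on_compose2[OF cw(3) continuous_on_polar sub])
            (auto simp: cis_conv_exp intro!: continuous_intros)
      qed (use r in auto)
      then show ?thesis
        by (simp add: A_def[abs_def] A'_def fourier_coeff_def cbox_interval)
    qed
    \<comment> \<open>Quotient rule: the numerator is the Wronskian, which vanishes by
      \<open>wron\<close>, so the quotient is constant in \<open>r\<close>.\<close>
    have "((\<lambda>r. A r * of_real (inverse (radial k n r))) has_vector_derivative 0) (at r within {0<..<R})"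
      if r: "r \<in> {0<..<R}" for r
    proof -
      have inv: "((\<lambda>r. inverse (radial k n r)) has_real_derivative
          - (radial' k n r * inverse ((radial k n r)\<^sup>2))) (at r within {0<..<R})"
        using DERIV_inverse_fun[OF radial_deriv, of k n r "{0<..<R}"] rad[OF r]
        by (simp add: numeral_2_eq_2)
      have "A r * of_real (- (radial' k n r * inverse ((radial k n r)\<^sup>2))) + A' r * of_real (inverse (radial k n r))
          = (radial k n r * A' r - radial' k n r * A r) * of_real (inverse ((radial k n r)\<^sup>2))"
        using rad[OF r] by (simp add: field_simps power2_eq_square)
      also have "\<dots> = 0" using wron[OF r] by simp
      finally show ?thesis
        using has_vector_derivative_mult[OF dA[OF r] has_vector_derivative_of_real[OF inv]] by simp
    qed
    then obtain c where c: "\<And>r. r \<in> {0<..<R} \<Longrightarrow> A r * of_real (inverse (radial k n r)) = c"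
      using has_vector_derivative_zero_constant[of "{0<..<R}" "\<lambda>r. A r * of_real (inverse (radial k n r))"]
      by auto
    have "A r = c * radial k n r" if "r \<in> {0<..<R}" for r
      using c[OF that] rad[OF that] by (auto simp: field_simps)
    then show ?thesis by (intro exI[of _ c] ballI) (simp add: A_def n_def)
  qed
  then have "\<forall>m. \<exists>c::complex. \<forall>r\<in>{0<..<R}. fourier_coeff (\<lambda>t. w (polar r t)) m = c * radial k (nat \<bar>m\<bar>) r"
    by blast
  from choice[OF this] obtain c :: "int \<Rightarrow> complex" where "\<forall>m. \<forall>r\<in>{0<..<R}. fourier_coeff (\<lambda>t. w (polar r t)) m = c m * radial k (nat \<bar>m\<bar>) r" ..
  then show ?thesis using that by auto
qed

lemma polar_exists:
  obtains t where "p = polar (norm p) t"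
proof (cases "p = 0")
  case True
  then show ?thesis using that by (simp add: polar_def prod_eq_iff)
next
  case False
  obtain x y where p: "p = (x, y)" by force
  define r where "r = norm p"
  have r: "r > 0" "r\<^sup>2 = x\<^sup>2 + y\<^sup>2"
    unfolding r_def using False by simp (simp add: p norm_Pair)
  have "(x / r)\<^sup>2 + (y / r)\<^sup>2 = 1"
    unfolding power_divide add_divide_distrib[symmetric] r(2)[symmetric] using r(1) by simp
  then obtain t where "x / r = cos t" "y / r = sin t"
    by (rule sincos_total_2pi)
  then have "p = polar r t"
    using r(1) by (simp add: p polar_def field_simps)
  then show ?thesis using that by (simp add: r_def)
qed

lemma helmholtz_zero_of_coeffs:
  assumes h: "helmholtz k S w w1 w2" and "open S" and Q: "{-R..R} \<times> {-R..R} \<subseteq> S"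
    and zero: "\<And>m r. 0 < r \<Longrightarrow> r < R \<Longrightarrow> fourier_coeff (\<lambda>t. w (polar r t)) m = 0"
    and p: "p \<noteq> 0" "norm p < R"
  shows "w p = 0"
proof -
  obtain t where t: "p = polar (norm p) t" by (rule polar_exists)
  have "w (norm p * Re (cis t), norm p * Im (cis t)) = 0"
  proof (rule fourier_coeff_zero_imp_zero[where G = "\<lambda>z. w (norm p * Re z, norm p * Im z)" and z = "cis t"])
    show "continuous_on (sphere 0 1) (\<lambda>z. w (norm p * Re z, norm p * Im z))"
      by (rule continuous_on_circle[OF helmholtz_continuous_on[OF h \<open>open S\<close>] Q]) (use p in auto)
    show "fourier_coeff (\<lambda>t. w (norm p * Re (cis t), norm p * Im (cis t))) m = 0" for m
      using zero[of "norm p" m] p unfolding polar_cis by simp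
  qed auto
  then show ?thesis using t unfolding polar_cis by simp
qed

text \<open>A single circle inside the zero ball determines every constant \<open>c m\<close>,
  because \<open>radial\<close> is positive there. All constants vanish, and with them the solution
  on all larger circles up to \<open>R\<close>.\<close>

lemma helmholtz_local_unique_continuation:
  assumes h: "helmholtz k S w w1 w2" and "open S" and Q: "{-R..R} \<times> {-R..R} \<subseteq> S"
    and kR: "k\<^sup>2 * R\<^sup>2 \<le> 1" and e: "0 < e" "\<And>p. norm p < e \<Longrightarrow> w p = 0"
    and p: "norm p < R"
  shows "w p = 0"
proof (cases "p = 0")
  case True
  then show ?thesis using e by simp
next
  case False
  have "R > 0" using p by (rule le_less_trans[OF norm_ge_zero])
  obtain c :: "int \<Rightarrow> complex" where
    c: "\<And>m r. 0 < r \<Longrightarrow> r < R \<Longrightarrow> fourier_coeff (\<lambda>t. w (polar r t)) m = c m * radial k (nat \<bar>m\<bar>) r"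
    using helmholtz_angular_coeff[OF h \<open>open S\<close> Q kR] by blast
  define s where "s = min e R / 2"
  have s: "0 < s" "s < R" "s < e" using e(1) \<open>R > 0\<close> by (auto simp: s_def)
  have "norm (polar s t) = s" for t
    using s(1) unfolding polar_def norm_Pair real_norm_def power2_abs power_mult_distrib
    by (simp flip: distrib_left)
  then have "fourier_coeff (\<lambda>t. w (polar s t)) m = 0" for m
    using s by (simp add: fourier_coeff_def e(2))
  then have "c m = 0" for m
    using c[OF s(1,2), of m] radial_pos[OF s(1,2) kR, of "nat \<bar>m\<bar>"] by simp
  then have "fourier_coeff (\<lambda>t. w (polar r t)) m = 0" if "0 < r" "r < R" for r m
    using c[OF that] by simp
  then show ?thesis
    by (rule helmholtz_zero_of_coeffs[OF h \<open>open S\<close> Q _ False p])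
qed

text \<open>The factor 3 leaves room to move the centre by less than \<open>R\<close> and still fit
  a ball of radius \<open>2 * R\<close>, which contains the square used by the local
  results.\<close>

lemma square_radius_exists:
  fixes k \<rho> :: real
  assumes "\<rho> > 0"
  obtains R where "0 < R" "3 * R \<le> \<rho>" "k\<^sup>2 * R\<^sup>2 \<le> 1"
proof
  define R where "R = min (\<rho> / 3) (1 / (\<bar>k\<bar> + 1))"
  show "0 < R" "3 * R \<le> \<rho>" using assms by (auto simp: R_def)
  have "\<bar>k\<bar> * R \<le> \<bar>k\<bar> * (1 / (\<bar>k\<bar> + 1))" by (intro mult_left_mono) (auto simp: R_def)
  also have "\<dots> \<le> 1" by simp
  finally have "(\<bar>k\<bar> * R)\<^sup>2 \<le> 1" using \<open>0 < R\<close> by (simp add: power_le_one)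
  then show "k\<^sup>2 * R\<^sup>2 \<le> 1" by (simp add: power_mult_distrib)
qed

lemma square_subset_ball:
  assumes "0 < R"
  shows "{-R..R} \<times> {-R..R} \<subseteq> ball 0 (2 * R :: real)"
proof clarify
  fix x y assume "x \<in> {-R..R}" "y \<in> {-R..R}"
  then have "x\<^sup>2 \<le> R\<^sup>2" "y\<^sup>2 \<le> R\<^sup>2" by (auto simp: abs_le_square_iff[symmetric])
  moreover have "R\<^sup>2 > 0" using assms by simp
  ultimately have "x\<^sup>2 + y\<^sup>2 < (2 * R)\<^sup>2" unfolding power_mult_distrib four_x_squared power2_eq_square[of "2::real"] by linarith
  then have "sqrt (x\<^sup>2 + y\<^sup>2) < 2 * R"
    using assms by (intro real_less_lsqrt) auto
  then show "(x, y) \<in> ball 0 (2 * R)" by (simp add: norm_Pair)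
qed

text \<open>Connectedness argument for the interior \<open>Z\<close> of the zero set. Relative
  closedness is the point: it needs a radius that does not shrink with the zero ball around a point
  of \<open>Z\<close>.\<close>

theorem helmholtz_unique_continuation:
  assumes h: "helmholtz k S w w1 w2" and "open S" "connected S"
    and q0: "q0 \<in> S" and e: "0 < e" "\<And>p. p \<in> ball q0 e \<Longrightarrow> w p = 0"
    and p: "p \<in> S"
  shows "w p = 0"
proof -
  define Z where "Z = {q \<in> S. \<exists>e>0. \<forall>p\<in>ball q e. w p = 0}"
  \<comment> \<open>\<open>R\<close> is chosen from \<open>k\<close> and a ball around
    \<open>p\<close> inside \<open>S\<close>, before \<open>q\<close> is given; the size of the zero
    ball around \<open>q\<close> does not enter.\<close>
  have step: "\<exists>R>0. \<forall>q\<in>Z. dist q p < R \<longrightarrow> p \<in> Z" if "p \<in> S" for p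
  proof -
    obtain \<rho> where \<rho>: "\<rho> > 0" "ball p \<rho> \<subseteq> S" by (rule openE[OF \<open>open S\<close> \<open>p \<in> S\<close>])
    obtain R where R: "0 < R" "3 * R \<le> \<rho>" "k\<^sup>2 * R\<^sup>2 \<le> 1" by (rule square_radius_exists[OF \<rho>(1)])
    have "p \<in> Z" if "q \<in> Z" "dist q p < R" for q
    proof -
      obtain e where e: "e > 0" "\<And>p. p \<in> ball q e \<Longrightarrow> w p = 0" using \<open>q \<in> Z\<close> unfolding Z_def by blast
      have in_S: "q + v \<in> S" if "v \<in> ball 0 (2 * R)" for v
      proof -
        have "dist p (q + v) \<le> dist p q + dist q (q + v)" by (rule dist_triangle)
        also have "\<dots> < R + 2 * R" using that \<open>dist q p < R\<close> by (intro add_strict_mono) (auto simp: dist_norm norm_minus_commute)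
        finally show ?thesis using \<rho>(2) R by auto
      qed
      have ball: "w y = 0" if "dist q y < R" for y
      proof -
        have "w (q + (y - q)) = 0"
        proof (rule helmholtz_local_unique_continuation[OF helmholtz_translate[OF h in_S] open_ball square_subset_ball[OF R(1)] R(3) e(1)])
          show "w (q + v) = 0" if "norm v < e" for v
            using e(2)[of "q + v"] that by (simp add: dist_norm)
          show "norm (y - q) < R" using that by (simp add: dist_norm norm_minus_commute)
        qed
        then show ?thesis by simp
      qed
      have "ball p (R - dist q p) \<subseteq> {y. dist q y < R}"
      proof clarify
        fix y assume "y \<in> ball p (R - dist q p)"
        then show "dist q y < R" using dist_triangle[of q y p] by simp
      qed
      then show "p \<in> Z"
        unfolding Z_def using \<open>p \<in> S\<close> \<open>dist q p < R\<close> ball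
        by (intro CollectI conjI exI[of _ "R - dist q p"]) auto
    qed
    then show ?thesis using R(1) by blast
  qed
  have "open Z"
  proof (rule openI)
    fix q assume q: "q \<in> Z"
    then obtain e where e: "e > 0" "\<And>p. p \<in> ball q e \<Longrightarrow> w p = 0" unfolding Z_def by blast
    obtain d where d: "d > 0" "ball q d \<subseteq> S" 
      using openE[OF \<open>open S\<close>, of q] q unfolding Z_def by blast
    have "ball q (min d e) \<subseteq> Z"
    proof
      fix y assume y: "y \<in> ball q (min d e)"
      have "ball y (e - dist q y) \<subseteq> ball q e"
      proof
        fix x assume "x \<in> ball y (e - dist q y)"
        then show "x \<in> ball q e" using dist_triangle[of q x y] by simp
      qed
      then show "y \<in> Z"
        unfolding Z_def using y d e by (intro CollectI conjI exI[of _ "e - dist q y"]) auto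
    qed
    then show "\<exists>T>0. ball q T \<subseteq> Z" using d(1) e(1) by (intro exI[of _ "min d e"]) auto
  qed
  moreover have "open (S - Z)"
  proof (rule openI)
    fix q assume q: "q \<in> S - Z"
    obtain R where R: "R > 0" "\<forall>z\<in>Z. dist z q < R \<longrightarrow> q \<in> Z" using step q by blast
    obtain d where d: "d > 0" "ball q d \<subseteq> S" using openE[OF \<open>open S\<close>, of q] q by blast
    have "ball q (min d R) \<subseteq> S - Z" using d R q by (auto simp: dist_commute)
    then show "\<exists>T>0. ball q T \<subseteq> S - Z" using d(1) R(1) by (intro exI[of _ "min d R"]) auto
  qed
  moreover have "q0 \<in> Z" using q0 e unfolding Z_def by blast
  ultimately have "S - Z = {}"
    using \<open>connected S\<close> q0 connectedD[of S Z "S - Z"] by (auto simp: Z_def)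
  then have "p \<in> Z" using p by blast
  then show ?thesis unfolding Z_def by force
qed

section \<open>Corners with irrational angle\<close>

text \<open>A summable majorant on the integers: the linear factor absorbs the multiplier
  \<open>m\<close> produced by differentiating in the angle, and the powers of 1/2 come from
  restricting to \<open>2 * r \<le> r0\<close>.\<close>

definition int_weight :: "int \<Rightarrow> real" where
  "int_weight m = (real_of_int \<bar>m\<bar> + 1) * (1 / 2) ^ nat \<bar>m\<bar>"

lemma int_weight_summable: "int_weight summable_on UNIV"
proof -
  have "summable (\<lambda>n. diffs (\<lambda>_. 1) n * (1 / 2 :: real) ^ n)"
    by (rule termdiff_converges[where K = 1]) auto
  then have "summable (\<lambda>n. (real n + 1) * (1 / 2) ^ n)"
    by (simp add: diffs_def add.commute)
  then have s: "(\<lambda>n. (real n + 1) * (1 / 2) ^ n) summable_on UNIV"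
    by (subst summable_on_UNIV_nonneg_real_iff) auto
  have "int_weight summable_on range int"
    using s by (subst summable_on_reindex) (auto simp: o_def int_weight_def)
  moreover have "int_weight summable_on range (\<lambda>n. - int n)"
    using s by (subst summable_on_reindex) (auto simp: o_def int_weight_def inj_on_def)
  ultimately have "int_weight summable_on (range int \<union> range (\<lambda>n. - int n))"
    by (rule summable_on_union)
  moreover have "range int \<union> range (\<lambda>n. - int n) = UNIV"
    by (auto intro: int_cases2)
  ultimately show ?thesis by simp
qed

text \<open>Split \<open>r / r0\<close> as \<open>(2 * r / r0) * (1 / 2)\<close>. Beyond the indices
  \<open>N\<close> and \<open>- N\<close> the first factor contributes at most its power
  \<open>Suc N\<close>, while the second leaves a summable weight, so the remainder is of order
  \<open>r ^ Suc N\<close>. The condition \<open>N \<ge> 1\<close> keeps the two leading indices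
  distinct.\<close>

lemma int_series_leading_terms:
  fixes a :: "int \<Rightarrow> complex"
  assumes r: "0 < r" "0 < r0" "2 * r \<le> r0" and hs: "(a has_sum S) UNIV"
    and bound: "\<And>m. norm (a m) \<le> K * (real_of_int \<bar>m\<bar> + 1) * (r / r0) ^ nat \<bar>m\<bar>" and "K \<ge> 0"
    and zero: "\<And>m. nat \<bar>m\<bar> < N \<Longrightarrow> a m = 0" and N: "N \<ge> 1"
  shows "norm (S - (a (int N) + a (- int N))) \<le> K * (2 * r / r0) ^ Suc N * infsum int_weight UNIV"
proof -
  define F where "F = {int N, - int N}"
  define a' where "a' m = (if m \<in> F then 0 else a m)" for m
  define q where "q = 2 * r / r0"
  have q: "0 \<le> q" "q \<le> 1" using r by (auto simp: q_def)
  have "(a has_sum sum a F) F"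
    by (rule has_sum_finite) (simp add: F_def)
  then have "(a has_sum (S - sum a F)) (UNIV - F)"
    using hs by (intro has_sum_Diff) auto
  moreover have "(a has_sum (S - sum a F)) (UNIV - F) \<longleftrightarrow> (a' has_sum (S - sum a F)) UNIV"
    by (rule has_sum_cong_neutral) (auto simp: a'_def)
  ultimately have "(a' has_sum (S - sum a F)) UNIV" by blast
  moreover have "((\<lambda>m. K * q ^ Suc N * int_weight m) has_sum (K * q ^ Suc N * infsum int_weight UNIV)) UNIV"
    using int_weight_summable by (intro has_sum_cmult_right) (rule has_sum_infsum)
  moreover have "norm (a' m) \<le> K * q ^ Suc N * int_weight m" for m
  proof -
    consider "m \<in> F \<or> nat \<bar>m\<bar> < N" | "m \<notin> F" "nat \<bar>m\<bar> \<ge> Suc N"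
    proof -
      have "m \<in> F \<or> nat \<bar>m\<bar> < N \<or> m \<notin> F \<and> nat \<bar>m\<bar> \<ge> Suc N"
        unfolding F_def insert_iff empty_iff by linarith
      then show ?thesis using that by blast
    qed
    then show ?thesis
    proof cases
      case 1
      then have "a' m = 0" using zero by (auto simp: a'_def)
      then show ?thesis using \<open>K \<ge> 0\<close> q by (simp add: int_weight_def)
    next
      case 2
      have "(r / r0) ^ nat \<bar>m\<bar> = q ^ nat \<bar>m\<bar> * (1 / 2) ^ nat \<bar>m\<bar>"
        by (simp add: q_def flip: power_mult_distrib)
      also have "\<dots> \<le> q ^ Suc N * (1 / 2) ^ nat \<bar>m\<bar>"
        using 2 q by (intro mult_right_mono power_decreasing) auto
      finally have "K * (real_of_int \<bar>m\<bar> + 1) * (r / r0) ^ nat \<bar>m\<bar> \<le>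
          K * (real_of_int \<bar>m\<bar> + 1) * (q ^ Suc N * (1 / 2) ^ nat \<bar>m\<bar>)"
        using \<open>K \<ge> 0\<close> by (intro mult_left_mono) auto
      also have "\<dots> = K * q ^ Suc N * int_weight m"
        by (simp add: int_weight_def)
      finally show ?thesis using bound[of m] 2(1) by (simp add: a'_def)
    qed
  qed
  ultimately have "norm (S - sum a F) \<le> K * q ^ Suc N * infsum int_weight UNIV"
    by (rule norm_infsum_le)
  moreover have "sum a F = a (int N) + a (- int N)"
    using N by (simp add: F_def)
  ultimately show ?thesis by (simp add: q_def)
qed

lemma bessel_series_0: "bessel_series k n 0 = 1 / fact n"
  using powser_zero[of "bessel_coeff k n"] by (simp add: bessel_series_def bessel_coeff_def)

text \<open>The multiplier \<open>\<mu>\<close> lets one limit serve both the field and its angular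
  derivative. Both leading terms share the factor \<open>bessel_series k N (r\<^sup>2)\<close>,
  which tends to \<open>1 / fact N\<close>, and the remainder is of one order higher in
  \<open>r\<close>.\<close>

lemma bessel_expansion_leading_limit:
  fixes c \<mu> :: "int \<Rightarrow> complex" and S :: "real \<Rightarrow> complex"
  assumes r0: "0 < r0" and K: "K \<ge> 0" and N: "N \<ge> 1"
    and hs: "\<And>r. 0 < r \<Longrightarrow> 2 * r \<le> r0 \<Longrightarrow>
      ((\<lambda>m. \<mu> m * (c m * radial k (nat \<bar>m\<bar>) r)) has_sum S r) UNIV"
    and \<mu>: "\<And>m. norm (\<mu> m) \<le> real_of_int \<bar>m\<bar> + 1"
    and bound: "\<And>m r. 0 < r \<Longrightarrow> 2 * r \<le> r0 \<Longrightarrow>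
      norm (c m * radial k (nat \<bar>m\<bar>) r) \<le> K * (r / r0) ^ nat \<bar>m\<bar>"
    and zero: "\<And>m. nat \<bar>m\<bar> < N \<Longrightarrow> c m = 0"
  shows "((\<lambda>r. S r / of_real (r ^ N)) \<longlongrightarrow>
    (\<mu> (int N) * c (int N) + \<mu> (- int N) * c (- int N)) / fact N) (at_right 0)"
proof -
  define L where "L = \<mu> (int N) * c (int N) + \<mu> (- int N) * c (- int N)"
  define C where "C = K * (2 / r0) ^ Suc N * infsum int_weight UNIV"
  have near: "eventually (\<lambda>r. 0 < r \<and> 2 * r \<le> r0) (at_right (0::real))"
    using eventually_at_right_less[of 0] eventually_at_right_field[of "\<lambda>r. r < r0 / 2" 0]
    by (auto simp: eventually_at_right_field intro!: exI[of _ "r0 / 2"] r0)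
  have "eventually (\<lambda>r. norm (S r / of_real (r ^ N) - L * of_real (bessel_series k N (r\<^sup>2))) \<le> C * r) (at_right 0)"
    using near
  proof eventually_elim
    case (elim r)
    have "norm (S r - (\<mu> (int N) * (c (int N) * radial k (nat \<bar>int N\<bar>) r)
        + \<mu> (- int N) * (c (- int N) * radial k (nat \<bar>- int N\<bar>) r)))
        \<le> K * (2 * r / r0) ^ Suc N * infsum int_weight UNIV"
    proof (rule int_series_leading_terms)
      show "norm (\<mu> m * (c m * radial k (nat \<bar>m\<bar>) r)) \<le> K * (real_of_int \<bar>m\<bar> + 1) * (r / r0) ^ nat \<bar>m\<bar>" for m
      proof -
        have "norm (\<mu> m * (c m * radial k (nat \<bar>m\<bar>) r)) = norm (\<mu> m) * norm (c m * radial k (nat \<bar>m\<bar>) r)"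
          by (rule norm_mult)
        also have "\<dots> \<le> (real_of_int \<bar>m\<bar> + 1) * (K * (r / r0) ^ nat \<bar>m\<bar>)"
          using elim by (intro mult_mono \<mu> bound) auto
        finally show ?thesis by (simp add: mult_ac)
      qed
    qed (use elim r0 K N hs zero in auto)
    also have "K * (2 * r / r0) ^ Suc N * infsum int_weight UNIV = C * r * r ^ N"
      by (simp add: C_def power_divide power_mult_distrib)
    also have "\<mu> (int N) * (c (int N) * radial k (nat \<bar>int N\<bar>) r)
        + \<mu> (- int N) * (c (- int N) * radial k (nat \<bar>- int N\<bar>) r)
        = of_real (r ^ N) * (L * of_real (bessel_series k N (r\<^sup>2)))"
      by (simp add: radial_def L_def algebra_simps)
    finally have le: "norm (S r - of_real (r ^ N) * (L * of_real (bessel_series k N (r\<^sup>2)))) \<le> C * r * r ^ N" .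
    have rN: "r ^ N > 0" using elim by simp
    have "S r / of_real (r ^ N) - L * of_real (bessel_series k N (r\<^sup>2))
        = (S r - of_real (r ^ N) * (L * of_real (bessel_series k N (r\<^sup>2)))) / of_real (r ^ N)"
      using elim by (simp add: diff_divide_distrib)
    also have "norm \<dots> = norm (S r - of_real (r ^ N) * (L * of_real (bessel_series k N (r\<^sup>2)))) / r ^ N"
      using elim by (simp add: norm_divide norm_power)
    also have "\<dots> \<le> C * r"
      using le rN by (simp add: divide_le_eq)
    finally show ?case .
  qed
  moreover have "((\<lambda>r. C * r) \<longlongrightarrow> 0) (at_right 0)"
    by (auto intro!: tendsto_eq_intros)
  ultimately have 1: "((\<lambda>r. S r / of_real (r ^ N) - L * of_real (bessel_series k N (r\<^sup>2))) \<longlongrightarrow> 0) (at_right 0)"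
    by (rule Lim_null_comparison)
  have cont: "isCont (bessel_series k N) 0"
    using bessel_series_continuous(1)[of UNIV] by (simp add: continuous_on_eq_continuous_at)
  have "((\<lambda>r::real. r\<^sup>2) \<longlongrightarrow> 0) (at_right 0)"
    by (auto intro!: tendsto_eq_intros)
  from isCont_tendsto_compose[OF cont this]
  have "((\<lambda>r. bessel_series k N (r\<^sup>2)) \<longlongrightarrow> 1 / fact N) (at_right 0)"
    by (simp add: bessel_series_0)
  then have 2: "((\<lambda>r. L * of_real (bessel_series k N (r\<^sup>2))) \<longlongrightarrow> L * of_real (1 / fact N)) (at_right 0)"
    by (intro tendsto_intros)
  have "((\<lambda>r. (S r / of_real (r ^ N) - L * of_real (bessel_series k N (r\<^sup>2))) + L * of_real (bessel_series k N (r\<^sup>2)))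
      \<longlongrightarrow> 0 + L * of_real (1 / fact N)) (at_right 0)"
    by (rule tendsto_add[OF 1 2])
  then show ?thesis by (simp add: L_def)
qed

section \<open>Decay of the angular coefficients and expansions on small circles\<close>

lemma fourier_coeff_norm_bound:
  fixes g :: "real \<Rightarrow> complex"
  assumes "continuous_on {0..2 * pi} g" "\<And>t. t \<in> {0..2 * pi} \<Longrightarrow> norm (g t) \<le> M"
  shows "norm (fourier_coeff g m) \<le> M * (2 * pi)"
proof -
  have "norm (integral {0..2 * pi} (\<lambda>t. g t * cis (- (of_int m * t)))) \<le> M * (2 * pi - 0)"
  proof (rule integral_bound)
    show "continuous_on {0..2 * pi} (\<lambda>t. g t * cis (- (of_int m * t)))"
      using assms(1) by (intro continuous_on_mult) (auto simp: cis_conv_exp intro!: continuous_intros)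
  qed (use assms in \<open>auto simp: norm_mult\<close>)
  then show ?thesis by (simp add: fourier_coeff_def)
qed

text \<open>On the circle of radius \<open>r0\<close> the coefficients are bounded uniformly in
  \<open>m\<close>. Moving to radius \<open>r\<close> costs the quotient of two values of
  \<open>radial\<close>, at most \<open>2 * (r / r0) ^ n\<close> by \<open>radial_bound\<close>; the
  2 is 4/3 over 2/3.\<close>

lemma helmholtz_angular_coeff_bound:
  fixes c :: "int \<Rightarrow> complex"
  assumes h: "helmholtz k S w w1 w2" and "open S" and Q: "{-R..R} \<times> {-R..R} \<subseteq> S"
    and kR: "k\<^sup>2 * R\<^sup>2 \<le> 1" and r0: "0 < r0" "r0 < R"
    and c: "\<And>m r. 0 < r \<Longrightarrow> r < R \<Longrightarrow> fourier_coeff (\<lambda>t. w (polar r t)) m = c m * radial k (nat \<bar>m\<bar>) r"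
  obtains K where "K \<ge> 0" "\<And>m r. 0 < r \<Longrightarrow> r \<le> r0 \<Longrightarrow> norm (c m * radial k (nat \<bar>m\<bar>) r) \<le> K * (r / r0) ^ nat \<bar>m\<bar>"
proof -
  have cont: "continuous_on {0..2 * pi} (\<lambda>t. w (polar r0 t))"
    by (rule continuous_on_polar_circle[OF helmholtz_continuous_on[OF h \<open>open S\<close>] Q]) (use r0 in auto)
  then have "compact ((\<lambda>t. w (polar r0 t)) ` {0..2 * pi})"
    by (rule compact_continuous_image) simp
  then obtain M where M: "M > 0" "\<And>t. t \<in> {0..2 * pi} \<Longrightarrow> norm (w (polar r0 t)) \<le> M"
    by (auto dest!: compact_imp_bounded simp: bounded_pos)
  have le: "norm (c m) * radial k (nat \<bar>m\<bar>) r0 \<le> M * (2 * pi)" for m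
    using fourier_coeff_norm_bound[OF cont M(2), of m] c[OF r0, of m] radial_pos[OF r0 kR, of "nat \<bar>m\<bar>"]
    by (simp add: norm_mult)
  have kr: "k\<^sup>2 * r\<^sup>2 \<le> 1" if "0 < r" "r \<le> r0" for r
  proof -
    have "k\<^sup>2 * r\<^sup>2 \<le> k\<^sup>2 * R\<^sup>2" using that r0 by (intro mult_left_mono power_mono) auto
    then show ?thesis using kR by linarith
  qed
  show ?thesis
  proof
    show "0 \<le> 2 * (M * (2 * pi))" using M by simp
    fix m r assume r: "0 < r" "r \<le> r0"
    let ?n = "nat \<bar>m\<bar>"
    have f: "fact ?n * radial k ?n r \<le> 4 / 3 * r ^ ?n"
      using r by (intro radial_bound(2) kr) auto
    have g: "2 / 3 * r0 ^ ?n \<le> fact ?n * radial k ?n r0"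
      using r0 by (intro radial_bound(1) kr) auto
    have pos: "radial k ?n r > 0" using r r0 kR by (intro radial_pos[of r R]) auto
    have "fact ?n * (radial k ?n r * r0 ^ ?n) \<le> (4 / 3 * r ^ ?n) * r0 ^ ?n"
      using mult_right_mono[OF f, of "r0 ^ ?n"] r0 by (simp add: mult_ac)
    also have "\<dots> = 2 * r ^ ?n * (2 / 3 * r0 ^ ?n)" by simp
    also have "\<dots> \<le> 2 * r ^ ?n * (fact ?n * radial k ?n r0)"
      using r by (intro mult_left_mono g) auto
    finally have "fact ?n * (radial k ?n r * r0 ^ ?n) \<le> fact ?n * (2 * r ^ ?n * radial k ?n r0)"
      by (simp only: mult_ac)
    then have "radial k ?n r * r0 ^ ?n \<le> 2 * r ^ ?n * radial k ?n r0"
      by (rule mult_left_le_imp_le) simp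
    then have "radial k ?n r \<le> 2 * (r / r0) ^ ?n * radial k ?n r0"
      using r0 by (simp add: power_divide field_simps)
    then have "norm (c m) * radial k ?n r \<le> norm (c m) * (2 * (r / r0) ^ ?n * radial k ?n r0)"
      by (intro mult_left_mono) auto
    also have "\<dots> = 2 * (r / r0) ^ ?n * (norm (c m) * radial k ?n r0)" by simp
    also have "\<dots> \<le> 2 * (r / r0) ^ ?n * (M * (2 * pi))"
      using r r0 by (intro mult_left_mono le) auto
    finally show "norm (c m * radial k ?n r) \<le> 2 * (M * (2 * pi)) * (r / r0) ^ ?n"
      using pos by (simp add: norm_mult mult_ac)
  qed
qed

text \<open>The derivative of \<open>w (polar r t)\<close> in \<open>t\<close>, that is,
  \<open>r\<close> times the derivative normal to the ray at angle \<open>t\<close>.\<close>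

definition angular_deriv ::
  "(real \<times> real \<Rightarrow> complex) \<Rightarrow> (real \<times> real \<Rightarrow> complex) \<Rightarrow> real \<Rightarrow> real \<Rightarrow> complex" where
  "angular_deriv w1 w2 r t =
    of_real r * (of_real (cos t) * w2 (polar r t) - of_real (sin t) * w1 (polar r t))"

text \<open>Integration by parts over the full circle; the boundary terms cancel by
  periodicity.\<close>

lemma fourier_coeff_angular_deriv:
  assumes h: "helmholtz k S w w1 w2" and "open S" and Q: "{-R..R} \<times> {-R..R} \<subseteq> S"
    and r: "0 \<le> r" "r < R"
  shows "fourier_coeff (angular_deriv w1 w2 r) m = \<i> * of_int m * fourier_coeff (\<lambda>t. w (polar r t)) m"
proof -
  have d: "((\<lambda>t. w (polar r t)) has_vector_derivative angular_deriv w1 w2 r t) (at t within T)" for t T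
  proof -
    have "((w \<circ> polar r) has_vector_derivative
        (\<lambda>h. fst h *\<^sub>R w1 (polar r t) + snd h *\<^sub>R w2 (polar r t)) (- (r * sin t), r * cos t)) (at t within T)"
      by (rule vector_derivative_diff_chain_within[OF polar_has_vector_derivative(1)])
        (rule has_derivative_at_withinI, rule helmholtz_has_derivative[OF h \<open>open S\<close> polar_mem[OF Q r]])
    then show ?thesis
      by (simp add: o_def angular_deriv_def scaleR_conv_of_real algebra_simps)
  qed
  have e: "((\<lambda>t. cis (- (of_int m * t))) has_vector_derivative - (\<i> * of_int m) * cis (- (of_int m * t))) (at t within T)" for t T
  proof -
    have "((\<lambda>z. exp (- (\<i> * of_int m) * z)) has_field_derivative
        - (\<i> * of_int m) * exp (- (\<i> * of_int m) * of_real t)) (at (of_real t))"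
      by (auto intro!: derivative_eq_intros)
    from has_vector_derivative_real_field[OF this]
    have "((\<lambda>t. exp (- (\<i> * of_int m) * of_real t)) has_vector_derivative
        - (\<i> * of_int m) * exp (- (\<i> * of_int m) * of_real t)) (at t within T)" .
    then show ?thesis by (simp add: cis_conv_exp mult.assoc)
  qed
  have "((\<lambda>t. w (polar r t) * (- (\<i> * of_int m) * cis (- (of_int m * t)))
        + angular_deriv w1 w2 r t * cis (- (of_int m * t))) has_integral
      (w (polar r (2 * pi)) * cis (- (of_int m * (2 * pi))) - w (polar r 0) * cis (- (of_int m * 0)))) {0..2 * pi}"
    by (rule fundamental_theorem_of_calculus[OF _ has_vector_derivative_mult[OF d e]]) simp
  moreover have "w (polar r (2 * pi)) * cis (- (of_int m * (2 * pi))) - w (polar r 0) * cis (- (of_int m * 0)) = 0"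
  proof -
    have "cis (- (of_int m * (2 * pi))) = 1"
      using cis_multiple_2pi[of "of_int (- m)"] by (simp add: mult_ac)
    then show ?thesis by (simp add: polar_def)
  qed
  ultimately have 1: "((\<lambda>t. w (polar r t) * (- (\<i> * of_int m) * cis (- (of_int m * t)))
        + angular_deriv w1 w2 r t * cis (- (of_int m * t))) has_integral 0) {0..2 * pi}"
    by simp
  have "(\<lambda>t. w (polar r t) * cis (- (of_int m * t))) integrable_on {0..2 * pi}"
    by (intro integrable_continuous_real continuous_on_mult
        continuous_on_polar_circle[OF helmholtz_continuous_on[OF h \<open>open S\<close>] Q r])
      (auto simp: cis_conv_exp intro!: continuous_intros)
  then have 2: "((\<lambda>t. \<i> * of_int m * (w (polar r t) * cis (- (of_int m * t)))) has_integral
      \<i> * of_int m * fourier_coeff (\<lambda>t. w (polar r t)) m) {0..2 * pi}"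
    unfolding fourier_coeff_def by (intro has_integral_mult_right integrable_integral)
  have "((\<lambda>t. angular_deriv w1 w2 r t * cis (- (of_int m * t))) has_integral
      \<i> * of_int m * fourier_coeff (\<lambda>t. w (polar r t)) m) {0..2 * pi}"
    using has_integral_add[OF 1 2] by (simp add: algebra_simps)
  then show ?thesis
    unfolding fourier_coeff_def[of "angular_deriv w1 w2 r"] by (rule integral_unique)
qed

text \<open>Since \<open>2 * r \<le> r0\<close>, the coefficients are dominated by
  \<open>int_weight\<close> even after multiplication by \<open>m\<close>. The second series is
  obtained by Fourier inversion of the angular derivative itself, so no series is differentiated
  termwise.\<close>

lemma helmholtz_bessel_expansion:
  assumes h: "helmholtz k S w w1 w2" and "open S" and Q: "{-R..R} \<times> {-R..R} \<subseteq> S"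
    and r0: "0 < r0" "r0 < R" and r: "0 < r" "2 * r \<le> r0" and K: "K \<ge> 0"
    and bound: "\<And>m. norm (fourier_coeff (\<lambda>t. w (polar r t)) m) \<le> K * (r / r0) ^ nat \<bar>m\<bar>"
  shows "((\<lambda>m. cis (of_int m * t) / (2 * pi) * fourier_coeff (\<lambda>t. w (polar r t)) m) has_sum w (polar r t)) UNIV"
    and "((\<lambda>m. \<i> * of_int m * cis (of_int m * t) / (2 * pi) * fourier_coeff (\<lambda>t. w (polar r t)) m)
      has_sum angular_deriv w1 w2 r t) UNIV"
proof -
  have sm: "(\<lambda>m. K * int_weight m) summable_on UNIV"
    by (intro summable_on_cmult_right int_weight_summable)
  have fb: "of_int \<bar>m\<bar> * norm (fourier_coeff (\<lambda>t. w (polar r t)) m) \<le> K * int_weight m"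
    "norm (fourier_coeff (\<lambda>t. w (polar r t)) m) \<le> K * int_weight m" for m
  proof -
    have "(r / r0) ^ nat \<bar>m\<bar> \<le> (1 / 2) ^ nat \<bar>m\<bar>"
      using r r0 by (intro power_mono) (auto simp: field_simps)
    then have "norm (fourier_coeff (\<lambda>t. w (polar r t)) m) \<le> K * (1 / 2) ^ nat \<bar>m\<bar>"
      using bound[of m] mult_left_mono[OF _ K] order_trans by blast
    then have *: "x * norm (fourier_coeff (\<lambda>t. w (polar r t)) m) \<le> (real_of_int \<bar>m\<bar> + 1) * (K * (1 / 2) ^ nat \<bar>m\<bar>)"
      if "0 \<le> x" "x \<le> real_of_int \<bar>m\<bar> + 1" for x
      using that K by (intro mult_mono) auto
    show "of_int \<bar>m\<bar> * norm (fourier_coeff (\<lambda>t. w (polar r t)) m) \<le> K * int_weight m"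
      "norm (fourier_coeff (\<lambda>t. w (polar r t)) m) \<le> K * int_weight m"
      using *[of "of_int \<bar>m\<bar>"] *[of 1] by (auto simp: int_weight_def mult_ac)
  qed
  have rR: "0 \<le> r" "r < R" using r r0 by auto
  define G where "G z = w (r * Re z, r * Im z)" for z
  have Gcis: "G (cis t) = w (polar r t)" for t
    unfolding G_def polar_cis ..
  have "((\<lambda>m. fourier_coeff (\<lambda>t. G (cis t)) m / (2 * pi) * cis (of_int m * t)) has_sum G (cis t)) UNIV"
  proof (rule fourier_inversion_abs_summable[OF _ sm])
    show "continuous_on (sphere 0 1) G"
      unfolding G_def by (rule continuous_on_circle[OF helmholtz_continuous_on[OF h \<open>open S\<close>] Q rR])
    show "norm (fourier_coeff (\<lambda>t. G (cis t)) m) \<le> K * int_weight m" for m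
      unfolding Gcis by (rule fb)
  qed
  then show "((\<lambda>m. cis (of_int m * t) / (2 * pi) * fourier_coeff (\<lambda>t. w (polar r t)) m) has_sum w (polar r t)) UNIV"
    unfolding Gcis by (simp add: mult.commute)
  define H where "H z = of_real r * (of_real (Re z) * w2 (r * Re z, r * Im z) - of_real (Im z) * w1 (r * Re z, r * Im z))" for z
  have Hcis: "H (cis t) = angular_deriv w1 w2 r t" for t
    unfolding H_def polar_cis angular_deriv_def by simp
  have fH: "fourier_coeff (\<lambda>t. H (cis t)) m = \<i> * of_int m * fourier_coeff (\<lambda>t. w (polar r t)) m" for m
    unfolding Hcis by (rule fourier_coeff_angular_deriv[OF h \<open>open S\<close> Q rR])
  have "((\<lambda>m. fourier_coeff (\<lambda>t. H (cis t)) m / (2 * pi) * cis (of_int m * t)) has_sum H (cis t)) UNIV"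
  proof (rule fourier_inversion_abs_summable[OF _ sm])
    show "continuous_on (sphere 0 1) H"
      unfolding H_def using helmholtz_continuous_on_gradient[OF h]
      by (intro continuous_intros continuous_on_circle[OF _ Q rR])
    show "norm (fourier_coeff (\<lambda>t. H (cis t)) m) \<le> K * int_weight m" for m
      unfolding fH using fb(1)[of m] by (simp add: norm_mult)
  qed
  then show "((\<lambda>m. \<i> * of_int m * cis (of_int m * t) / (2 * pi) * fourier_coeff (\<lambda>t. w (polar r t)) m)
      has_sum angular_deriv w1 w2 r t) UNIV"
    unfolding fH unfolding Hcis by (simp add: mult_ac)
qed

text \<open>\<open>(- sin t, cos t)\<close> is a unit normal of the ray. Its orientation relative to
  the domain is absorbed into the sign of \<open>e\<close>, so both edges of a corner fit the same
  form; only the behaviour near the tip matters.\<close>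

definition impedance_ray ::
  "(real \<times> real \<Rightarrow> complex) \<Rightarrow> (real \<times> real \<Rightarrow> complex) \<Rightarrow> (real \<times> real \<Rightarrow> complex) \<Rightarrow> real \<Rightarrow> bool" where
  "impedance_ray w w1 w2 t \<longleftrightarrow>
     (\<forall>\<^sub>F r in at_right 0. w (polar r t) = 0) \<or>
     (\<exists>e. \<forall>\<^sub>F r in at_right 0.
        of_real (cos t) * w2 (polar r t) - of_real (sin t) * w1 (polar r t) + e * w (polar r t) = 0)"

text \<open>Multiplied by \<open>r / r ^ N\<close>, the impedance term keeps a spare factor
  \<open>r\<close> and disappears in the limit. What remains is \<open>A + B = 0\<close> on a
  Dirichlet ray and \<open>A - B = 0\<close> otherwise, where \<open>N \<ge> 1\<close> allows
  cancelling \<open>N\<close>.\<close>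

lemma impedance_ray_leading:
  fixes A B :: complex
  assumes ray: "impedance_ray w w1 w2 t" and N: "N \<ge> 1"
    and lim: "((\<lambda>r. w (polar r t) / of_real (r ^ N)) \<longlongrightarrow> A + B) (at_right 0)"
    and lim': "((\<lambda>r. angular_deriv w1 w2 r t / of_real (r ^ N)) \<longlongrightarrow> \<i> * of_nat N * (A - B)) (at_right 0)"
  shows "A = B \<or> A = - B"
  using ray unfolding impedance_ray_def
proof (elim disjE exE)
  assume "\<forall>\<^sub>F r in at_right 0. w (polar r t) = 0"
  then have "\<forall>\<^sub>F r in at_right 0. w (polar r t) / of_real (r ^ N) = 0"
    by eventually_elim simp
  then have "((\<lambda>r. w (polar r t) / of_real (r ^ N)) \<longlongrightarrow> 0) (at_right 0)"
    by (rule tendsto_eventually)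
  from tendsto_unique[OF _ lim this] have "A + B = 0" by simp
  then show ?thesis by (simp add: eq_neg_iff_add_eq_0)
next
  fix e
  assume ev: "\<forall>\<^sub>F r in at_right 0.
    of_real (cos t) * w2 (polar r t) - of_real (sin t) * w1 (polar r t) + e * w (polar r t) = 0"
  have "((\<lambda>r. angular_deriv w1 w2 r t / of_real (r ^ N) + of_real r * e * (w (polar r t) / of_real (r ^ N)))
      \<longlongrightarrow> \<i> * of_nat N * (A - B) + of_real 0 * e * (A + B)) (at_right 0)"
    by (intro tendsto_intros lim lim')
  note lim0 = this
  have "\<forall>\<^sub>F r in at_right 0. angular_deriv w1 w2 r t / of_real (r ^ N)
      + of_real r * e * (w (polar r t) / of_real (r ^ N)) = 0"
    using ev
  proof eventually_elim
    case (elim r)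
    have "angular_deriv w1 w2 r t / of_real (r ^ N) + of_real r * e * (w (polar r t) / of_real (r ^ N))
      = of_real r * (of_real (cos t) * w2 (polar r t) - of_real (sin t) * w1 (polar r t) + e * w (polar r t)) / of_real (r ^ N)"
      unfolding angular_deriv_def by (simp add: add_divide_distrib distrib_left mult.assoc)
    then show ?case using elim by simp
  qed
  from tendsto_unique[OF _ lim0 tendsto_eventually[OF this]]
  have "\<i> * of_nat N * (A - B) + of_real 0 * e * (A + B) = 0" by simp
  then show ?thesis using N by simp
qed

text \<open>If the lowest nonvanishing angular modes are \<open>A cis (N t) + B cis (- N t)\<close>, the boundary
  condition on a ray at angle \<open>t\<close> forces \<open>A cis (2 N t) = B\<close> (Neumann, Robin) or
  \<open>A cis (2 N t) = - B\<close> (Dirichlet). Two such rays enclose a rational multiple of \<open>\<pi>\<close>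
  unless \<open>A = B = 0\<close>. The Robin term does not contribute to leading order because \<open>N \<ge> 1\<close>,
  that is, because \<open>w 0 = 0\<close>.\<close>

theorem helmholtz_corner_zero:
  assumes h: "helmholtz k S w w1 w2" and "open S" and Q: "{-R..R} \<times> {-R..R} \<subseteq> S"
    and kR: "k\<^sup>2 * R\<^sup>2 \<le> 1" and "0 < R"
    and w0: "w 0 = 0" and rays: "impedance_ray w w1 w2 t1" "impedance_ray w w1 w2 t2"
    and irr: "(t2 - t1) / pi \<notin> \<rat>" and p: "norm p < R"
  shows "w p = 0"
proof (cases "p = 0")
  case False
  obtain c :: "int \<Rightarrow> complex" where
    c: "\<And>m r. 0 < r \<Longrightarrow> r < R \<Longrightarrow> fourier_coeff (\<lambda>t. w (polar r t)) m = c m * radial k (nat \<bar>m\<bar>) r"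
    using helmholtz_angular_coeff[OF h \<open>open S\<close> Q kR] by blast
  define r0 where "r0 = R / 2"
  have r0: "0 < r0" "r0 < R" using \<open>0 < R\<close> by (auto simp: r0_def)
  obtain K where K: "K \<ge> 0"
    "\<And>m r. 0 < r \<Longrightarrow> r \<le> r0 \<Longrightarrow> norm (c m * radial k (nat \<bar>m\<bar>) r) \<le> K * (r / r0) ^ nat \<bar>m\<bar>"
    using helmholtz_angular_coeff_bound[OF h \<open>open S\<close> Q kR r0 c] by blast
  have expansion: "((\<lambda>m. cis (of_int m * t) / (2 * pi) * (c m * radial k (nat \<bar>m\<bar>) r)) has_sum w (polar r t)) UNIV"
      "((\<lambda>m. \<i> * of_int m * cis (of_int m * t) / (2 * pi) * (c m * radial k (nat \<bar>m\<bar>) r)) has_sum angular_deriv w1 w2 r t) UNIV"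
    if "0 < r" "2 * r \<le> r0" for r t
    using helmholtz_bessel_expansion[OF h \<open>open S\<close> Q r0 that K(1)] K(2)[of r] c[of r] that r0 by auto
  \<comment> \<open>The circle integrals of \<open>w\<close> tend to zero by continuity and
    \<open>w 0 = 0\<close>, whereas \<open>radial k 0\<close> tends to 1.\<close>
  have c0: "c 0 = 0"
  proof -
    have lim: "((\<lambda>r. fourier_coeff (\<lambda>t. w (polar r t)) 0) \<longlongrightarrow> 0) (at_right 0)"
    proof (rule tendstoI)
      fix e :: real assume "e > 0"
      have "0 \<in> S"
        by (rule subsetD[OF Q]) (use \<open>0 < R\<close> in \<open>simp add: zero_prod_def\<close>)
      then have "isCont w 0"
        by (rule has_derivative_continuous[OF helmholtz_has_derivative[OF h \<open>open S\<close>]])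
      moreover have "e / (4 * pi) > 0" using \<open>e > 0\<close> by simp
      ultimately obtain d where d: "d > 0" "\<And>x. norm x < d \<Longrightarrow> norm (w x) < e / (4 * pi)"
        unfolding continuous_at_eps_delta by (auto simp: w0 dist_norm)
      have "norm (fourier_coeff (\<lambda>t. w (polar r t)) 0) < e" if "0 < r" "r < min d R" for r
      proof -
        have np: "norm (polar r t) = r" for t
          using that unfolding polar_def norm_Pair real_norm_def power2_abs power_mult_distrib
          by (simp flip: distrib_left)
        have "norm (fourier_coeff (\<lambda>t. w (polar r t)) 0) \<le> e / (4 * pi) * (2 * pi)"
        proof (rule fourier_coeff_norm_bound)
          show "continuous_on {0..2 * pi} (\<lambda>t. w (polar r t))"
            by (rule continuous_on_polar_circle[OF helmholtz_continuous_on[OF h \<open>open S\<close>] Q]) (use that in auto)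
          show "norm (w (polar r t)) \<le> e / (4 * pi)" for t
            using d(2)[of "polar r t"] np that by simp
        qed
        also have "\<dots> < e" using \<open>e > 0\<close> by simp
        finally show ?thesis .
      qed
      then show "\<forall>\<^sub>F r in at_right 0. dist (fourier_coeff (\<lambda>t. w (polar r t)) 0) 0 < e"
        unfolding eventually_at_right_field using d(1) \<open>0 < R\<close> by (intro exI[of _ "min d R"]) auto
    qed
    have "((\<lambda>r. c 0 * of_real (bessel_series k 0 (r\<^sup>2))) \<longlongrightarrow> c 0 * of_real (bessel_series k 0 (0\<^sup>2))) (at_right 0)"
      using continuous_on_tendsto_compose[OF bessel_series_continuous(1)[of UNIV k 0], of "\<lambda>r. r\<^sup>2" "0\<^sup>2" "at_right 0"]
      by (intro tendsto_intros) (auto intro!: tendsto_eq_intros)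
    moreover have "\<forall>\<^sub>F r in at_right 0. c 0 * of_real (bessel_series k 0 (r\<^sup>2)) = fourier_coeff (\<lambda>t. w (polar r t)) 0"
      unfolding eventually_at_right_field using \<open>0 < R\<close> c[of _ 0]
      by (intro exI[of _ R]) (auto simp: radial_def)
    ultimately have "((\<lambda>r. fourier_coeff (\<lambda>t. w (polar r t)) 0) \<longlongrightarrow> c 0 * of_real (bessel_series k 0 (0\<^sup>2))) (at_right 0)"
      by (simp add: tendsto_cong)
    from tendsto_unique[OF _ this lim] show ?thesis by (simp add: bessel_series_0)
  qed
  have step: "c (int N) = 0 \<and> c (- int N) = 0"
    if N: "N \<ge> 1" and zero: "\<And>m. nat \<bar>m\<bar> < N \<Longrightarrow> c m = 0" for N
  proof -
    have rel: "c (int N) * cis (2 * of_nat N * t) = c (- int N) \<or> c (int N) * cis (2 * of_nat N * t) = - c (- int N)"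
      if ray: "impedance_ray w w1 w2 t" for t
    proof -
      define A where "A = c (int N) * cis (of_nat N * t) / (2 * pi) / fact N"
      define B where "B = c (- int N) * cis (- (of_nat N * t)) / (2 * pi) / fact N"
      have "((\<lambda>r. w (polar r t) / of_real (r ^ N)) \<longlongrightarrow>
          (cis (of_int (int N) * t) / (2 * pi) * c (int N) + cis (of_int (- int N) * t) / (2 * pi) * c (- int N)) / fact N) (at_right 0)"
      proof (rule bessel_expansion_leading_limit[OF r0(1) K(1) N expansion(1) _ _ zero])
        show "norm (cis (of_int m * t) / (2 * pi)) \<le> real_of_int \<bar>m\<bar> + 1" for m
        proof -
          have "1 / (2 * pi) \<le> 1 / 1" using pi_ge_two by (intro divide_left_mono) auto
          also have "\<dots> \<le> real_of_int \<bar>m\<bar> + 1" by simp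
          finally show ?thesis by (simp add: norm_divide)
        qed
      qed (use K(2) in auto)
      then have 1: "((\<lambda>r. w (polar r t) / of_real (r ^ N)) \<longlongrightarrow> A + B) (at_right 0)"
        by (simp add: A_def B_def add_divide_distrib mult_ac)
      have "((\<lambda>r. angular_deriv w1 w2 r t / of_real (r ^ N)) \<longlongrightarrow>
          (\<i> * of_int (int N) * cis (of_int (int N) * t) / (2 * pi) * c (int N)
           + \<i> * of_int (- int N) * cis (of_int (- int N) * t) / (2 * pi) * c (- int N)) / fact N) (at_right 0)"
      proof (rule bessel_expansion_leading_limit[OF r0(1) K(1) N expansion(2) _ _ zero])
        show "norm (\<i> * of_int m * cis (of_int m * t) / (2 * pi)) \<le> real_of_int \<bar>m\<bar> + 1" for m
        proof -
          have "real_of_int \<bar>m\<bar> / (2 * pi) \<le> real_of_int \<bar>m\<bar> / 1"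
            using pi_ge_two by (intro divide_left_mono) auto
          then show ?thesis by (simp add: norm_divide norm_mult)
        qed
      qed (use K(2) in auto)
      then have 2: "((\<lambda>r. angular_deriv w1 w2 r t / of_real (r ^ N)) \<longlongrightarrow> \<i> * of_nat N * (A - B)) (at_right 0)"
        by (simp add: A_def B_def diff_divide_distrib right_diff_distrib mult_ac)
      have "A = B \<or> A = - B" by (rule impedance_ray_leading[OF ray N 1 2])
      then have "c (int N) * cis (of_nat N * t) = c (- int N) * cis (- (of_nat N * t)) \<or>
          c (int N) * cis (of_nat N * t) = - (c (- int N) * cis (- (of_nat N * t)))"
        unfolding A_def B_def by (auto simp: divide_eq_eq)
      moreover have "a * cis (2 * of_nat N * t) = b" if "a * cis (of_nat N * t) = b * cis (- (of_nat N * t))" for a b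
      proof -
        have "a * cis (2 * of_nat N * t) = (a * cis (of_nat N * t)) * cis (of_nat N * t)"
          unfolding mult.assoc cis_mult by (simp only: mult_2 distrib_right)
        also have "\<dots> = b" unfolding that mult.assoc cis_mult by simp
        finally show ?thesis .
      qed
      ultimately show ?thesis by (metis mult_minus_left)
    qed
    have "c (int N) = 0"
    proof (rule ccontr)
      assume nz: "c (int N) \<noteq> 0"
      \<comment> \<open>The two edges may carry conditions of different type, so their relations can
        be compared only up to sign.\<close>
      have eq_upto_sign: "y = x \<or> y = - x" if "y = b \<or> y = - b" "x = b \<or> x = - b" for x y b :: complex
        using that by auto
      have "c (int N) * cis (2 * of_nat N * t2) = c (int N) * cis (2 * of_nat N * t1) \<or>
          c (int N) * cis (2 * of_nat N * t2) = c (int N) * - cis (2 * of_nat N * t1)"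
        using eq_upto_sign[OF rel[OF rays(2)] rel[OF rays(1)]] by (simp only: mult_minus_right)
      then have "cis (2 * of_nat N * t2) = cis (2 * of_nat N * t1) \<or> cis (2 * of_nat N * t2) = - cis (2 * of_nat N * t1)"
        using nz unfolding mult_cancel_left by blast
      then have "cis (2 * of_nat N * (t2 - t1)) = 1 \<or> cis (2 * of_nat N * (t2 - t1)) = -1"
        unfolding right_diff_distrib cis_divide[symmetric] by (auto simp: divide_eq_eq)
      \<comment> \<open>Both signs say that the value is real, which treats equal and mixed edge
        types together: \<open>t2 - t1\<close> is an integer multiple of
        \<open>pi / (2 * N)\<close>.\<close>
      then have "Im (cis (2 * of_nat N * (t2 - t1))) = 0"
        by (elim disjE) (simp_all only:, simp_all)
      then have "sin (2 * of_nat N * (t2 - t1)) = 0" by simp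
      then obtain i :: int where "2 * of_nat N * (t2 - t1) = of_int i * pi"
        using sin_zero_iff_int2 by blast
      then have "(t2 - t1) / pi = of_int i / of_nat (2 * N)"
        using N by (simp add: field_simps)
      then have "(t2 - t1) / pi \<in> \<rat>" by simp
      then show False using irr by simp
    qed
    with rel[OF rays(1)] show ?thesis by auto
  qed
  \<comment> \<open>Strong induction on the order of the mode, since \<open>step\<close> presupposes
    that all lower modes vanish.\<close>
  have all: "\<forall>m. nat \<bar>m\<bar> = N \<longrightarrow> c m = 0" for N
  proof (induction N rule: less_induct)
    case (less N)
    show ?case
    proof (cases "N = 0")
      case True
      then show ?thesis using c0 by auto
    next
      case False
      then have "c (int N) = 0 \<and> c (- int N) = 0"
        using less by (intro step) auto
      moreover have "m = int N \<or> m = - int N" if "nat \<bar>m\<bar> = N" for m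
        using that by auto
      ultimately show ?thesis by metis
    qed
  qed
  have "fourier_coeff (\<lambda>t. w (polar r t)) m = 0" if "0 < r" "r < R" for r m
    using c[OF that] all by simp
  then show ?thesis
    by (rule helmholtz_zero_of_coeffs[OF h \<open>open S\<close> Q _ False p])
qed (simp add: w0)

section \<open>Rayleigh expansions\<close>

lemma open_Omega:
  assumes "continuous_on UNIV f"
  shows "open (Omega f)"
proof -
  have "continuous_on UNIV (\<lambda>p. f (fst p))"
    by (rule continuous_on_compose2[OF assms continuous_on_fst[OF continuous_on_id]]) simp
  then show ?thesis
    unfolding Omega_def by (rule open_Collect_less[OF _ continuous_on_snd[OF continuous_on_id]])
qed

text \<open>A vertical shear maps a convex half-plane onto the epigraph.\<close>

lemma connected_Omega:
  assumes "continuous_on UNIV h"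
  shows "connected (Omega h)"
proof -
  have "Omega h = (\<lambda>p. (fst p, h (fst p) + snd p)) ` (UNIV \<times> {0<..})"
  proof (intro equalityI subsetI)
    fix p assume "p \<in> Omega h"
    then show "p \<in> (\<lambda>p. (fst p, h (fst p) + snd p)) ` (UNIV \<times> {0<..})"
      by (intro image_eqI[of _ _ "(fst p, snd p - h (fst p))"]) (auto simp: Omega_def)
  qed (auto simp: Omega_def)
  moreover have "connected ((\<lambda>p. (fst p, h (fst p) + snd p)) ` (UNIV \<times> {0<..}))"
  proof (rule connected_continuous_image)
    have "continuous_on (UNIV \<times> {0<..}) (\<lambda>p. h (fst p))"
      by (rule continuous_on_compose2[OF assms continuous_on_fst[OF continuous_on_id]]) simp
    then show "continuous_on (UNIV \<times> {0<..}) (\<lambda>p. (fst p, h (fst p) + snd p))"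
      by (intro continuous_on_Pair continuous_on_add continuous_on_fst continuous_on_snd continuous_on_id)
    show "connected ((UNIV :: real set) \<times> {0::real<..})"
      by (intro convex_connected convex_Times convex_UNIV convex_real_interval)
  qed
  ultimately show ?thesis by simp
qed

text \<open>The intersection is the epigraph of the pointwise maximum, hence connected and its own
  only component.\<close>

lemma component_Omega_Int:
  assumes "continuous_on UNIV f" "continuous_on UNIV g" "G \<in> components (Omega f \<inter> Omega g)"
  shows "G = Omega f \<inter> Omega g"
proof -
  have eq: "Omega f \<inter> Omega g = Omega (\<lambda>x. max (f x) (g x))"
    by (auto simp: Omega_def)
  have conn: "connected (Omega f \<inter> Omega g)"
    unfolding eq by (intro connected_Omega continuous_on_max assms)
  have "G \<noteq> {}" "G \<subseteq> Omega f \<inter> Omega g"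
    using assms(3) in_components_nonempty in_components_subset by blast+
  with conn assms(3) show ?thesis
    unfolding in_components_maximal by blast
qed

section \<open>Rayleigh modes of total fields\<close>

lemma total_fieldE:
  assumes "total_field f C eta k \<theta> u"
  obtains u1 u2 where "helmholtz k (Omega f) u u1 u2"
    and "\<forall>x. x \<notin> C \<longrightarrow> (case eta x of
              None \<Rightarrow> u (x, f x) = 0
            | Some e \<Rightarrow> (\<exists>g1 g2. (u1 \<longlongrightarrow> g1) (at (x, f x) within Omega f) \<and>
                                  (u2 \<longlongrightarrow> g2) (at (x, f x) within Omega f) \<and>
                                  (- of_real (deriv f x) * g1 + g2) / of_real (sqrt (1 + (deriv f x)\<^sup>2))
                                    + e * u (x, f x) = 0))"
proof -
  note unfolded = assms[unfolded total_field_def]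
  show ?thesis
    apply (insert unfolded)
    apply (elim conjE exE)
    subgoal for u1 c u2 u11 u22
      unfolding helmholtz_def helmholtz_witness_def
      by (rule that[of u1 u2], unfold helmholtz_def helmholtz_witness_def)
        ((intro exI[of _ u11] exI[of _ u22] conjI; assumption), assumption)
    done
qed

lemma admissible_continuous:
  "admissible_polygonal_grating f C eta \<Longrightarrow> continuous_on UNIV f"
  by (simp add: admissible_polygonal_grating_def)

text \<open>Removing the quasiperiodic phase turns the Rayleigh modes into ordinary Fourier modes in
  \<open>x1\<close>.\<close>

lemma exp_alpha_beta_mult_cis:
  "exp (\<i> * (of_real (alpha_n k \<theta> n * x1) + B * of_real x2)) * cis (- (k * sin \<theta> * x1))
    = exp (\<i> * B * of_real x2) * cis (of_int n * x1)"
  by (simp add: cis_conv_exp alpha_n_def flip: exp_add) (simp add: algebra_simps)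

lemma incident_mult_cis:
  "incident k \<theta> (x1, x2) * cis (- (k * sin \<theta> * x1)) = cis (- (k * cos \<theta> * x2))"
  by (simp add: incident_def cis_conv_exp flip: exp_add) (simp add: algebra_simps)

text \<open>Once the phase is removed, the incident wave is constant in \<open>x1\<close> and
  contributes to the zeroth coefficient only, as the downward wave
  \<open>cis (- (k * cos \<theta> * x2))\<close>.\<close>

lemma rayleigh_coefficients:
  assumes "total_field f C eta k \<theta> u"
  obtains c where
    "\<And>x1 x2. (\<And>t. f t < x2) \<Longrightarrow>
      ((\<lambda>n. c n * exp (\<i> * (of_real (alpha_n k \<theta> n * x1) + beta_n k \<theta> n * of_real x2)))
           has_sum (u (x1, x2) - incident k \<theta> (x1, x2))) UNIV"
    and "\<And>n x2. (\<And>t. f t < x2) \<Longrightarrow>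
      fourier_coeff (\<lambda>x1. u (x1, x2) * cis (- (k * sin \<theta> * x1))) n =
        2 * pi * (c n * exp (\<i> * beta_n k \<theta> n * of_real x2) + (if n = 0 then cis (- (k * cos \<theta> * x2)) else 0))"
proof -
  obtain c where c: "\<forall>x1 x2. (\<forall>t. f t < x2) \<longrightarrow>
      ((\<lambda>n. c n * exp (\<i> * (of_real (alpha_n k \<theta> n * x1) + beta_n k \<theta> n * of_real x2)))
           has_sum (u (x1, x2) - incident k \<theta> (x1, x2))) UNIV"
    using assms unfolding total_field_def by (elim conjE exE)
  have hs: "((\<lambda>n. c n * exp (\<i> * (of_real (alpha_n k \<theta> n * x1) + beta_n k \<theta> n * of_real x2)))
           has_sum (u (x1, x2) - incident k \<theta> (x1, x2))) UNIV" if "\<And>t. f t < x2" for x1 x2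
    using c that by simp
  have "fourier_coeff (\<lambda>x1. u (x1, x2) * cis (- (k * sin \<theta> * x1))) n =
        2 * pi * (c n * exp (\<i> * beta_n k \<theta> n * of_real x2) + (if n = 0 then cis (- (k * cos \<theta> * x2)) else 0))"
    if x2: "\<And>t. f t < x2" for n x2
  proof (rule fourier_coeff_has_sum)
    fix x1 :: real
    have 1: "((\<lambda>n. c n * exp (\<i> * beta_n k \<theta> n * of_real x2) * cis (of_int n * x1)) has_sum
        (u (x1, x2) - incident k \<theta> (x1, x2)) * cis (- (k * sin \<theta> * x1))) UNIV"
      using has_sum_cmult_left[OF hs[OF x2, of x1], of "cis (- (k * sin \<theta> * x1))"]
      unfolding mult.assoc exp_alpha_beta_mult_cis[unfolded mult.assoc] .
    have 2: "((\<lambda>n::int. (if n = 0 then cis (- (k * cos \<theta> * x2)) else 0) * cis (of_int n * x1)) has_sum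
        cis (- (k * cos \<theta> * x2))) UNIV"
      by (rule has_sum_finite_neutralI[of "{0}"]) auto
    have "(u (x1, x2) - incident k \<theta> (x1, x2)) * cis (- (k * sin \<theta> * x1)) + cis (- (k * cos \<theta> * x2))
        = u (x1, x2) * cis (- (k * sin \<theta> * x1))"
      unfolding left_diff_distrib incident_mult_cis by simp
    with has_sum_add[OF 1 2]
    show "((\<lambda>n. (c n * exp (\<i> * beta_n k \<theta> n * of_real x2) + (if n = 0 then cis (- (k * cos \<theta> * x2)) else 0))
        * cis (of_int n * x1)) has_sum u (x1, x2) * cis (- (k * sin \<theta> * x1))) UNIV"
      by (simp only: distrib_right)
  qed
  from that[OF hs this] show ?thesis by blast
qed

lemma rayleigh_fourier_coeff:
  assumes "total_field f C eta k \<theta> u"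
  obtains c where
    "\<forall>n x2. (\<forall>t. f t < x2) \<longrightarrow>
      fourier_coeff (\<lambda>x1. u (x1, x2) * cis (- (k * sin \<theta> * x1))) n =
        2 * pi * (c n * exp (\<i> * beta_n k \<theta> n * of_real x2) + (if n = 0 then cis (- (k * cos \<theta> * x2)) else 0))"
proof (rule rayleigh_coefficients[OF assms])
  fix c
  assume c: "\<And>n x2. (\<And>t. f t < x2) \<Longrightarrow>
      fourier_coeff (\<lambda>x1. u (x1, x2) * cis (- (k * sin \<theta> * x1))) n =
        2 * pi * (c n * exp (\<i> * beta_n k \<theta> n * of_real x2) + (if n = 0 then cis (- (k * cos \<theta> * x2)) else 0))"
  show thesis by (rule that[of c], intro allI impI) (rule c, blast)
qed

text \<open>The height-dependent exponentials never vanish, so the trace over one period at height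
  \<open>b\<close> determines all Rayleigh coefficients, and these determine the field at every
  height from \<open>b\<close> upwards.\<close>

lemma total_fields_agree_above:
  assumes u: "total_field f C eta k \<theta> u" and ut: "total_field ft Ct etat k \<theta> ut"
    and b: "\<And>x. f x < b" "\<And>x. ft x < b"
    and eq: "\<And>x. x \<in> {0..2 * pi} \<Longrightarrow> u (x, b) = ut (x, b)"
    and x2: "b \<le> x2"
  shows "u (x1, x2) = ut (x1, x2)"
proof -
  obtain c where c:
    "\<And>x1 x2. (\<And>t. f t < x2) \<Longrightarrow>
      ((\<lambda>n. c n * exp (\<i> * (of_real (alpha_n k \<theta> n * x1) + beta_n k \<theta> n * of_real x2)))
           has_sum (u (x1, x2) - incident k \<theta> (x1, x2))) UNIV"
    "\<And>n x2. (\<And>t. f t < x2) \<Longrightarrow>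
      fourier_coeff (\<lambda>x1. u (x1, x2) * cis (- (k * sin \<theta> * x1))) n =
        2 * pi * (c n * exp (\<i> * beta_n k \<theta> n * of_real x2) + (if n = 0 then cis (- (k * cos \<theta> * x2)) else 0))"
    using rayleigh_coefficients[OF u] by blast
  obtain ct where ct:
    "\<And>x1 x2. (\<And>t. ft t < x2) \<Longrightarrow>
      ((\<lambda>n. ct n * exp (\<i> * (of_real (alpha_n k \<theta> n * x1) + beta_n k \<theta> n * of_real x2)))
           has_sum (ut (x1, x2) - incident k \<theta> (x1, x2))) UNIV"
    "\<And>n x2. (\<And>t. ft t < x2) \<Longrightarrow>
      fourier_coeff (\<lambda>x1. ut (x1, x2) * cis (- (k * sin \<theta> * x1))) n =
        2 * pi * (ct n * exp (\<i> * beta_n k \<theta> n * of_real x2) + (if n = 0 then cis (- (k * cos \<theta> * x2)) else 0))"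
    using rayleigh_coefficients[OF ut] by blast
  have "c n = ct n" for n
  proof -
    have "fourier_coeff (\<lambda>x1. u (x1, b) * cis (- (k * sin \<theta> * x1))) n =
        fourier_coeff (\<lambda>x1. ut (x1, b) * cis (- (k * sin \<theta> * x1))) n"
      by (rule fourier_coeff_cong) (simp add: eq)
    then have "c n * exp (\<i> * beta_n k \<theta> n * of_real b) = ct n * exp (\<i> * beta_n k \<theta> n * of_real b)"
      unfolding c(2)[OF b(1)] ct(2)[OF b(2)] by simp
    then show ?thesis by simp
  qed
  then have "c = ct" by blast
  have lt: "f t < x2" "ft t < x2" for t
    using b[of t] x2 by auto
  have "u (x1, x2) - incident k \<theta> (x1, x2) = ut (x1, x2) - incident k \<theta> (x1, x2)"
    by (rule has_sum_unique[OF c(1)[OF lt(1)] ct(1)[OF lt(2), folded \<open>c = ct\<close>]])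
  then show ?thesis by simp
qed

text \<open>Multiplication by \<open>cis (\<beta> * x)\<close> makes the second term constant.
  Raising \<open>x\<close> by \<open>pi / (2 * \<beta>)\<close> flips the sign of the first, so
  adding the two equations isolates \<open>a\<close>.\<close>

lemma outgoing_incoming_independent:
  assumes "\<beta> > 0" and eq: "\<And>x. B \<le> x \<Longrightarrow> E * cis (\<beta> * x) + a * cis (- (\<beta> * x)) = 0"
  shows "a = 0"
proof -
  have *: "E * cis (2 * (\<beta> * x)) + a = 0" if "B \<le> x" for x
  proof -
    have "(E * cis (\<beta> * x) + a * cis (- (\<beta> * x))) * cis (\<beta> * x) = 0"
      using eq[OF that] by simp
    then show ?thesis
      unfolding distrib_right mult.assoc cis_mult by simp
  qed
  have "2 * (\<beta> * (B + pi / (2 * \<beta>))) = 2 * (\<beta> * B) + pi"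
    using assms(1) by (simp add: field_simps)
  then have "cis (2 * (\<beta> * (B + pi / (2 * \<beta>)))) = - cis (2 * (\<beta> * B))"
    by (simp flip: cis_mult)
  moreover have "B \<le> B + pi / (2 * \<beta>)" using assms(1) by simp
  ultimately have "- (E * cis (2 * (\<beta> * B))) + a = 0"
    using *[of "B + pi / (2 * \<beta>)"] by simp
  with *[of B] have "2 * a = 0"
    by (simp add: algebra_simps)
  then show ?thesis by simp
qed

text \<open>If the period multipliers of the two fields differ, a shift by one period separates
  them. If they agree, \<open>k * sin \<theta>\<close> and \<open>k * sin \<theta>'\<close> differ
  by a nonzero integer \<open>m\<close>, and the zeroth mode of \<open>u\<close> meets the mode
  \<open>m\<close> of \<open>v\<close>, which has no incoming part. In either case nothing cancels
  the incoming wave of \<open>u\<close>; exchanging the fields treats the other coefficient.\<close>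

lemma total_fields_independent:
  assumes u: "total_field f C eta k \<theta> u" and v: "total_field f C eta k \<theta>' v"
    and k: "k > 0" and \<theta>: "- (pi / 2) < \<theta>" "\<theta> < pi / 2" and \<theta>': "- (pi / 2) < \<theta>'" "\<theta>' < pi / 2"
    and ne: "\<theta> \<noteq> \<theta>'" and B: "\<And>t. f t < B"
    and dep: "\<And>x1 x2. B \<le> x2 \<Longrightarrow> a * u (x1, x2) + b * v (x1, x2) = 0"
  shows "a = 0"
proof -
  have "cos \<theta> > 0" by (rule cos_gt_zero_pi) (use \<theta> in auto)
  define \<beta> where "\<beta> = k * cos \<theta>"
  have "\<beta> > 0" using k \<open>cos \<theta> > 0\<close> by (simp add: \<beta>_def)
  have "k\<^sup>2 - (k * sin \<theta>)\<^sup>2 = \<beta>\<^sup>2"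
    using sin_cos_squared_add[of \<theta>] by (simp add: \<beta>_def power_mult_distrib algebra_simps flip: distrib_left)
  moreover have "\<bar>k * sin \<theta>\<bar> \<le> k"
    using k mult_left_mono[OF abs_sin_le_one[of \<theta>], of k] by (simp add: abs_mult)
  \<comment> \<open>\<open>beta_n\<close> sees the direction and the index only through
    \<open>alpha_n\<close>. The general form covers the zeroth mode of \<open>u\<close> and also the
    mode \<open>m\<close> of \<open>v\<close> below.\<close>
  ultimately have \<beta>: "beta_n k' \<theta>'' n = of_real \<beta>" if "alpha_n k' \<theta>'' n = k * sin \<theta>" "k' = k" for k' \<theta>'' n
    using that \<open>\<beta> > 0\<close> by (simp add: beta_n_def)
  have exp_\<beta>: "exp (\<i> * of_real \<beta> * of_real x) = cis (\<beta> * x)" for x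
    by (simp add: cis_conv_exp mult.assoc)
  have fB: "f t < x" if "B \<le> x" for t x using B[of t] that by simp
  obtain c where c_all: "\<forall>n x2. (\<forall>t. f t < x2) \<longrightarrow>
      fourier_coeff (\<lambda>x1. u (x1, x2) * cis (- (k * sin \<theta> * x1))) n =
        2 * pi * (c n * exp (\<i> * beta_n k \<theta> n * of_real x2) + (if n = 0 then cis (- (k * cos \<theta> * x2)) else 0))"
    by (rule rayleigh_fourier_coeff[OF u])
  have c: "fourier_coeff (\<lambda>x1. u (x1, x) * cis (- (k * sin \<theta> * x1))) n =
        2 * pi * (c n * exp (\<i> * beta_n k \<theta> n * of_real x) + (if n = 0 then cis (- (k * cos \<theta> * x)) else 0))" if "B \<le> x" for n x
    using c_all fB[OF that] by blast
  obtain d where d_all: "\<forall>n x2. (\<forall>t. f t < x2) \<longrightarrow>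
      fourier_coeff (\<lambda>x1. v (x1, x2) * cis (- (k * sin \<theta>' * x1))) n =
        2 * pi * (d n * exp (\<i> * beta_n k \<theta>' n * of_real x2) + (if n = 0 then cis (- (k * cos \<theta>' * x2)) else 0))"
    by (rule rayleigh_fourier_coeff[OF v])
  have d: "fourier_coeff (\<lambda>x1. v (x1, x) * cis (- (k * sin \<theta>' * x1))) n =
        2 * pi * (d n * exp (\<i> * beta_n k \<theta>' n * of_real x) + (if n = 0 then cis (- (k * cos \<theta>' * x)) else 0))" if "B \<le> x" for n x
    using d_all fB[OF that] by blast
  have c0: "fourier_coeff (\<lambda>x1. u (x1, x) * cis (- (k * sin \<theta> * x1))) 0 =
      2 * pi * (c 0 * cis (\<beta> * x) + cis (- (\<beta> * x)))" if "B \<le> x" for x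
    using c[OF that, of 0] \<beta>[of k \<theta> 0] by (simp add: alpha_n_def exp_\<beta>) (simp add: \<beta>_def)
  define q where "q = exp (2 * \<i> * of_real (k * sin \<theta>) * of_real pi)"
  define q' where "q' = exp (2 * \<i> * of_real (k * sin \<theta>') * of_real pi)"
  show ?thesis
  proof (cases "q = q'")
    case False
    show ?thesis
    proof (rule ccontr)
      assume "a \<noteq> 0"
      have u0: "u (x1, x2) = 0" if "B \<le> x2" for x1 x2
      proof -
        have om: "(x1, x2) \<in> Omega f" using fB[OF that] by (simp add: Omega_def)
        have "u (x1 + 2 * pi, x2) = q * u (x1, x2)"
          using u om unfolding total_field_def q_def by (elim conjE) force
        moreover have "v (x1 + 2 * pi, x2) = q' * v (x1, x2)"
          using v om unfolding total_field_def q'_def by (elim conjE) force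
        ultimately have "a * (q * u (x1, x2)) + b * (q' * v (x1, x2)) = 0"
          using dep[OF that, of "x1 + 2 * pi"] by simp
        moreover have "q' * (a * u (x1, x2) + b * v (x1, x2)) = 0"
          using dep[OF that, of x1] by simp
        ultimately have "a * (q * u (x1, x2)) + b * (q' * v (x1, x2)) - q' * (a * u (x1, x2) + b * v (x1, x2)) = 0"
          by simp
        \<comment> \<open>Subtracting \<open>q'\<close> times the unshifted relation eliminates
          \<open>v\<close>.\<close>
        then have "(q - q') * a * u (x1, x2) = 0" by (simp add: algebra_simps)
        then show ?thesis using False \<open>a \<noteq> 0\<close> by simp
      qed
      \<comment> \<open>If \<open>u\<close> vanished above the grating, its incoming wave, of
        amplitude 1, would have to be cancelled by its outgoing zeroth mode.\<close>
      have "(1::complex) = 0"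
      proof (rule outgoing_incoming_independent[OF \<open>\<beta> > 0\<close>])
        fix x assume x: "B \<le> x"
        have "fourier_coeff (\<lambda>x1. u (x1, x) * cis (- (k * sin \<theta> * x1))) 0 = 0"
          by (simp add: u0[OF x] fourier_coeff_def)
        then show "c 0 * cis (\<beta> * x) + 1 * cis (- (\<beta> * x)) = 0"
          unfolding c0[OF x] by simp
      qed
      then show False by simp
    qed
  next
    case True
    then obtain m :: int where "2 * \<i> * of_real (k * sin \<theta>) * of_real pi = 2 * \<i> * of_real (k * sin \<theta>') * of_real pi + of_real (2 * of_int m * pi) * \<i>"
      unfolding q_def q'_def exp_eq by auto
    then have "Im (2 * \<i> * of_real (k * sin \<theta>) * of_real pi) = Im (2 * \<i> * of_real (k * sin \<theta>') * of_real pi + of_real (2 * of_int m * pi) * \<i>)"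
      by (rule arg_cong)
    then have "(k * sin \<theta>) * (2 * pi) = (k * sin \<theta>' + of_int m) * (2 * pi)"
      by (simp add: algebra_simps)
    then have m: "k * sin \<theta> = of_int m + k * sin \<theta>'" by simp
    \<comment> \<open>The sine is injective on the admissible range of angles, so distinct
      directions have distinct \<open>k * sin \<theta>\<close>.\<close>
    have "m \<noteq> 0"
    proof
      assume "m = 0"
      then have "sin \<theta> = sin \<theta>'" using m k by simp
      then show False using ne \<theta> \<theta>' by (simp add: sin_inj_pi)
    qed
    show ?thesis
    proof (rule outgoing_incoming_independent[OF \<open>\<beta> > 0\<close>])
      fix x assume x: "B \<le> x"
      have "a * fourier_coeff (\<lambda>x1. u (x1, x) * cis (- (k * sin \<theta> * x1))) 0
          = fourier_coeff (\<lambda>x1. a * (u (x1, x) * cis (- (k * sin \<theta> * x1)))) 0"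
        by (rule fourier_coeff_mult[symmetric])
      also have "\<dots> = fourier_coeff (\<lambda>x1. (- b) * (v (x1, x) * cis (- (k * sin \<theta> * x1)))) 0"
      proof (rule fourier_coeff_cong)
        fix x1
        have "a * u (x1, x) = (- b) * v (x1, x)"
          using dep[OF x, of x1] by (simp add: eq_neg_iff_add_eq_0)
        then show "a * (u (x1, x) * cis (- (k * sin \<theta> * x1))) = (- b) * (v (x1, x) * cis (- (k * sin \<theta> * x1)))"
          by (simp only: mult.assoc[symmetric])
      qed
      also have "\<dots> = (- b) * fourier_coeff (\<lambda>x1. v (x1, x) * cis (- (k * sin \<theta> * x1))) 0"
        by (rule fourier_coeff_mult)
      \<comment> \<open>Measuring \<open>v\<close> with the phase of \<open>u\<close> shifts its
        Fourier index by \<open>m\<close>.\<close>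
      also have "fourier_coeff (\<lambda>x1. v (x1, x) * cis (- (k * sin \<theta> * x1))) 0
          = fourier_coeff (\<lambda>x1. v (x1, x) * cis (- (k * sin \<theta>' * x1))) m"
        unfolding fourier_coeff_def m
        by (rule integral_cong) (simp add: mult.assoc cis_mult algebra_simps)
      also have "\<dots> = 2 * pi * (d m * cis (\<beta> * x))"
        using d[OF x, of m] \<beta>[of k \<theta>' m] m \<open>m \<noteq> 0\<close> by (simp add: alpha_n_def exp_\<beta>)
      finally have "2 * pi * ((a * c 0 + b * d m) * cis (\<beta> * x) + a * cis (- (\<beta> * x))) = 0"
        unfolding c0[OF x] by (simp add: algebra_simps eq_neg_iff_add_eq_0)
      then show "(a * c 0 + b * d m) * cis (\<beta> * x) + a * cis (- (\<beta> * x)) = 0"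
        by simp
    qed
  qed
qed

section \<open>Local structure of a polygonal grating\<close>

lemma breakpoints_shift:
  assumes "\<forall>x. x \<in> C \<longleftrightarrow> x + 2 * pi \<in> C"
  shows "x \<in> C \<longleftrightarrow> x + 2 * pi * of_int j \<in> C"
proof (induction j rule: int_induct[where k = 0])
  case (step1 i)
  then show ?case using assms[rule_format, of "x + 2 * pi * of_int i"] by (simp add: algebra_simps)
next
  case (step2 i)
  then show ?case using assms[rule_format, of "x + 2 * pi * of_int (i - 1)"] by (simp add: algebra_simps)
qed simp

lemma breakpoints_finite:
  assumes per: "\<forall>x. x \<in> C \<longleftrightarrow> x + 2 * pi \<in> C" and fin: "finite (C \<inter> {0..<2 * pi})"
  shows "finite (C \<inter> {a..b})"
proof -
  have "C \<inter> {a..b} \<subseteq> (\<Union>j\<in>{\<lfloor>a / (2 * pi)\<rfloor>..\<lfloor>b / (2 * pi)\<rfloor>}. (\<lambda>x. x + 2 * pi * of_int j) ` (C \<inter> {0..<2 * pi}))"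
  proof
    fix x assume x: "x \<in> C \<inter> {a..b}"
    define j where "j = \<lfloor>x / (2 * pi)\<rfloor>"
    have "of_int j \<le> x / (2 * pi)" "x / (2 * pi) < of_int j + 1"
      unfolding j_def by linarith+
    then have "2 * pi * of_int j \<le> x" "x < 2 * pi * of_int j + 2 * pi"
      by (simp_all add: field_simps)
    moreover have "x + 2 * pi * of_int (- j) \<in> C"
      using breakpoints_shift[OF per, of x "- j"] x by blast
    ultimately have "x - 2 * pi * of_int j \<in> C \<inter> {0..<2 * pi}" by simp
    moreover have "j \<in> {\<lfloor>a / (2 * pi)\<rfloor>..\<lfloor>b / (2 * pi)\<rfloor>}"
      using x by (auto simp: j_def intro!: floor_mono divide_right_mono)
    ultimately show "x \<in> (\<Union>j\<in>{\<lfloor>a / (2 * pi)\<rfloor>..\<lfloor>b / (2 * pi)\<rfloor>}. (\<lambda>x. x + 2 * pi * of_int j) ` (C \<inter> {0..<2 * pi}))"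
      by (intro UN_I[of j] image_eqI[of _ _ "x - 2 * pi * of_int j"]) auto
  qed
  then show ?thesis using fin by (meson finite_UN_I finite_atLeastAtMost_int finite_imageI finite_subset)
qed

text \<open>Treats the left and the right slope together: \<open>I d\<close> stands for a one-sided
  interval of length \<open>d\<close> at \<open>c\<close>, and any two such intervals share a point
  other than \<open>c\<close>.\<close>

lemma the_one_sided_slope:
  fixes c m :: real and I :: "real \<Rightarrow> real set" and f :: "real \<Rightarrow> real"
  assumes inf: "\<And>d. d > 0 \<Longrightarrow> \<exists>x\<in>I d. x \<noteq> c" and mono: "\<And>d e. d \<le> e \<Longrightarrow> I d \<subseteq> I e"
    and m: "d > 0" "\<forall>x\<in>I d. f x = f c + m * (x - c)"
  shows "(THE m. \<exists>d>0. \<forall>x\<in>I d. f x = f c + m * (x - c)) = m"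
proof (rule the_equality)
  fix m' assume "\<exists>d>0. \<forall>x\<in>I d. f x = f c + m' * (x - c)"
  then obtain d' where d': "d' > 0" "\<forall>x\<in>I d'. f x = f c + m' * (x - c)" by blast
  have "min d d' > 0" using m d' by simp
  then obtain x where x: "x \<in> I (min d d')" "x \<noteq> c" using inf by blast
  then have "x \<in> I d" "x \<in> I d'" using mono[of "min d d'" d] mono[of "min d d'" d'] by auto
  then have "f c + m * (x - c) = f c + m' * (x - c)" using m(2) d'(2) by metis
  then show "m' = m" using x(2) by simp
qed (use m in blast)

lemma affine_deriv:
  fixes f :: "real \<Rightarrow> real"
  assumes "open I" "x \<in> I" "\<And>y. y \<in> I \<Longrightarrow> f y = y0 + m * (y - c)"
  shows "deriv f x = m"
proof (rule DERIV_imp_deriv)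
  have "((\<lambda>y. y0 + m * (y - c)) has_real_derivative m) (at x)"
    by (auto intro!: derivative_eq_intros)
  then show "(f has_real_derivative m) (at x)"
    by (rule has_field_derivative_transform_within_open[OF _ assms(1,2)]) (simp add: assms(3))
qed

text \<open>Breakpoints are locally finite, so \<open>f\<close> is affine and \<open>eta\<close>
  constant on each side of \<open>c\<close>; this also shows that the definite descriptions of the
  one-sided slopes denote.\<close>

lemma grating_local_structure:
  assumes adm: "admissible_polygonal_grating f C eta"
  obtains d er el where "d > 0"
    and "\<And>x. x \<in> {c<..<c + d} \<Longrightarrow> x \<notin> C \<and> f x = f c + right_slope f c * (x - c)
      \<and> eta x = er \<and> deriv f x = right_slope f c"
    and "\<And>x. x \<in> {c - d<..<c} \<Longrightarrow> x \<notin> C \<and> f x = f c + left_slope f c * (x - c)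
      \<and> eta x = el \<and> deriv f x = left_slope f c"
proof -
  have cont: "continuous_on UNIV f" and per: "\<forall>x. x \<in> C \<longleftrightarrow> x + 2 * pi \<in> C"
    and fin: "finite (C \<inter> {0..<2 * pi})"
    and lin: "\<And>a b. a < b \<Longrightarrow> {a<..<b} \<inter> C = {} \<Longrightarrow>
        (\<exists>m q. \<forall>x\<in>{a<..<b}. f x = m * x + q) \<and> (\<exists>e. \<forall>x\<in>{a<..<b}. eta x = e)"
    using adm unfolding admissible_polygonal_grating_def by blast+
  obtain d0 where d0: "d0 > 0" "\<And>x. x \<in> C \<inter> {c - 1..c + 1} \<Longrightarrow> x \<noteq> c \<Longrightarrow> d0 \<le> dist c x"
    using finite_set_avoid[OF breakpoints_finite[OF per fin, of "c - 1" "c + 1"], of c] by blast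
  define d where "d = min d0 1"
  have d: "d > 0" using d0 by (simp add: d_def)
  have noC: "x \<notin> C" if "x \<noteq> c" "\<bar>x - c\<bar> < d" for x
  proof
    assume "x \<in> C"
    moreover have "x \<in> {c - 1..c + 1}" using that(2) unfolding d_def by auto
    ultimately have "d0 \<le> dist c x" using d0(2) that(1) by blast
    then show False using that(2) by (simp add: d_def dist_real_def abs_minus_commute)
  qed
  have lim: "(f \<longlongrightarrow> f c) (at c within T)" for T
    using cont by (meson UNIV_I continuous_on_def subset_UNIV tendsto_within_subset)
  \<comment> \<open>Continuity at \<open>c\<close> fixes the intercept, so each adjacent line passes
    through the corner.\<close>
  have q_eq: "q = f c - m * c"
    if "F \<noteq> bot" "F \<le> at c" "\<forall>\<^sub>F x in F. f x = m * x + q" for F m q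
  proof -
    have "(f \<longlongrightarrow> f c) F" using lim[of UNIV] that(2) by (rule tendsto_mono[rotated])
    moreover have "((\<lambda>x. m * x + q) \<longlongrightarrow> m * c + q) F"
      by (rule tendsto_mono[OF that(2)]) (intro tendsto_intros)
    then have "(f \<longlongrightarrow> m * c + q) F"
      using that(3) by (simp add: tendsto_cong)
    ultimately have "f c = m * c + q" using that(1) tendsto_unique by blast
    then show ?thesis by simp
  qed
  have empty: "{c<..<c + d} \<inter> C = {}" "{c - d<..<c} \<inter> C = {}"
    using noC by force+
  have "c < c + d" "c - d < c" using d by auto
  obtain m q er where r: "\<forall>x\<in>{c<..<c + d}. f x = m * x + q" "\<forall>x\<in>{c<..<c + d}. eta x = er"
    using lin[OF \<open>c < c + d\<close> empty(1)] by blast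
  obtain m' q' el where l: "\<forall>x\<in>{c - d<..<c}. f x = m' * x + q'" "\<forall>x\<in>{c - d<..<c}. eta x = el"
    using lin[OF \<open>c - d < c\<close> empty(2)] by blast
  have "q = f c - m * c"
  proof (rule q_eq[of "at_right c"])
    show "\<forall>\<^sub>F x in at_right c. f x = m * x + q"
      unfolding eventually_at_right_field using r(1) \<open>c < c + d\<close> by (intro exI[of _ "c + d"]) auto
  qed (auto intro: at_le)
  then have r': "\<forall>x\<in>{c<..<c + d}. f x = f c + m * (x - c)"
    using r(1) by (simp add: algebra_simps)
  have "q' = f c - m' * c"
  proof (rule q_eq[of "at_left c"])
    show "\<forall>\<^sub>F x in at_left c. f x = m' * x + q'"
      unfolding eventually_at_left_field using l(1) \<open>c - d < c\<close> by (intro exI[of _ "c - d"]) auto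
  qed (auto intro: at_le)
  then have l': "\<forall>x\<in>{c - d<..<c}. f x = f c + m' * (x - c)"
    using l(1) by (simp add: algebra_simps)
  have rs: "right_slope f c = m"
    unfolding right_slope_def
  proof (rule the_one_sided_slope[where I = "\<lambda>e. {c<..<c + e}", OF _ _ d r'])
    show "\<exists>x\<in>{c<..<c + e}. x \<noteq> c" if "e > 0" for e :: real
      using that by (intro bexI[of _ "c + e / 2"]) auto
  qed auto
  have ls: "left_slope f c = m'"
    unfolding left_slope_def
  proof (rule the_one_sided_slope[where I = "\<lambda>e. {c - e<..<c}", OF _ _ d l'])
    show "\<exists>x\<in>{c - e<..<c}. x \<noteq> c" if "e > 0" for e :: real
      using that by (intro bexI[of _ "c - e / 2"]) auto
  qed auto
  show ?thesis
  proof (rule that[OF d, of er el])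
    fix x assume x: "x \<in> {c<..<c + d}"
    have "deriv f x = m" by (rule affine_deriv[OF open_greaterThanLessThan x]) (use r' in blast)
    then show "x \<notin> C \<and> f x = f c + right_slope f c * (x - c) \<and> eta x = er \<and> deriv f x = right_slope f c"
      unfolding rs using x r(2) r' empty by blast
  next
    fix x assume x: "x \<in> {c - d<..<c}"
    have "deriv f x = m'" by (rule affine_deriv[OF open_greaterThanLessThan x]) (use l' in blast)
    then show "x \<notin> C \<and> f x = f c + left_slope f c * (x - c) \<and> eta x = el \<and> deriv f x = left_slope f c"
      unfolding ls using x l(2) l' empty by blast
  qed
qed

text \<open>The two gradients come from independent existential witnesses; where the fields agree on
  an open set, both represent the same total derivative.\<close>

lemma helmholtz_gradient_unique:
  assumes h: "helmholtz k S w w1 w2" and h': "helmholtz k T v v1 v2" and "open U" "p \<in> U" "U \<subseteq> S \<inter> T"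
    and "open S" "open T" and eq: "\<And>q. q \<in> U \<Longrightarrow> w q = v q"
  shows "w1 p = v1 p" "w2 p = v2 p"
proof -
  have pS: "p \<in> S" "p \<in> T" using assms(4,5) by auto
  have "(w has_derivative (\<lambda>h. fst h *\<^sub>R v1 p + snd h *\<^sub>R v2 p)) (at p)"
    by (rule has_derivative_transform_within_open[OF helmholtz_has_derivative[OF h' \<open>open T\<close> pS(2)] assms(3,4)])
      (simp add: eq)
  from has_derivative_unique[OF helmholtz_has_derivative[OF h \<open>open S\<close> pS(1)] this]
  have *: "fst x *\<^sub>R w1 p + snd x *\<^sub>R w2 p = fst x *\<^sub>R v1 p + snd x *\<^sub>R v2 p" for x :: "real \<times> real"
    by (rule fun_cong)
  show "w1 p = v1 p" using *[of "(1, 0)"] by simp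
  show "w2 p = v2 p" using *[of "(0, 1)"] by simp
qed

text \<open>Points straight above approach the graph from inside the domain, so limits within
  \<open>Omega f\<close> are unique.\<close>

lemma graph_point_at_within_Omega:
  "at (x, f x) within Omega f \<noteq> bot"
proof -
  have "(x, f x) islimpt Omega f"
    unfolding islimpt_approachable
  proof (intro allI impI)
    fix e :: real assume "e > 0"
    then show "\<exists>x'\<in>Omega f. x' \<noteq> (x, f x) \<and> dist x' (x, f x) < e"
      by (intro bexI[of _ "(x, f x + e / 2)"]) (auto simp: Omega_def dist_Pair_Pair dist_real_def)
  qed
  then show ?thesis by (simp add: trivial_limit_within)
qed

text \<open>The graph point is interior to \<open>T\<close>, so \<open>b\<close> is continuous
  across the graph and the one-sided limit of \<open>a\<close> must be its value there.\<close>

lemma graph_limit_transfer: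
  fixes a b :: "real \<times> real \<Rightarrow> complex"
  assumes "open T" "(x, f x) \<in> T" and eq: "\<And>p. p \<in> Omega f \<inter> T \<Longrightarrow> a p = b p"
    and b: "continuous_on T b" and a: "(a \<longlongrightarrow> l) (at (x, f x) within Omega f)"
  shows "l = b (x, f x)"
proof -
  have "isCont b (x, f x)" using assms(1,2) b continuous_on_eq_continuous_at by blast
  then have "(b \<longlongrightarrow> b (x, f x)) (at (x, f x) within Omega f)"
    by (meson isCont_def subset_UNIV tendsto_within_subset)
  moreover have "\<forall>\<^sub>F p in at (x, f x) within Omega f. b p = a p"
    unfolding eventually_at_topological using assms(1,2) eq by (intro exI[of _ T]) auto
  ultimately have "(a \<longlongrightarrow> b (x, f x)) (at (x, f x) within Omega f)"
    by (rule Lim_transform_eventually)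
  then show ?thesis using tendsto_unique[OF graph_point_at_within_Omega a] by blast
qed

section \<open>Absence of corners off the other grating\<close>

text \<open>Where \<open>ft x < f x\<close>, the boundary point of one grating is interior to the
  domain of the other, so the limits of \<open>u\<close> and its gradient become genuine values of
  \<open>v\<close>, \<open>v1\<close> and \<open>v2\<close>.\<close>

lemma boundary_condition_transfer:
  assumes u: "total_field f C eta k \<theta> u" and h: "helmholtz k (Omega ft) v v1 v2"
    and cont: "continuous_on UNIV f" "continuous_on UNIV ft"
    and agree: "\<And>p. p \<in> Omega f \<inter> Omega ft \<Longrightarrow> u p = v p"
    and x: "x \<notin> C" "ft x < f x"
  shows "case eta x of None \<Rightarrow> v (x, f x) = 0
    | Some e \<Rightarrow> (- of_real (deriv f x) * v1 (x, f x) + v2 (x, f x)) / of_real (sqrt (1 + (deriv f x)\<^sup>2))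
        + e * v (x, f x) = 0"
proof -
  obtain u1 u2 where hu: "helmholtz k (Omega f) u u1 u2"
    and bc: "\<forall>x. x \<notin> C \<longrightarrow> (case eta x of
              None \<Rightarrow> u (x, f x) = 0
            | Some e \<Rightarrow> (\<exists>g1 g2. (u1 \<longlongrightarrow> g1) (at (x, f x) within Omega f) \<and>
                                  (u2 \<longlongrightarrow> g2) (at (x, f x) within Omega f) \<and>
                                  (- of_real (deriv f x) * g1 + g2) / of_real (sqrt (1 + (deriv f x)\<^sup>2))
                                    + e * u (x, f x) = 0))"
    by (rule total_fieldE[OF u])
  note op = open_Omega[OF cont(1)] open_Omega[OF cont(2)]
  have P: "(x, f x) \<in> Omega ft" using x(2) by (simp add: Omega_def)
  note transfer = graph_limit_transfer[where f = f and x = x, OF op(2) P]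
  have grad: "u1 p = v1 p" "u2 p = v2 p" if "p \<in> Omega f \<inter> Omega ft" for p
    by (rule helmholtz_gradient_unique[OF hu h open_Int[OF op] that subset_refl op], erule agree)+
  have "(x, f x) \<in> closure (Omega f)"
    using graph_point_at_within_Omega[of x f] by (simp add: trivial_limit_within closure_def)
  moreover have "continuous_on (closure (Omega f)) u"
    using u unfolding total_field_def by (elim conjE)
  ultimately have "(u \<longlongrightarrow> u (x, f x)) (at (x, f x) within closure (Omega f))"
    by (simp add: continuous_on_def)
  then have "(u \<longlongrightarrow> u (x, f x)) (at (x, f x) within Omega f)"
    by (rule tendsto_within_subset) (rule closure_subset)
  from transfer[OF agree helmholtz_continuous_on[OF h op(2)] this]
  have uv: "u (x, f x) = v (x, f x)" .
  show ?thesis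
  proof (cases "eta x")
    case None
    then show ?thesis using bc[THEN spec, THEN mp, OF x(1)] uv by simp
  next
    case (Some e)
    then obtain g1 g2 where g: "(u1 \<longlongrightarrow> g1) (at (x, f x) within Omega f)"
      "(u2 \<longlongrightarrow> g2) (at (x, f x) within Omega f)"
      "(- of_real (deriv f x) * g1 + g2) / of_real (sqrt (1 + (deriv f x)\<^sup>2)) + e * u (x, f x) = 0"
      using bc[THEN spec, THEN mp, OF x(1)] by auto
    have "g1 = v1 (x, f x)"
      by (rule transfer[OF grad(1) helmholtz_continuous_on_gradient(1)[OF h] g(1)])
    moreover have "g2 = v2 (x, f x)"
      by (rule transfer[OF grad(2) helmholtz_continuous_on_gradient(2)[OF h] g(2)])
    ultimately show ?thesis using g(3) Some uv by simp
  qed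
qed

section \<open>Edge conditions as conditions along rays\<close>

definition edge_condition ::
  "complex option \<Rightarrow> real \<Rightarrow> (real \<times> real \<Rightarrow> complex) \<Rightarrow> (real \<times> real \<Rightarrow> complex)
    \<Rightarrow> (real \<times> real \<Rightarrow> complex) \<Rightarrow> real \<times> real \<Rightarrow> bool" where
  "edge_condition z m w w1 w2 p \<longleftrightarrow> (case z of None \<Rightarrow> w p = 0
    | Some e \<Rightarrow> (- of_real m * w1 p + w2 p) / of_real (sqrt (1 + m\<^sup>2)) + e * w p = 0)"

lemma edge_condition_cmult_add:
  assumes "edge_condition z m w w1 w2 p" "edge_condition z m v v1 v2 p"
  shows "edge_condition z m (\<lambda>p. a * w p + b * v p) (\<lambda>p. a * w1 p + b * v1 p) (\<lambda>p. a * w2 p + b * v2 p) p"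
proof (cases z)
  case None
  then show ?thesis using assms by (simp add: edge_condition_def)
next
  case (Some e)
  define s where "s = complex_of_real (sqrt (1 + m\<^sup>2))"
  have "(- of_real m * (a * w1 p + b * v1 p) + (a * w2 p + b * v2 p)) / s + e * (a * w p + b * v p)
      = a * ((- of_real m * w1 p + w2 p) / s + e * w p) + b * ((- of_real m * v1 p + v2 p) / s + e * v p)"
    by (simp add: add_divide_distrib diff_divide_distrib algebra_simps)
  also have "\<dots> = 0" using assms Some by (simp add: edge_condition_def s_def)
  finally show ?thesis using Some by (simp add: edge_condition_def s_def)
qed

text \<open>The edge has direction \<open>(1, m) / s\<close>, so radius \<open>r\<close> corresponds
  to abscissa \<open>c + r / s\<close>. At the angle \<open>arctan m\<close> the normal
  \<open>(- sin t, cos t)\<close> of the ray is exactly the upward unit normal.\<close>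

lemma edge_impedance_ray_right:
  assumes d: "d > 0" and f: "\<And>x. x \<in> {c<..<c + d} \<Longrightarrow> f x = f c + m * (x - c)"
    and bc: "\<And>x. x \<in> {c<..<c + d} \<Longrightarrow> edge_condition z m w w1 w2 (x, f x)"
  shows "impedance_ray (\<lambda>p. w ((c, f c) + p)) (\<lambda>p. w1 ((c, f c) + p)) (\<lambda>p. w2 ((c, f c) + p)) (arctan m)"
proof -
  define s where "s = sqrt (1 + m\<^sup>2)"
  have s: "s \<ge> 1" by (simp add: s_def)
  have cs: "cos (arctan m) = 1 / s" "sin (arctan m) = m / s"
    by (simp_all add: s_def cos_arctan sin_arctan)
  have pt: "edge_condition z m w w1 w2 ((c, f c) + polar r (arctan m))" if "0 < r" "r < d" for r
  proof -
    have "r / s \<le> r / 1" using s that by (intro divide_left_mono) auto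
    then have x: "c + r / s \<in> {c<..<c + d}" using that s by auto
    have "(c, f c) + polar r (arctan m) = (c + r / s, f (c + r / s))"
      unfolding f[OF x] by (simp add: polar_def cs)
    then show ?thesis using bc[OF x] by simp
  qed
  have ev: "\<forall>\<^sub>F r in at_right 0. 0 < r \<and> r < d"
    unfolding eventually_at_right_field using d by blast
  show ?thesis
  proof (cases z)
    case None
    have "\<forall>\<^sub>F r in at_right 0. w ((c, f c) + polar r (arctan m)) = 0"
      using ev by eventually_elim (use pt None in \<open>auto simp: edge_condition_def\<close>)
    then show ?thesis unfolding impedance_ray_def by blast
  next
    case (Some e)
    have "\<forall>\<^sub>F r in at_right 0. of_real (cos (arctan m)) * w2 ((c, f c) + polar r (arctan m))
        - of_real (sin (arctan m)) * w1 ((c, f c) + polar r (arctan m)) + e * w ((c, f c) + polar r (arctan m)) = 0"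
      using ev
    proof eventually_elim
      case (elim r)
      then show ?case
        using pt[of r] Some unfolding cs
        by (simp add: edge_condition_def add_divide_distrib diff_divide_distrib flip: s_def)
    qed
    then show ?thesis unfolding impedance_ray_def by blast
  qed
qed

text \<open>On the opposite direction \<open>pi + arctan m\<close> the normal of the ray points
  downwards, so the condition is negated and the impedance becomes \<open>- e\<close>.\<close>

lemma edge_impedance_ray_left:
  assumes d: "d > 0" and f: "\<And>x. x \<in> {c - d<..<c} \<Longrightarrow> f x = f c + m * (x - c)"
    and bc: "\<And>x. x \<in> {c - d<..<c} \<Longrightarrow> edge_condition z m w w1 w2 (x, f x)"
  shows "impedance_ray (\<lambda>p. w ((c, f c) + p)) (\<lambda>p. w1 ((c, f c) + p)) (\<lambda>p. w2 ((c, f c) + p)) (pi + arctan m)"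
proof -
  define s where "s = sqrt (1 + m\<^sup>2)"
  have s: "s \<ge> 1" by (simp add: s_def)
  have cs: "cos (pi + arctan m) = - (1 / s)" "sin (pi + arctan m) = - (m / s)"
    by (simp_all add: s_def cos_arctan sin_arctan cos_add sin_add)
  have pt: "edge_condition z m w w1 w2 ((c, f c) + polar r (pi + arctan m))" if "0 < r" "r < d" for r
  proof -
    have "r / s \<le> r / 1" using s that by (intro divide_left_mono) auto
    then have x: "c - r / s \<in> {c - d<..<c}" using that s by auto
    have "(c, f c) + polar r (pi + arctan m) = (c - r / s, f (c - r / s))"
      unfolding f[OF x] polar_def cs by simp
    then show ?thesis using bc[OF x] by simp
  qed
  have ev: "\<forall>\<^sub>F r in at_right 0. 0 < r \<and> r < d"
    unfolding eventually_at_right_field using d by blast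
  show ?thesis
  proof (cases z)
    case None
    have "\<forall>\<^sub>F r in at_right 0. w ((c, f c) + polar r (pi + arctan m)) = 0"
      using ev by eventually_elim (use pt None in \<open>auto simp: edge_condition_def\<close>)
    then show ?thesis unfolding impedance_ray_def by blast
  next
    case (Some e)
    have "\<forall>\<^sub>F r in at_right 0. of_real (cos (pi + arctan m)) * w2 ((c, f c) + polar r (pi + arctan m))
        - of_real (sin (pi + arctan m)) * w1 ((c, f c) + polar r (pi + arctan m))
        + (- e) * w ((c, f c) + polar r (pi + arctan m)) = 0"
      using ev
    proof eventually_elim
      case (elim r)
      define q where "q = (c, f c) + polar r (pi + arctan m)"
      have "(- of_real m * w1 q + w2 q) / of_real s + e * w q = 0"
        using pt[of r] elim Some by (simp add: edge_condition_def q_def s_def)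
      then have "- ((- of_real m * w1 q + w2 q) / of_real s + e * w q) = 0" by simp
      then show ?case
        unfolding cs q_def[symmetric] by (simp add: add_divide_distrib diff_divide_distrib)
    qed
    then show ?thesis unfolding impedance_ray_def by blast
  qed
qed

text \<open>One half of the theorem; exchanging the roles of the two gratings gives the other
  half.\<close>

lemma no_corner_off_other_grating:
  fixes \<theta> :: "nat \<Rightarrow> real" and u ut :: "nat \<Rightarrow> real \<times> real \<Rightarrow> complex"
  assumes adm: "admissible_polygonal_grating f C eta" and irr: "irrational_grating f C"
    and admt: "admissible_polygonal_grating ft Ct etat"
    and G: "G \<in> components (Omega f \<inter> Omega ft)"
    and k: "k > 0" and \<theta>: "\<And>l. l \<in> {1, 2} \<Longrightarrow> - (pi / 2) < \<theta> l \<and> \<theta> l < pi / 2" and ne: "\<theta> 1 \<noteq> \<theta> 2"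
    and b: "\<And>x. f x < b" "\<And>x. ft x < b"
    and u: "\<And>l. l \<in> {1, 2} \<Longrightarrow> total_field f C eta k (\<theta> l) (u l)"
    and ut: "\<And>l. l \<in> {1, 2} \<Longrightarrow> total_field ft Ct etat k (\<theta> l) (ut l)"
    and eq: "\<And>l x. l \<in> {1, 2} \<Longrightarrow> x \<in> {0..2 * pi} \<Longrightarrow> u l (x, b) = ut l (x, b)"
    and c: "c \<in> C"
  shows "(c, f c) \<notin> frontier G - Lambda ft"
proof
  assume corner: "(c, f c) \<in> frontier G - Lambda ft"
  note cf = admissible_continuous[OF adm] and cft = admissible_continuous[OF admt]
  note op = open_Omega[OF cf] open_Omega[OF cft]
  have G_eq: "G = Omega f \<inter> Omega ft" by (rule component_Omega_Int[OF cf cft G])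
  \<comment> \<open>The closure of \<open>G\<close> lies weakly above the graph of
    \<open>ft\<close>, and equality would put the corner on that graph.\<close>
  have above: "ft c < f c"
  proof -
    have "continuous_on UNIV (\<lambda>p. ft (fst p))"
      by (rule continuous_on_compose2[OF cft continuous_on_fst[OF continuous_on_id]]) simp
    then have "closed {p. ft (fst p) \<le> snd p}"
      by (rule closed_Collect_le[OF _ continuous_on_snd[OF continuous_on_id]])
    moreover have "G \<subseteq> {p. ft (fst p) \<le> snd p}" unfolding G_eq by (auto simp: Omega_def)
    ultimately have "closure G \<subseteq> {p. ft (fst p) \<le> snd p}" by (rule closure_minimal[rotated])
    then have "ft c \<le> f c" using corner by (auto simp: frontier_def)
    moreover have "f c \<noteq> ft c" using corner by (simp add: Lambda_def)
    ultimately show ?thesis by simp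
  qed
  define x0 where "x0 = (c, f c)"
  have x0: "x0 \<in> Omega ft" using above by (simp add: x0_def Omega_def)
  have "\<exists>v1 v2. helmholtz k (Omega ft) (ut l) v1 v2" if "l \<in> {1, 2}" for l
    using total_fieldE[OF ut[OF that]] by blast
  then obtain p1 p2 q1 q2 where h1: "helmholtz k (Omega ft) (ut 1) p1 p2"
    and h2: "helmholtz k (Omega ft) (ut 2) q1 q2"
    by (metis insertCI)
  have agree: "u l p = ut l p" if l: "l \<in> {1, 2}" and p: "p \<in> Omega f \<inter> Omega ft" for l p
  proof -
    obtain u1 u2 where hu: "helmholtz k (Omega f) (u l) u1 u2" using total_fieldE[OF u[OF l]] by blast
    obtain v1 v2 where hv: "helmholtz k (Omega ft) (ut l) v1 v2" using total_fieldE[OF ut[OF l]] by blast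
    have hd: "helmholtz k (Omega f \<inter> Omega ft) (\<lambda>p. 1 * u l p + (- 1) * ut l p)
        (\<lambda>p. 1 * u1 p + (- 1) * v1 p) (\<lambda>p. 1 * u2 p + (- 1) * v2 p)"
      by (intro helmholtz_cmult_add helmholtz_subset[OF hu] helmholtz_subset[OF hv] Int_lower1 Int_lower2)
    have conn: "connected (Omega f \<inter> Omega ft)"
      using G G_eq in_components_connected by blast
    have "1 * u l p + (- 1) * ut l p = 0"
    proof (rule helmholtz_unique_continuation[OF hd open_Int[OF op] conn _ zero_less_one _ p])
      \<comment> \<open>The unit ball around this point stays above height \<open>b\<close>, where
        the fields already agree.\<close>
      show "(0, b + 1) \<in> Omega f \<inter> Omega ft"
        using b[of 0] by (simp add: Omega_def)
      fix q :: "real \<times> real" assume "q \<in> ball (0, b + 1) 1"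
      then have "dist (b + 1) (snd q) < 1"
        using dist_snd_le[of "(0, b + 1)" q] by simp
      then have "b \<le> snd q" by (simp add: dist_real_def)
      then have "u l (fst q, snd q) = ut l (fst q, snd q)"
        by (rule total_fields_agree_above[OF u[OF l] ut[OF l] b eq[OF l], rotated])
      then show "1 * u l q + (- 1) * ut l q = 0" by simp
    qed
    then show ?thesis by simp
  qed
  \<comment> \<open>Two complex numbers are always linearly dependent.\<close>
  obtain \<alpha> \<gamma> :: complex where nz: "\<alpha> \<noteq> 0 \<or> \<gamma> \<noteq> 0" and w_x0: "\<alpha> * ut 1 x0 + \<gamma> * ut 2 x0 = 0"
  proof (cases "ut 2 x0 = 0")
    case True
    then show ?thesis using that[of 0 1] by simp
  next
    case False
    then show ?thesis using that[of "ut 2 x0" "- ut 1 x0"] by (simp add: mult.commute)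
  qed
  define w where "w p = \<alpha> * ut 1 p + \<gamma> * ut 2 p" for p
  define w1 where "w1 p = \<alpha> * p1 p + \<gamma> * q1 p" for p
  define w2 where "w2 p = \<alpha> * p2 p + \<gamma> * q2 p" for p
  \<comment> \<open>The combination uses the fields of the other grating, which extend through the
    corner.\<close>
  have hw: "helmholtz k (Omega ft) w w1 w2"
    unfolding w_def w1_def w2_def by (rule helmholtz_cmult_add[OF h1 h2])
  obtain d er el where d: "d > 0"
    and right: "\<And>x. x \<in> {c<..<c + d} \<Longrightarrow> x \<notin> C \<and> f x = f c + right_slope f c * (x - c)
      \<and> eta x = er \<and> deriv f x = right_slope f c"
    and left: "\<And>x. x \<in> {c - d<..<c} \<Longrightarrow> x \<notin> C \<and> f x = f c + left_slope f c * (x - c)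
      \<and> eta x = el \<and> deriv f x = left_slope f c"
    by (rule grating_local_structure[OF adm, of c]) blast
  have "open {x. ft x < f x}" by (rule open_Collect_less[OF cft cf])
  then obtain d' where d': "d' > 0" "ball c d' \<subseteq> {x. ft x < f x}"
    using above by (metis mem_Collect_eq openE)
  define \<delta> where "\<delta> = min d d'"
  have \<delta>: "\<delta> > 0" "\<delta> \<le> d" using d d' by (auto simp: \<delta>_def)
  have above': "ft x < f x" if "\<bar>x - c\<bar> < \<delta>" for x
  proof -
    have "x \<in> ball c d'" using that by (simp add: \<delta>_def dist_real_def abs_minus_commute)
    then show ?thesis using d'(2) by blast
  qed
  have edge: "edge_condition (eta x) (deriv f x) w w1 w2 (x, f x)" if "x \<notin> C" "\<bar>x - c\<bar> < \<delta>" for x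
  proof -
    have "edge_condition (eta x) (deriv f x) (ut 1) p1 p2 (x, f x)"
      unfolding edge_condition_def
      by (rule boundary_condition_transfer[OF u h1 cf cft agree that(1) above'[OF that(2)]]) simp_all
    moreover have "edge_condition (eta x) (deriv f x) (ut 2) q1 q2 (x, f x)"
      unfolding edge_condition_def
      by (rule boundary_condition_transfer[OF u h2 cf cft agree that(1) above'[OF that(2)]]) simp_all
    ultimately show ?thesis
      unfolding w_def w1_def w2_def by (rule edge_condition_cmult_add)
  qed
  have ray1: "impedance_ray (\<lambda>p. w (x0 + p)) (\<lambda>p. w1 (x0 + p)) (\<lambda>p. w2 (x0 + p)) (arctan (right_slope f c))"
    unfolding x0_def
  proof (rule edge_impedance_ray_right[OF \<delta>(1)])
    fix x assume x: "x \<in> {c<..<c + \<delta>}"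
    then have x': "x \<in> {c<..<c + d}" "\<bar>x - c\<bar> < \<delta>" using \<delta>(2) by auto
    show "f x = f c + right_slope f c * (x - c)" using right[OF x'(1)] by blast
    show "edge_condition er (right_slope f c) w w1 w2 (x, f x)" using edge[of x] right[OF x'(1)] x'(2) by auto
  qed
  have ray2: "impedance_ray (\<lambda>p. w (x0 + p)) (\<lambda>p. w1 (x0 + p)) (\<lambda>p. w2 (x0 + p)) (pi + arctan (left_slope f c))"
    unfolding x0_def
  proof (rule edge_impedance_ray_left[OF \<delta>(1)])
    fix x assume x: "x \<in> {c - \<delta><..<c}"
    then have x': "x \<in> {c - d<..<c}" "\<bar>x - c\<bar> < \<delta>" using \<delta>(2) by auto
    show "f x = f c + left_slope f c * (x - c)" using left[OF x'(1)] by blast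
    show "edge_condition el (left_slope f c) w w1 w2 (x, f x)" using edge[of x] left[OF x'(1)] x'(2) by auto
  qed
  have angle: "((pi + arctan (left_slope f c)) - arctan (right_slope f c)) / pi \<notin> \<rat>"
    using irr c by (simp add: irrational_grating_def corner_angle_def)
  obtain \<rho> where \<rho>: "\<rho> > 0" "ball x0 \<rho> \<subseteq> Omega ft" by (rule openE[OF op(2) x0])
  obtain R where R: "0 < R" "3 * R \<le> \<rho>" "k\<^sup>2 * R\<^sup>2 \<le> 1" by (rule square_radius_exists[OF \<rho>(1)])
  have in_ft: "x0 + p \<in> Omega ft" if "p \<in> ball 0 (2 * R)" for p
  proof -
    have "dist x0 (x0 + p) < \<rho>" using that R by (simp add: dist_norm)
    then show ?thesis using \<rho>(2) by auto
  qed
  have local_zero: "w (x0 + p) = 0" if "norm p < R" for p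
    by (rule helmholtz_corner_zero[OF helmholtz_translate[OF hw in_ft] open_ball square_subset_ball[OF R(1)] R(3,1)
          _ ray1 ray2 angle that]) (use w_x0 in \<open>simp_all add: w_def\<close>)
  \<comment> \<open>Vanishing near the corner spreads through the connected domain
    \<open>Omega ft\<close>, in particular to the region where the Rayleigh expansions hold.\<close>
  have w_zero: "w p = 0" if "p \<in> Omega ft" for p
  proof (rule helmholtz_unique_continuation[OF hw op(2) connected_Omega[OF cft] x0 R(1) _ that])
    fix q assume "q \<in> ball x0 R"
    then show "w q = 0" using local_zero[of "q - x0"] by (simp add: dist_norm norm_minus_commute)
  qed
  \<comment> \<open>Both orders are recorded because the independence result only yields that the
    first coefficient vanishes.\<close>
  have dep: "\<alpha> * ut 1 (x1, x2) + \<gamma> * ut 2 (x1, x2) = 0" "\<gamma> * ut 2 (x1, x2) + \<alpha> * ut 1 (x1, x2) = 0"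
    if "b \<le> x2" for x1 x2
  proof -
    have "(x1, x2) \<in> Omega ft" using b(2)[of x1] that by (simp add: Omega_def)
    then show "\<alpha> * ut 1 (x1, x2) + \<gamma> * ut 2 (x1, x2) = 0" using w_zero by (simp add: w_def)
    then show "\<gamma> * ut 2 (x1, x2) + \<alpha> * ut 1 (x1, x2) = 0" by (simp add: add.commute)
  qed
  have \<theta>12: "- (pi / 2) < \<theta> 1" "\<theta> 1 < pi / 2" "- (pi / 2) < \<theta> 2" "\<theta> 2 < pi / 2"
    using \<theta>[of 1] \<theta>[of 2] by auto
  have ut12: "total_field ft Ct etat k (\<theta> 1) (ut 1)" "total_field ft Ct etat k (\<theta> 2) (ut 2)"
    using ut by auto
  have "\<alpha> = 0" by (rule total_fields_independent[OF ut12 k \<theta>12 ne b(2) dep(1)])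
  moreover have "\<gamma> = 0"
    by (rule total_fields_independent[OF ut12(2,1) k \<theta>12(3,4,1,2) ne[symmetric] b(2) dep(2)])
  ultimately show False using nz by simp
qed

theorem theorem8p13:
  fixes f ft :: "real \<Rightarrow> real" and C Ct :: "real set"
    and eta etat :: "real \<Rightarrow> complex option"
    and G :: "(real \<times> real) set" and k b :: real and \<theta> :: "nat \<Rightarrow> real"
    and u ut :: "nat \<Rightarrow> real \<times> real \<Rightarrow> complex"
  assumes "admissible_polygonal_grating f C eta" and "irrational_grating f C"
    and "admissible_polygonal_grating ft Ct etat" and "irrational_grating ft Ct"
    and "G \<in> components (Omega f \<inter> Omega ft)" and "\<not> bounded G"
    and "k > 0"
    and "\<forall>l\<in>{1,2}. - (pi / 2) < \<theta> l \<and> \<theta> l < pi / 2"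
    and "\<theta> 1 \<noteq> \<theta> 2"
    and "\<forall>x. \<bar>f x\<bar> < b" and "\<forall>x. \<bar>ft x\<bar> < b"
    and "\<forall>l\<in>{1,2}. uniquely_solvable f C eta k (\<theta> l) \<and> total_field f C eta k (\<theta> l) (u l)"
    and "\<forall>l\<in>{1,2}. uniquely_solvable ft Ct etat k (\<theta> l) \<and> total_field ft Ct etat k (\<theta> l) (ut l)"
    and "\<forall>l\<in>{1,2}. \<forall>x1\<in>{0..2 * pi}. u l (x1, b) = ut l (x1, b)"
  shows "(\<forall>c\<in>C. (c, f c) \<notin> frontier G - Lambda ft) \<and>
         (\<forall>c\<in>Ct. (c, ft c) \<notin> frontier G - Lambda f)"
proof -
  have b: "f x < b" "ft x < b" for x
    using assms(10,11) by (meson abs_le_D1 abs_less_iff)+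
  have \<theta>: "- (pi / 2) < \<theta> l \<and> \<theta> l < pi / 2" if "l \<in> {1, 2}" for l
    using assms(8) that by blast
  have tf: "total_field f C eta k (\<theta> l) (u l)" "total_field ft Ct etat k (\<theta> l) (ut l)" if "l \<in> {1, 2}" for l
    using assms(12,13) that by blast+
  have eq: "u l (x, b) = ut l (x, b)" "ut l (x, b) = u l (x, b)" if "l \<in> {1, 2}" "x \<in> {0..2 * pi}" for l x
    using bspec[OF bspec[OF assms(14) that(1)] that(2)] by simp_all
  have G': "G \<in> components (Omega ft \<inter> Omega f)"
    using assms(5) by (simp add: Int_commute)
  show ?thesis
    using no_corner_off_other_grating[OF assms(1-3,5,7) \<theta> assms(9) b tf eq(1)]
      no_corner_off_other_grating[OF assms(3,4,1) G' assms(7) \<theta> assms(9) b(2,1) tf(2,1) eq(2)]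
    by blast
qed

end
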